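(* Let $(\bar y,\bar p,\bar u)\in H_0^1(\Omega)\times H_0^1(\Omega)\times\mathbb{U}_{ad}$, with associated subgradient $\bar\lambda$, be the solution to the continuous optimality system and, for a mesh $\mathscr{T}\in\mathbb{T}$, let $(\bar y_{\mathscr{T}},\bar p_{\mathscr{T}},\bar u_{\mathscr{T}})\in\mathbb{V}(\mathscr{T})\times\mathbb{V}(\mathscr{T})\times\mathbb{U}_{ad,0}(\mathscr{T})$, with associated discrete subgradient $\bar\lambda_{\mathscr{T}}$, be the solution to the discrete optimality system with piecewise constant controls. Then the error estimator $\mathcal{E}$ satisfies $$\mathcal{E}\lesssim|\!|\!|e|\!|\!|_\Omega+\mathrm{osc}_{\mathscr{T},0}(f;\mathscr{T})+\mathrm{osc}_{\mathscr{T},0}(y_\Omega;\mathscr{T}),$$ where $$|\!|\!|e|\!|\!|_\Omega^2=|\bar y-\bar y_{\mathscr{T}}|_{H^1(\Omega)}^2+|\bar p-\bar p_{\mathscr{T}}|_{H^1(\Omega)}^2+\|\bar u-\bar u_{\mathscr{T}}\|_{L^2(\Omega)}^2+\|\bar\lambda-\bar\lambda_{\mathscr{T}}\|_{L^2(\Omega)}^2$$ and the hidden constant is independent of the optimal variables, their approximations, the size of the elements in the mesh $\mathscr{T}$, and $\#\mathscr{T}$.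
   Context: $A\lesssim B$ means $A\le CB$ with a constant $C$ (with the independence stated in the claim). Data. $d\in\{2,3\}$; $\Omega\subset\mathbb{R}^d$ is an open bounded polytopal domain with Lipschitz boundary; $f,y_\Omega\in L^2(\Omega)$; $\alpha>0$, $\beta>0$; $a,b\in\mathbb{R}$ with $a<0<b$; $\mathbb{U}_{ad}=\{v\in L^2(\Omega): a\le v(x)\le b \text{ for a.e. } x\in\Omega\}$. $|\cdot|_{H^1(\Omega)}=\|\nabla\cdot\|_{L^2(\Omega)}$. Continuous optimality system. With $\psi(u)=\|u\|_{L^1(\Omega)}$ and $\partial\psi$ its convex subdifferential, find $(\bar y,\bar p,\bar u)\in H_0^1(\Omega)\times H_0^1(\Omega)\times\mathbb{U}_{ad}$ and $\bar\lambda\in\partial\psi(\bar u)$ such that $(\nabla\bar y,\nabla v)_{L^2(\Omega)}=(\bar u+f,v)_{L^2(\Omega)}$ for all $v\in H_0^1(\Omega)$; $(\nabla w,\nabla\bar p)_{L^2(\Omega)}=(\bar y-y_\Omega,w)_{L^2(\Omega)}$ for all $w\in H_0^1(\Omega)$; $(\bar p+\alpha\bar u+\beta\bar\lambda,u-\bar u)_{L^2(\Omega)}\ge0$ for all $u\in\mathbb{U}_{ad}$. Both $(\bar y,\bar p,\bar u)$ and $\bar\lambda$ are uniquely determined, and $\bar u=\Pi_{[a,b]}(-\tfrac1\alpha(\bar p+\beta\bar\lambda))$, $\bar\lambda=\Pi_{[-1,1]}(-\tfrac1\beta\bar p)$, where $\Pi_{[\mathfrak a,\mathfrak b]}(v)(x)=\min\{\mathfrak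 b,\max\{\mathfrak a,v(x)\}\}$. Meshes. $\mathbb{T}$ is a collection of conforming, (uniformly) shape regular simplicial meshes $\mathscr{T}=\{K\}$ of $\bar\Omega$ that are refinements of an initial mesh $\mathscr{T}_0$; $h_K=\mathrm{diam}(K)$. $\mathbb{V}(\mathscr{T})$ is the space of continuous functions on $\bar\Omega$ that are affine on each $K\in\mathscr{T}$ and vanish on $\partial\Omega$. Discrete system (piecewise constant controls). $\mathbb{U}_0(\mathscr{T})=\{u_{\mathscr{T}}\in L^2(\Omega): u_{\mathscr{T}}|_K\in\mathbb{P}_0(K)\ \forall K\in\mathscr{T}\}$, $\mathbb{U}_{ad,0}(\mathscr{T})=\mathbb{U}_0(\mathscr{T})\cap\mathbb{U}_{ad}$. Find $(\bar y_{\mathscr{T}},\bar p_{\mathscr{T}},\bar u_{\mathscr{T}})\in\mathbb{V}(\mathscr{T})\times\mathbb{V}(\mathscr{T})\times\mathbb{U}_{ad,0}(\mathscr{T})$ and $\bar\lambda_{\mathscr{T}}\in\partial\psi(\bar u_{\mathscr{T}})$ (subdifferential of $\psi(u_{\mathscr{T}})=\int_\Omega|u_{\mathscr{T}}|\,dx$ on $\mathbb{U}_0(\mathscr{T})$) such that $(\nabla\bar y_{\mathscr{T}},\nabla v_{\mathscr{T}})_{L^2(\Omega)}=(\bar u_{\mathscr{T}}+f,v_{\mathscr{T}})_{L^2(\Omega)}$ and $(\nabla w_{\mathscr{T}},\nabla\bar p_{\mathscr{T}})_{L^2(\Omega)}=(\bar y_{\mathscr{T}}-y_\Omega,w_{\mathscr{T}})_{L^2(\Omega)}$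 for all $v_{\mathscr{T}},w_{\mathscr{T}}\in\mathbb{V}(\mathscr{T})$, and $(\bar p_{\mathscr{T}}+\alpha\bar u_{\mathscr{T}}+\beta\bar\lambda_{\mathscr{T}},u_{\mathscr{T}}-\bar u_{\mathscr{T}})_{L^2(\Omega)}\ge0$ for all $u_{\mathscr{T}}\in\mathbb{U}_{ad,0}(\mathscr{T})$. Here $\bar\lambda_{\mathscr{T}}$ is identified with an element of $\mathbb{U}_0(\mathscr{T})$ satisfying $\bar\lambda_{\mathscr{T}}|_K=1$ if $\bar u_{\mathscr{T}}|_K>0$, $=-1$ if $\bar u_{\mathscr{T}}|_K<0$, and $\in[-1,1]$ if $\bar u_{\mathscr{T}}|_K=0$; it is uniquely determined. Estimator. For an internal $(d-1)$-dimensional interelement side $\gamma$ shared by $K^+\ne K^-$ and $z_{\mathscr{T}}\in\mathbb{V}(\mathscr{T})$, $[\![\nabla z_{\mathscr{T}}\cdot\nu]\!]_\gamma=\nu^+\cdot\nabla z_{\mathscr{T}}|_{K^+}+\nu^-\cdot\nabla z_{\mathscr{T}}|_{K^-}$, where $\nu^\pm$ is the unit normal to $\gamma$ pointing outward of $K^\pm$. Set $\tilde\lambda=\Pi_{[-1,1]}(-\tfrac1\beta\bar p_{\mathscr{T}})$, $\tilde u=\Pi_{[a,b]}(-\tfrac1\alpha(\bar p_{\mathscr{T}}+\beta\tilde\lambda))$ and $\mathcal{E}_{y,K}^2=h_K^2\|\bar u_{\mathscr{T}}+f\|_{L^2(K)}^2+h_K\|[\![\nabla\bar y_{\mathscr{T}}\cdot\nu]\!]_\gamma\|_{L^2(\partial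 K\setminus\partial\Omega)}^2$, $\mathcal{E}_{p,K}^2=h_K^2\|\bar y_{\mathscr{T}}-y_\Omega\|_{L^2(K)}^2+h_K\|[\![\nabla\bar p_{\mathscr{T}}\cdot\nu]\!]_\gamma\|_{L^2(\partial K\setminus\partial\Omega)}^2$, $E_{u,K}^2=\|\tilde u-\bar u_{\mathscr{T}}\|_{L^2(K)}^2$, $E_{\lambda,K}^2=\|\tilde\lambda-\bar\lambda_{\mathscr{T}}\|_{L^2(K)}^2$. The estimator is $\mathcal{E}=\big(\sum_{K\in\mathscr{T}}\mathcal{E}_K^2\big)^{1/2}$ with $\mathcal{E}_K^2=\mathscr{C}_{st}\mathcal{E}_{y,K}^2+\mathscr{C}_{ad}\mathcal{E}_{p,K}^2+\mathscr{C}_{ct}E_{u,K}^2+\mathscr{C}_{sg}E_{\lambda,K}^2$, where $\mathscr{C}_{st},\mathscr{C}_{ad},\mathscr{C}_{ct},\mathscr{C}_{sg}$ are fixed positive constants, independent of the continuous and discrete optimal variables, of the size of the elements of $\mathscr{T}$ and of $\#\mathscr{T}$, for which the reliability bound $|\!|\!|e|\!|\!|_\Omega\le\mathcal{E}$ holds. Oscillation. For $\ell\in\{0,1\}$ (either choice), $\Pi_K^\ell$ is the $L^2(K)$-orthogonal projection onto $\mathbb{P}_\ell(K)$; for $\kappa\in\{0,1\}$, $g\in L^2(\Omega)$ and $\mathscr{M}\subset\mathscr{T}$, $\mathrm{osc}_{\mathscr{T},\kappa}(g;\mathscr{M})=\big(\sum_{K\in\mathscr{M}}h_K^{2(\kappa+1)}\|g-\Pi_K^\ell(g)\|_{L^2(K)}^2\big)^{1/2}$.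 *)

theory Defs
  imports "HOL-Analysis.Analysis"
begin

section \<open>Lebesgue and Sobolev spaces\<close>

text \<open>Elements of function spaces over a set are represented by functions on the whole type.
  Only their values on that set, up to null sets, enter the definitions below; the one exception is
  the finite element space, whose members are continuous representatives on the closure of the domain.\<close>

definition L2 :: "'a::euclidean_space set \<Rightarrow> ('a \<Rightarrow> 'b::euclidean_space) set" where
  "L2 S = {f. f \<in> borel_measurable (lebesgue_on S) \<and>
              integrable (lebesgue_on S) (\<lambda>x. (norm (f x))\<^sup>2)}"

definition L2_inner :: "'a::euclidean_space set \<Rightarrow> ('a \<Rightarrow> 'b::euclidean_space) \<Rightarrow> ('a \<Rightarrow> 'b) \<Rightarrow> real" where
  "L2_inner S f g = (LINT x|lebesgue_on S. f x \<bullet> g x)"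

definition L2_norm :: "'a::euclidean_space set \<Rightarrow> ('a \<Rightarrow> 'b::euclidean_space) \<Rightarrow> real" where
  "L2_norm S f = sqrt (LINT x|lebesgue_on S. (norm (f x))\<^sup>2)"

definition L1_norm :: "'a::euclidean_space set \<Rightarrow> ('a \<Rightarrow> real) \<Rightarrow> real" where
  "L1_norm S f = (LINT x|lebesgue_on S. \<bar>f x\<bar>)"

primrec Ck :: "nat \<Rightarrow> ('a::euclidean_space \<Rightarrow> real) \<Rightarrow> bool" where
  "Ck 0 f \<longleftrightarrow> continuous_on UNIV f"
| "Ck (Suc k) f \<longleftrightarrow>
     (\<forall>x. f differentiable (at x)) \<and> (\<forall>b\<in>Basis. Ck k (\<lambda>x. frechet_derivative f (at x) b))"

definition test_functions :: "'a::euclidean_space set \<Rightarrow> ('a \<Rightarrow> real) set" where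
  "test_functions \<Omega> =
     {\<phi>. (\<forall>k. Ck k \<phi>) \<and> compact (closure {x. \<phi> x \<noteq> 0}) \<and> closure {x. \<phi> x \<noteq> 0} \<subseteq> \<Omega>}"

definition classical_grad :: "('a::euclidean_space \<Rightarrow> real) \<Rightarrow> 'a \<Rightarrow> 'a" where
  "classical_grad \<phi> x = (\<Sum>b\<in>Basis. frechet_derivative \<phi> (at x) b *\<^sub>R b)"

definition has_weak_grad :: "'a::euclidean_space set \<Rightarrow> ('a \<Rightarrow> real) \<Rightarrow> ('a \<Rightarrow> 'a) \<Rightarrow> bool" where
  "has_weak_grad \<Omega> v g \<longleftrightarrow>
     (\<forall>\<phi>\<in>test_functions \<Omega>.
        (LINT x|lebesgue_on \<Omega>. v x *\<^sub>R classical_grad \<phi> x) = - (LINT x|lebesgue_on \<Omega>. \<phi> x *\<^sub>R g x))"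

definition H1 :: "'a::euclidean_space set \<Rightarrow> ('a \<Rightarrow> real) set" where
  "H1 \<Omega> = {v \<in> L2 \<Omega>. \<exists>g\<in>L2 \<Omega>. has_weak_grad \<Omega> v g}"

text \<open>For \<open>v \<in> H1 \<Omega>\<close> the chosen gradient is unique up to a null set.\<close>

definition weak_grad :: "'a::euclidean_space set \<Rightarrow> ('a \<Rightarrow> real) \<Rightarrow> 'a \<Rightarrow> 'a" where
  "weak_grad \<Omega> v = (SOME g. g \<in> L2 \<Omega> \<and> has_weak_grad \<Omega> v g)"

definition H1_seminorm :: "'a::euclidean_space set \<Rightarrow> ('a \<Rightarrow> real) \<Rightarrow> real" where
  "H1_seminorm \<Omega> v = L2_norm \<Omega> (weak_grad \<Omega> v)"

text \<open>The closure of the test functions in the norm of \<open>H1 \<Omega>\<close>.\<close>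

definition H10 :: "'a::euclidean_space set \<Rightarrow> ('a \<Rightarrow> real) set" where
  "H10 \<Omega> = {v \<in> H1 \<Omega>. \<forall>\<epsilon>>0. \<exists>\<phi>\<in>test_functions \<Omega>.
      (L2_norm \<Omega> (\<lambda>x. v x - \<phi> x))\<^sup>2 + (H1_seminorm \<Omega> (\<lambda>x. v x - \<phi> x))\<^sup>2 < \<epsilon>}"


section \<open>Domains and meshes\<close>

text \<open>Near each boundary point, in coordinates given by a unit vector \<open>\<nu>\<close> and its orthogonal complement,
  the domain is the strict subgraph of a Lipschitz function \<open>g\<close>; only the values of \<open>g\<close>
  on the complement of \<open>\<nu>\<close> are used.\<close>

definition lipschitz_boundary :: "'a::euclidean_space set \<Rightarrow> bool" where
  "lipschitz_boundary \<Omega> \<longleftrightarrow>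
     (\<forall>x\<in>frontier \<Omega>. \<exists>r>0. \<exists>\<nu> g L. norm \<nu> = 1 \<and> L-lipschitz_on UNIV (g :: 'a \<Rightarrow> real) \<and>
        \<Omega> \<inter> ball x r = {z \<in> ball x r. z \<bullet> \<nu> < g (z - (z \<bullet> \<nu>) *\<^sub>R \<nu>)})"

definition polytopal_lipschitz_domain :: "'a::euclidean_space set \<Rightarrow> bool" where
  "polytopal_lipschitz_domain \<Omega> \<longleftrightarrow>
     open \<Omega> \<and> connected \<Omega> \<and> \<Omega> \<noteq> {} \<and> bounded \<Omega> \<and>
     (\<exists>P. finite P \<and> (\<forall>S\<in>P. polytope S) \<and> closure \<Omega> = \<Union>P) \<and>
     lipschitz_boundary \<Omega>"

text \<open>Conformity is the face-to-face condition contained in \<^const>\<open>triangulation\<close>.\<close>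

definition conforming_mesh :: "'a::euclidean_space set \<Rightarrow> 'a set set \<Rightarrow> bool" where
  "conforming_mesh \<Omega> \<T> \<longleftrightarrow>
     triangulation \<T> \<and> (\<forall>K\<in>\<T>. int DIM('a) simplex K) \<and> \<Union>\<T> = closure \<Omega>"

definition shape_regular :: "'a::euclidean_space set set set \<Rightarrow> bool" where
  "shape_regular \<TT> \<longleftrightarrow>
     (\<exists>\<sigma>. \<forall>\<T>\<in>\<TT>. \<forall>K\<in>\<T>. \<exists>c. \<exists>r>0. cball c r \<subseteq> K \<and> diameter K \<le> \<sigma> * r)"

definition refinement_of :: "'a set set \<Rightarrow> 'a set set \<Rightarrow> bool" where
  "refinement_of \<T> \<T>\<^sub>0 \<longleftrightarrow> (\<forall>K\<in>\<T>. \<exists>K\<^sub>0\<in>\<T>\<^sub>0. K \<subseteq> K\<^sub>0)"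

definition mesh_family :: "'a::euclidean_space set \<Rightarrow> 'a set set \<Rightarrow> 'a set set set \<Rightarrow> bool" where
  "mesh_family \<Omega> \<T>\<^sub>0 \<TT> \<longleftrightarrow>
     conforming_mesh \<Omega> \<T>\<^sub>0 \<and>
     (\<forall>\<T>\<in>\<TT>. conforming_mesh \<Omega> \<T> \<and> refinement_of \<T> \<T>\<^sub>0) \<and>
     shape_regular \<TT>"


section \<open>Discrete spaces\<close>

text \<open>Polynomials of degree at most \<open>l\<close>, for \<open>l \<in> {0, 1}\<close> only.\<close>

definition Poly01 :: "nat \<Rightarrow> ('a::euclidean_space \<Rightarrow> real) set" where
  "Poly01 l = {\<lambda>x. c + g \<bullet> x | c g. l = 0 \<longrightarrow> g = 0}"

definition fe_space :: "'a::euclidean_space set \<Rightarrow> 'a set set \<Rightarrow> ('a \<Rightarrow> real) set" where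
  "fe_space \<Omega> \<T> =
     {v. continuous_on (closure \<Omega>) v \<and>
         (\<forall>K\<in>\<T>. \<exists>q\<in>Poly01 1. \<forall>x\<in>K. v x = q x) \<and>
         (\<forall>x\<in>frontier \<Omega>. v x = 0)}"

text \<open>Equality holds only almost everywhere on \<open>K\<close>, because neighbouring closed elements overlap.\<close>

definition pw_const :: "'a::euclidean_space set \<Rightarrow> 'a set set \<Rightarrow> ('a \<Rightarrow> real) set" where
  "pw_const \<Omega> \<T> = {v \<in> L2 \<Omega>. \<forall>K\<in>\<T>. \<exists>q\<in>Poly01 0. AE x in lebesgue_on K. v x = q x}"

definition U_ad :: "'a::euclidean_space set \<Rightarrow> real \<Rightarrow> real \<Rightarrow> ('a \<Rightarrow> real) set" where
  "U_ad \<Omega> a b = {v \<in> L2 \<Omega>. AE x in lebesgue_on \<Omega>. a \<le> v x \<and> v x \<le> b}"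

definition L2_proj :: "'a::euclidean_space set \<Rightarrow> nat \<Rightarrow> ('a \<Rightarrow> real) \<Rightarrow> 'a \<Rightarrow> real" where
  "L2_proj K l g = (THE q. q \<in> Poly01 l \<and> (\<forall>r\<in>Poly01 l. L2_inner K (\<lambda>x. g x - q x) r = 0))"


section \<open>Optimality systems\<close>

text \<open>Subdifferential of \<open>\<psi>\<close>, regarded as a functional on the subspace \<open>X\<close> of \<open>L2 \<Omega>\<close>; the dual of \<open>X\<close> is
  identified with \<open>X\<close> by the inner product of \<open>L2 \<Omega>\<close>.\<close>

definition subdifferential ::
  "'a::euclidean_space set \<Rightarrow> ('a \<Rightarrow> real) set \<Rightarrow> (('a \<Rightarrow> real) \<Rightarrow> real) \<Rightarrow> ('a \<Rightarrow> real) \<Rightarrow> ('a \<Rightarrow> real) set" where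
  "subdifferential \<Omega> X \<psi> u =
     {l \<in> X. \<forall>v\<in>X. \<psi> u + L2_inner \<Omega> l (\<lambda>x. v x - u x) \<le> \<psi> v}"

definition optimal ::
  "'a::euclidean_space set \<Rightarrow> real \<Rightarrow> real \<Rightarrow> real \<Rightarrow> real \<Rightarrow> ('a \<Rightarrow> real) \<Rightarrow> ('a \<Rightarrow> real) \<Rightarrow>
   ('a \<Rightarrow> real) \<Rightarrow> ('a \<Rightarrow> real) \<Rightarrow> ('a \<Rightarrow> real) \<Rightarrow> ('a \<Rightarrow> real) \<Rightarrow> bool" where
  "optimal \<Omega> \<alpha> \<beta> a b f y\<^sub>\<Omega> y p u l \<longleftrightarrow>
     y \<in> H10 \<Omega> \<and> p \<in> H10 \<Omega> \<and> u \<in> U_ad \<Omega> a b \<and>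
     l \<in> subdifferential \<Omega> (L2 \<Omega>) (L1_norm \<Omega>) u \<and>
     (\<forall>v\<in>H10 \<Omega>. L2_inner \<Omega> (weak_grad \<Omega> y) (weak_grad \<Omega> v) = L2_inner \<Omega> (\<lambda>x. u x + f x) v) \<and>
     (\<forall>w\<in>H10 \<Omega>. L2_inner \<Omega> (weak_grad \<Omega> w) (weak_grad \<Omega> p) = L2_inner \<Omega> (\<lambda>x. y x - y\<^sub>\<Omega> x) w) \<and>
     (\<forall>v\<in>U_ad \<Omega> a b. 0 \<le> L2_inner \<Omega> (\<lambda>x. p x + \<alpha> * u x + \<beta> * l x) (\<lambda>x. v x - u x))"

definition discrete_optimal ::
  "'a::euclidean_space set \<Rightarrow> 'a set set \<Rightarrow> real \<Rightarrow> real \<Rightarrow> real \<Rightarrow> real \<Rightarrow> ('a \<Rightarrow> real) \<Rightarrow> ('a \<Rightarrow> real) \<Rightarrow>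
   ('a \<Rightarrow> real) \<Rightarrow> ('a \<Rightarrow> real) \<Rightarrow> ('a \<Rightarrow> real) \<Rightarrow> ('a \<Rightarrow> real) \<Rightarrow> bool" where
  "discrete_optimal \<Omega> \<T> \<alpha> \<beta> a b f y\<^sub>\<Omega> y p u l \<longleftrightarrow>
     y \<in> fe_space \<Omega> \<T> \<and> p \<in> fe_space \<Omega> \<T> \<and> u \<in> pw_const \<Omega> \<T> \<inter> U_ad \<Omega> a b \<and>
     l \<in> subdifferential \<Omega> (pw_const \<Omega> \<T>) (L1_norm \<Omega>) u \<and>
     (\<forall>v\<in>fe_space \<Omega> \<T>.
        L2_inner \<Omega> (weak_grad \<Omega> y) (weak_grad \<Omega> v) = L2_inner \<Omega> (\<lambda>x. u x + f x) v) \<and>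
     (\<forall>w\<in>fe_space \<Omega> \<T>.
        L2_inner \<Omega> (weak_grad \<Omega> w) (weak_grad \<Omega> p) = L2_inner \<Omega> (\<lambda>x. y x - y\<^sub>\<Omega> x) w) \<and>
     (\<forall>v\<in>pw_const \<Omega> \<T> \<inter> U_ad \<Omega> a b.
        0 \<le> L2_inner \<Omega> (\<lambda>x. p x + \<alpha> * u x + \<beta> * l x) (\<lambda>x. v x - u x))"


section \<open>Error, estimator and oscillation\<close>

definition total_error ::
  "'a::euclidean_space set \<Rightarrow>
   ('a \<Rightarrow> real) \<Rightarrow> ('a \<Rightarrow> real) \<Rightarrow> ('a \<Rightarrow> real) \<Rightarrow> ('a \<Rightarrow> real) \<Rightarrow>
   ('a \<Rightarrow> real) \<Rightarrow> ('a \<Rightarrow> real) \<Rightarrow> ('a \<Rightarrow> real) \<Rightarrow> ('a \<Rightarrow> real) \<Rightarrow> real" where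
  "total_error \<Omega> y p u l y\<^sub>T p\<^sub>T u\<^sub>T l\<^sub>T =
     sqrt ((H1_seminorm \<Omega> (\<lambda>x. y x - y\<^sub>T x))\<^sup>2 + (H1_seminorm \<Omega> (\<lambda>x. p x - p\<^sub>T x))\<^sup>2 +
           (L2_norm \<Omega> (\<lambda>x. u x - u\<^sub>T x))\<^sup>2 + (L2_norm \<Omega> (\<lambda>x. l x - l\<^sub>T x))\<^sup>2)"

definition clip :: "real \<Rightarrow> real \<Rightarrow> ('a \<Rightarrow> real) \<Rightarrow> 'a \<Rightarrow> real" where
  "clip s t v x = min t (max s (v x))"

text \<open>The constant gradient of a function that is affine on the full-dimensional set \<open>K\<close>.\<close>

definition elem_grad :: "'a::euclidean_space set \<Rightarrow> ('a \<Rightarrow> real) \<Rightarrow> 'a" where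
  "elem_grad K z = (THE g. \<exists>c. \<forall>x\<in>K. z x = c + g \<bullet> x)"

definition outward_normal :: "'a::euclidean_space set \<Rightarrow> 'a set \<Rightarrow> 'a" where
  "outward_normal K \<gamma> =
     (THE \<nu>. norm \<nu> = 1 \<and> (\<exists>c. (\<forall>x\<in>\<gamma>. \<nu> \<bullet> x = c) \<and> (\<forall>x\<in>K. \<nu> \<bullet> x \<le> c)))"

definition internal_sides :: "'a::euclidean_space set set \<Rightarrow> 'a set \<Rightarrow> 'a set set" where
  "internal_sides \<T> K = {\<gamma>. \<gamma> facet_of K \<and> (\<exists>K'\<in>\<T>. K' \<noteq> K \<and> \<gamma> facet_of K')}"

text \<open>For an internal side the sum has exactly two terms, one for each adjacent element.\<close>

definition normal_jump :: "'a::euclidean_space set set \<Rightarrow> ('a \<Rightarrow> real) \<Rightarrow> 'a set \<Rightarrow> real" where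
  "normal_jump \<T> z \<gamma> = (\<Sum>K | K \<in> \<T> \<and> \<gamma> facet_of K. outward_normal K \<gamma> \<bullet> elem_grad K z)"

text \<open>The \<open>(d - 1)\<close>-dimensional measure of a side \<open>\<gamma>\<close> of \<open>K\<close>, computed as the \<open>d\<close>-dimensional Lebesgue
  measure of the right prism of height one over \<open>\<gamma>\<close>.\<close>

definition side_area :: "'a::euclidean_space set \<Rightarrow> 'a set \<Rightarrow> real" where
  "side_area K \<gamma> = measure lebesgue {x + t *\<^sub>R outward_normal K \<gamma> | x t. x \<in> \<gamma> \<and> 0 \<le> t \<and> t \<le> 1}"

text \<open>The squared \<open>L2\<close>-norm of the jump over the part of the boundary of \<open>K\<close> inside the domain. The
  jump is constant on each side.\<close>

definition jump_norm_sq :: "'a::euclidean_space set set \<Rightarrow> ('a \<Rightarrow> real) \<Rightarrow> 'a set \<Rightarrow> real" where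
  "jump_norm_sq \<T> z K = (\<Sum>\<gamma>\<in>internal_sides \<T> K. (normal_jump \<T> z \<gamma>)\<^sup>2 * side_area K \<gamma>)"

text \<open>The indicator of both the state equation (\<open>z = y\<close>, \<open>r = u + f\<close>) and the adjoint
  equation (\<open>z = p\<close>, \<open>r = y - y\<^sub>\<Omega>\<close>); the term \<open>\<Delta> z\<close> vanishes on each element.\<close>

definition residual_indicator_sq ::
  "'a::euclidean_space set set \<Rightarrow> ('a \<Rightarrow> real) \<Rightarrow> ('a \<Rightarrow> real) \<Rightarrow> 'a set \<Rightarrow> real" where
  "residual_indicator_sq \<T> r z K =
     (diameter K)\<^sup>2 * (L2_norm K r)\<^sup>2 + diameter K * jump_norm_sq \<T> z K"

definition lambda_tilde :: "real \<Rightarrow> ('a \<Rightarrow> real) \<Rightarrow> 'a \<Rightarrow> real" where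
  "lambda_tilde \<beta> p = clip (-1) 1 (\<lambda>x. - (1 / \<beta>) * p x)"

definition u_tilde :: "real \<Rightarrow> real \<Rightarrow> real \<Rightarrow> real \<Rightarrow> ('a \<Rightarrow> real) \<Rightarrow> 'a \<Rightarrow> real" where
  "u_tilde \<alpha> \<beta> a b p = clip a b (\<lambda>x. - (1 / \<alpha>) * (p x + \<beta> * lambda_tilde \<beta> p x))"

definition estimator ::
  "'a::euclidean_space set set \<Rightarrow> real \<Rightarrow> real \<Rightarrow> real \<Rightarrow> real \<Rightarrow>
   real \<Rightarrow> real \<Rightarrow> real \<Rightarrow> real \<Rightarrow> ('a \<Rightarrow> real) \<Rightarrow> ('a \<Rightarrow> real) \<Rightarrow>
   ('a \<Rightarrow> real) \<Rightarrow> ('a \<Rightarrow> real) \<Rightarrow> ('a \<Rightarrow> real) \<Rightarrow> ('a \<Rightarrow> real) \<Rightarrow> real" where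
  "estimator \<T> C\<^sub>s\<^sub>t C\<^sub>a\<^sub>d C\<^sub>c\<^sub>t C\<^sub>s\<^sub>g \<alpha> \<beta> a b f y\<^sub>\<Omega> y p u l =
     sqrt (\<Sum>K\<in>\<T>.
       C\<^sub>s\<^sub>t * residual_indicator_sq \<T> (\<lambda>x. u x + f x) y K +
       C\<^sub>a\<^sub>d * residual_indicator_sq \<T> (\<lambda>x. y x - y\<^sub>\<Omega> x) p K +
       C\<^sub>c\<^sub>t * (L2_norm K (\<lambda>x. u_tilde \<alpha> \<beta> a b p x - u x))\<^sup>2 +
       C\<^sub>s\<^sub>g * (L2_norm K (\<lambda>x. lambda_tilde \<beta> p x - l x))\<^sup>2)"

definition osc :: "nat \<Rightarrow> nat \<Rightarrow> ('a::euclidean_space \<Rightarrow> real) \<Rightarrow> 'a set set \<Rightarrow> real" where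
  "osc l \<kappa> g \<M> =
     sqrt (\<Sum>K\<in>\<M>. diameter K ^ (2 * (\<kappa> + 1)) * (L2_norm K (\<lambda>x. g x - L2_proj K l g x))\<^sup>2)"

definition reliable ::
  "'a::euclidean_space set \<Rightarrow> 'a set set set \<Rightarrow> real \<Rightarrow> real \<Rightarrow> real \<Rightarrow> real \<Rightarrow>
   real \<Rightarrow> real \<Rightarrow> real \<Rightarrow> real \<Rightarrow> ('a \<Rightarrow> real) \<Rightarrow> ('a \<Rightarrow> real) \<Rightarrow> bool" where
  "reliable \<Omega> \<TT> C\<^sub>s\<^sub>t C\<^sub>a\<^sub>d C\<^sub>c\<^sub>t C\<^sub>s\<^sub>g \<alpha> \<beta> a b f y\<^sub>\<Omega> \<longleftrightarrow>
     (\<forall>\<T>\<in>\<TT>. \<forall>y p u l y\<^sub>T p\<^sub>T u\<^sub>T l\<^sub>T.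
        optimal \<Omega> \<alpha> \<beta> a b f y\<^sub>\<Omega> y p u l \<and>
        discrete_optimal \<Omega> \<T> \<alpha> \<beta> a b f y\<^sub>\<Omega> y\<^sub>T p\<^sub>T u\<^sub>T l\<^sub>T \<longrightarrow>
        total_error \<Omega> y p u l y\<^sub>T p\<^sub>T u\<^sub>T l\<^sub>T
          \<le> estimator \<T> C\<^sub>s\<^sub>t C\<^sub>a\<^sub>d C\<^sub>c\<^sub>t C\<^sub>s\<^sub>g \<alpha> \<beta> a b f y\<^sub>\<Omega> y\<^sub>T p\<^sub>T u\<^sub>T l\<^sub>T)"

end

(* All test functions are smooth bumps, so they lie in H^1_0 by definition. Testing the residual equation with
   a bump times an affine function inside an element bounds the elementwise residual; testing with a bump
   centred on an interior side, which fits into the two adjacent elements by shape regularity, bounds the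
   normal jump. The volume data enter through affine approximations, whence the oscillation terms. The control
   and subgradient indicators follow from the projection formulas, which are nonexpansive in the adjoint state.
   The lower order terms are absorbed by a Poincare inequality for the difference of an H^1_0 function and a
   finite element function, obtained by approximating the former only. *)
theory Submission
  imports Defs
begin

section \<open>Smooth bump functions\<close>

text \<open>\<open>H10\<close> is a closure of smooth compactly supported functions, so the usual
  polynomial bubbles, which are only piecewise smooth, would have to be approximated before they
  could enter the weak equations. Smooth bumps avoid this, but they rule out scaling to a reference
  simplex and the norm equivalence available there. Explicit bounds on balls replace both: an affine
  function reaches a quarter of its natural size \<open>M\<close> on some ball of radius
  \<open>\<rho>/4\<close> well inside the support of the bump, and the gradient jump across a side
  is constant, so a bump on a small part of the side already sees all of it. Shape regularity then
  enters only through the ratio of a diameter to the radius of such a ball, and the constants of the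
  final bounds depend on the mesh through \<open>\<sigma>\<close> alone. Elementwise integration by
  parts is avoided as well: the gradient of a test function integrates to zero, so a constant vector
  may be subtracted from a piecewise constant gradient before the two are paired.\<close>

lemma Ck_SucI:
  fixes f :: "'a::euclidean_space \<Rightarrow> real"
  assumes "\<And>x. (f has_derivative f' x) (at x)" "\<And>b. b \<in> Basis \<Longrightarrow> Ck k (\<lambda>x. f' x b)"
  shows "Ck (Suc k) f"
proof -
  have "frechet_derivative f (at x) = f' x" for x
    using frechet_derivative_at[OF assms(1)[of x]] by simp
  then show ?thesis using assms by (auto simp: differentiable_def)
qed

lemma Ck_has_derivative:
  assumes "Ck (Suc k) f"
  shows "(f has_derivative frechet_derivative f (at x)) (at x)"
  using assms frechet_derivative_works by auto

lemma Ck_continuous: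
  fixes f :: "'a::euclidean_space \<Rightarrow> real"
  assumes "Ck k f" shows "continuous_on UNIV f"
proof (cases k)
  case (Suc m)
  then show ?thesis using assms
    by (auto intro!: differentiable_imp_continuous_on simp: differentiable_on_def)
qed (use assms in simp)

lemma Ck_Suc_imp:
  fixes f :: "'a::euclidean_space \<Rightarrow> real"
  shows "Ck (Suc k) f \<Longrightarrow> Ck k f"
proof (induction k arbitrary: f)
  case 0 then show ?case using Ck_continuous by fastforce
next
  case (Suc k)
  then show ?case by (metis Ck.simps(2))
qed

lemma Ck_add:
  fixes f g :: "'a::euclidean_space \<Rightarrow> real"
  shows "Ck k f \<Longrightarrow> Ck k g \<Longrightarrow> Ck k (\<lambda>x. f x + g x)"
proof (induction k arbitrary: f g)
  case 0 then show ?case by (auto intro: continuous_intros)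
next
  case (Suc k)
  show ?case
    by (rule Ck_SucI[OF has_derivative_add[OF Ck_has_derivative[OF Suc.prems(1)] Ck_has_derivative[OF Suc.prems(2)]]])
       (use Suc in auto)
qed

lemma Ck_mult:
  fixes f g :: "'a::euclidean_space \<Rightarrow> real"
  shows "Ck k f \<Longrightarrow> Ck k g \<Longrightarrow> Ck k (\<lambda>x. f x * g x)"
proof (induction k arbitrary: f g)
  case 0 then show ?case by (auto intro: continuous_intros)
next
  case (Suc k)
  have "Ck k f" "Ck k g" using Suc.prems Ck_Suc_imp by blast+
  then show ?case
    by (intro Ck_SucI[OF has_derivative_mult[OF Ck_has_derivative[OF Suc.prems(1)] Ck_has_derivative[OF Suc.prems(2)]]]
          Ck_add Suc.IH) (use Suc.prems in auto)
qed

lemma Ck_const: "Ck k (\<lambda>x::'a::euclidean_space. c)"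
proof (induction k arbitrary: c)
  case (Suc k)
  show ?case by (rule Ck_SucI[OF has_derivative_const]) (rule Suc)
qed auto

lemma Ck_inner: "Ck k (\<lambda>x::'a::euclidean_space. x \<bullet> v)"
proof (cases k)
  case (Suc m)
  have "((\<lambda>x. x \<bullet> v) has_derivative (\<lambda>h. h \<bullet> v)) (at x)" for x :: 'a
    by (auto intro!: derivative_eq_intros)
  from Ck_SucI[OF this Ck_const] show ?thesis using Suc by simp
qed (auto intro: continuous_intros)

definition smooth :: "('a::euclidean_space \<Rightarrow> real) \<Rightarrow> bool" where
  "smooth f \<longleftrightarrow> (\<forall>k. Ck k f)"

lemma smooth_intros:
  "smooth (\<lambda>x::'a::euclidean_space. c)"
  "smooth (\<lambda>x::'a. x \<bullet> v)"
  "smooth (f::'a \<Rightarrow> real) \<Longrightarrow> smooth g \<Longrightarrow> smooth (\<lambda>x. f x + g x)"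
  "smooth f \<Longrightarrow> smooth g \<Longrightarrow> smooth (\<lambda>x. f x * g x)"
  by (auto simp: smooth_def Ck_const Ck_inner Ck_add Ck_mult)

lemma smooth_cmult: "smooth f \<Longrightarrow> smooth (\<lambda>x::'a::euclidean_space. c * f x)"
  by (intro smooth_intros)

lemma smooth_diff:
  assumes "smooth f" "smooth g" shows "smooth (\<lambda>x::'a::euclidean_space. f x - g x)"
  using smooth_intros(3)[OF assms(1) smooth_cmult[OF assms(2), of "-1"]] by simp

lemma smooth_sum:
  assumes "\<And>i. i \<in> I \<Longrightarrow> smooth (f i)"
  shows "smooth (\<lambda>x::'a::euclidean_space. \<Sum>i\<in>I. f i x)"
  using assms by (induction I rule: infinite_finite_induct) (auto intro: smooth_intros)

lemma smooth_prod:
  assumes "\<And>i. i \<in> I \<Longrightarrow> smooth (f i)"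
  shows "smooth (\<lambda>x::'a::euclidean_space. \<Prod>i\<in>I. f i x)"
  using assms by (induction I rule: infinite_finite_induct) (auto intro: smooth_intros)

lemma smooth_has_derivative:
  "smooth f \<Longrightarrow> (f has_derivative frechet_derivative f (at x)) (at x)"
  unfolding smooth_def using Ck_has_derivative by blast

lemma smooth_frechet_derivative:
  "smooth f \<Longrightarrow> b \<in> Basis \<Longrightarrow> smooth (\<lambda>x. frechet_derivative f (at x) b)"
  unfolding smooth_def by (metis Ck.simps(2))

lemma smooth_continuous: "smooth f \<Longrightarrow> continuous_on S f"
  unfolding smooth_def using Ck_continuous continuous_on_subset by blast

text \<open>Dividing \<open>exp (- 1 / s)\<close> by powers makes the family closed under differentiation, so that smoothness
  follows by one induction over all \<open>n\<close>.\<close>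

definition flat :: "nat \<Rightarrow> real \<Rightarrow> real" where
  "flat n s = (if s > 0 then exp (- (1 / s)) / s ^ n else 0)"

lemma flat_nonneg: "flat n s \<ge> 0"
  by (simp add: flat_def)

text \<open>The exponential series of \<open>1/s\<close> dominates its term of order
  \<open>Suc n\<close>, so \<open>exp (- (1/s))\<close> beats one more power of \<open>s\<close>
  than is divided out. The linear bound is what the difference quotient at the origin needs.\<close>

lemma flat_le: "flat n s \<le> fact (Suc n) * \<bar>s\<bar>"
proof (cases "s > 0")
  case True
  have "(1/s) ^ Suc n / fact (Suc n) \<le> exp (1/s)"
  proof -
    have "(\<Sum>k\<in>{Suc n}. (1/s)^k /\<^sub>R fact k) \<le> (\<Sum>k. (1/s)^k /\<^sub>R fact k)"
      by (rule sum_le_suminf) (use True summable_exp_generic[of "1/s"] in \<open>auto\<close>)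
    then show ?thesis by (simp add: exp_def divide_inverse mult.commute)
  qed
  then have "1 / (fact (Suc n) * s * s ^ n) \<le> exp (1/s)"
    by (simp add: power_divide mult_ac del: fact_Suc)
  then have "1 / (exp (1/s) * s ^ n) \<le> fact (Suc n) * s"
    using True by (simp add: field_simps del: fact_Suc)
  then show ?thesis using True
    by (simp add: flat_def exp_minus divide_inverse mult_ac del: fact_Suc)
qed (simp add: flat_def mult_nonneg_nonpos del: fact_Suc)

lemma flat_mult: "flat n s = s * flat (Suc n) s"
  by (simp add: flat_def)

lemma flat_has_derivative:
  "(flat n has_field_derivative (flat (n + 2) s - n * flat (n + 1) s)) (at s)"
proof -
  consider "s > 0" | "s < 0" | "s = 0" by linarith
  then show ?thesis
  proof cases
    case 1
    have ev: "\<forall>\<^sub>F t in nhds s. t \<in> {0<..}"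
      using 1 by (intro eventually_nhds_in_open) auto
    have "((\<lambda>t. exp (- (1/t)) / t ^ n) has_field_derivative (flat (n + 2) s - n * flat (n + 1) s)) (at s)"
    proof (rule DERIV_cong)
      show "((\<lambda>t. exp (- (1/t)) / t ^ n) has_field_derivative
          (exp (- (1/s)) * (1 / s\<^sup>2) * s ^ n - exp (- (1/s)) * (real n * s ^ (n - 1))) / (s ^ n * s ^ n)) (at s)"
        using 1 by (auto intro!: derivative_eq_intros simp: power2_eq_square)
      show "(exp (- (1/s)) * (1 / s\<^sup>2) * s ^ n - exp (- (1/s)) * (real n * s ^ (n - 1))) / (s ^ n * s ^ n)
        = flat (n + 2) s - n * flat (n + 1) s"
        using 1 by (cases n) (auto simp: flat_def divide_simps power2_eq_square algebra_simps)
    qed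
    then show ?thesis
      by (rule DERIV_cong_ev[THEN iffD1, rotated -1])
         (use ev in \<open>auto elim!: eventually_mono simp: flat_def\<close>)
  next
    case 2
    have ev: "\<forall>\<^sub>F t in nhds s. t \<in> {..<0}"
      using 2 by (intro eventually_nhds_in_open) auto
    have "((\<lambda>t. 0) has_field_derivative (flat (n + 2) s - n * flat (n + 1) s)) (at s)"
      using 2 by (simp add: flat_def)
    then show ?thesis
      by (rule DERIV_cong_ev[THEN iffD1, rotated -1])
         (use ev in \<open>auto elim!: eventually_mono simp: flat_def\<close>)
  next
    case 3
    \<comment> \<open>Dividing by \<open>h\<close> only raises the index: the quotient is
      \<open>flat (Suc n) h\<close>, which the linear bound squeezes to 0.\<close>
    have "((\<lambda>h. (flat n (0 + h) - flat n 0) / h) \<longlongrightarrow> 0) (at 0)"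
    proof (rule Lim_null_comparison)
      show "\<forall>\<^sub>F h in at 0. norm ((flat n (0 + h) - flat n 0) / h) \<le> fact (n+2) * \<bar>h\<bar>"
      proof (rule eventually_at_filter[THEN iffD2], rule always_eventually, clarify)
        fix h :: real assume "h \<noteq> 0"
        then show "norm ((flat n (0 + h) - flat n 0) / h) \<le> fact (n+2) * \<bar>h\<bar>"
          using flat_le[of "Suc n" h] flat_nonneg[of "Suc n" h] flat_mult[of n h]
          by (simp add: flat_def[of n 0] del: fact_Suc)
      qed
      show "((\<lambda>h::real. fact (n+2) * \<bar>h\<bar>) \<longlongrightarrow> 0) (at 0)"
        by (auto intro!: tendsto_eq_intros)
    qed
    then show ?thesis using 3 by (simp add: DERIV_def flat_def)
  qed
qed

lemma smooth_flat:
  fixes s :: "'a::euclidean_space \<Rightarrow> real"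
  assumes s: "smooth s" shows "smooth (\<lambda>x. flat n (s x))"
proof -
  have "Ck k (\<lambda>x. flat n (s x))" for k n
  proof (induction k arbitrary: n)
    case 0
    have "continuous_on UNIV (flat n)"
      using DERIV_isCont[OF flat_has_derivative] by (simp add: continuous_on_eq_continuous_at)
    then show ?case
      using continuous_on_compose2[of UNIV "flat n" UNIV s] smooth_continuous[OF s] by simp
  next
    case (Suc k)
    let ?D = "\<lambda>x h. (flat (n + 2) (s x) - n * flat (n + 1) (s x)) * frechet_derivative s (at x) h"
    have D: "((\<lambda>x. flat n (s x)) has_derivative ?D x) (at x)" for x
      using has_derivative_compose[OF smooth_has_derivative[OF s] flat_has_derivative[unfolded has_field_derivative_def]]
      by simp
    have "Ck k (\<lambda>x. ?D x b)" if "b \<in> Basis" for b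
    proof -
      have "Ck k (\<lambda>x. frechet_derivative s (at x) b)"
        using smooth_frechet_derivative[OF s that] by (simp add: smooth_def)
      then have "Ck k (\<lambda>x. (flat (n + 2) (s x) + (- real n) * flat (n + 1) (s x)) * frechet_derivative s (at x) b)"
        by (intro Ck_mult Ck_add Ck_const Suc)
      then show ?thesis by simp
    qed
    then show ?case by (rule Ck_SucI[OF D])
  qed
  then show ?thesis by (simp add: smooth_def)
qed

section \<open>Test functions and their classical gradients\<close>

lemma test_functionsI:
  assumes "smooth \<phi>" "compact C" "C \<subseteq> \<Omega>" "\<And>x. x \<notin> C \<Longrightarrow> \<phi> x = 0"
  shows "\<phi> \<in> test_functions \<Omega>"
proof -
  have "closure {x. \<phi> x \<noteq> 0} \<subseteq> C"
    using assms by (intro closure_minimal compact_imp_closed) auto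
  then show ?thesis
    using assms compact_Int_closed[of C "closure {x. \<phi> x \<noteq> 0}"]
    by (auto simp: test_functions_def smooth_def Int_absorb1)
qed

lemma test_functions_smooth: "\<phi> \<in> test_functions \<Omega> \<Longrightarrow> smooth \<phi>"
  by (simp add: test_functions_def smooth_def)

lemma classical_grad_inner:
  assumes "smooth \<phi>"
  shows "classical_grad \<phi> x \<bullet> h = frechet_derivative \<phi> (at x) h"
proof -
  interpret D: bounded_linear "frechet_derivative \<phi> (at x)"
    using smooth_has_derivative[OF assms] has_derivative_bounded_linear by blast
  have "frechet_derivative \<phi> (at x) h = frechet_derivative \<phi> (at x) (\<Sum>b\<in>Basis. (h \<bullet> b) *\<^sub>R b)"
    by (simp add: euclidean_representation)
  also have "\<dots> = (\<Sum>b\<in>Basis. (h \<bullet> b) * frechet_derivative \<phi> (at x) b)"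
    by (simp add: D.sum D.scaleR)
  finally show ?thesis
    by (simp add: classical_grad_def inner_sum_left inner_commute[of h] mult.commute)
qed

lemma classical_grad_eqI:
  assumes "\<And>h. (\<phi> has_derivative (\<lambda>h. g \<bullet> h)) (at x)"
  shows "classical_grad \<phi> x = g"
proof -
  have "frechet_derivative \<phi> (at x) = (\<lambda>h. g \<bullet> h)"
    using frechet_derivative_at[OF assms] by simp
  then show ?thesis by (simp add: classical_grad_def euclidean_representation)
qed

lemma smooth_continuous_grad:
  "smooth \<phi> \<Longrightarrow> continuous_on S (classical_grad \<phi>)"
  unfolding classical_grad_def
  by (intro continuous_intros smooth_continuous smooth_frechet_derivative)

text \<open>The standard mollifier profile. The squared norm is a polynomial in the coordinates, so
  the bump is smooth at its centre as well.\<close>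

definition bump :: "'a::euclidean_space \<Rightarrow> real \<Rightarrow> 'a \<Rightarrow> real" where
  "bump c r x = flat 0 (1 - (norm (x - c))\<^sup>2 / r\<^sup>2)"

lemma smooth_norm_sq: "smooth (\<lambda>x::'a::euclidean_space. (norm (x - c))\<^sup>2)"
proof -
  have "smooth (\<lambda>x::'a. \<Sum>i\<in>Basis. (x \<bullet> i - c \<bullet> i) * (x \<bullet> i - c \<bullet> i))"
    by (intro smooth_intros smooth_sum smooth_diff)
  then show ?thesis
    unfolding power2_norm_eq_inner by (subst euclidean_inner) (simp only: inner_diff_left)
qed

lemma smooth_bump: "smooth (bump (c::'a::euclidean_space) r)"
proof -
  have "smooth (\<lambda>x::'a. flat 0 (1 - (1/r\<^sup>2) * (norm (x - c))\<^sup>2))"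
    by (intro smooth_flat smooth_diff smooth_cmult smooth_norm_sq smooth_intros)
  then show ?thesis by (simp add: bump_def[abs_def])
qed

lemma bump_outside: "r > 0 \<Longrightarrow> x \<notin> ball c r \<Longrightarrow> bump c r x = 0"
  using power_mono[of r "norm (x - c)" 2]
  by (simp add: bump_def flat_def dist_norm norm_minus_commute not_less)

lemma bump_range: "0 \<le> bump c r x" "bump c r x \<le> 1"
  by (auto simp: bump_def flat_def)

text \<open>The value of \<open>exp (- 1 / s)\<close> at \<open>s = 1 - (3/4)\<^sup>2\<close>, i.e. at distance \<open>3/4 * r\<close> from the centre of a bump.\<close>

definition bump_level :: real where "bump_level = exp (- (16/7))"

lemma bump_level_pos: "bump_level > 0" by (simp add: bump_level_def)

text \<open>Valid for every \<open>n\<close> because dividing by a power of \<open>s \<le> 1\<close>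
  only increases the value. It is used with \<open>n = 0\<close> for a bump and with
  \<open>n = 2\<close> for its gradient.\<close>

lemma flat_ge_bump_level:
  assumes "7/16 \<le> s" "s \<le> 1" shows "bump_level \<le> flat n s"
proof -
  have "exp (- (16/7)) \<le> exp (- (1/s))" using assms by (simp add: field_simps)
  also have "\<dots> \<le> exp (- (1/s)) / s ^ n" using assms by (simp add: field_simps power_le_one)
  finally show ?thesis using assms by (simp add: flat_def bump_level_def)
qed

lemma bump_arg_bounds:
  assumes "r > 0" "dist x c \<le> 3/4 * r"
  shows "7/16 \<le> 1 - (norm (x - c))\<^sup>2 / r\<^sup>2" "1 - (norm (x - c))\<^sup>2 / r\<^sup>2 \<le> 1"
proof -
  have "(norm (x - c))\<^sup>2 \<le> (3/4 * r)\<^sup>2" using assms by (intro power_mono) (auto simp: dist_norm)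
  then show "7/16 \<le> 1 - (norm (x - c))\<^sup>2 / r\<^sup>2" using assms by (simp add: field_simps power2_eq_square)
qed simp

lemma bump_ge_bump_level: "r > 0 \<Longrightarrow> dist x c \<le> 3/4 * r \<Longrightarrow> bump_level \<le> bump c r x"
  unfolding bump_def by (intro flat_ge_bump_level bump_arg_bounds)

lemma bump_has_derivative:
  fixes c :: "'a::euclidean_space"
  shows "(bump c r has_derivative
     (\<lambda>h. (- (2 / r\<^sup>2 * flat 2 (1 - (norm (x - c))\<^sup>2 / r\<^sup>2)) *\<^sub>R (x - c)) \<bullet> h)) (at x)"
proof -
  have "((\<lambda>x. 1 - ((x - c) \<bullet> (x - c)) / r\<^sup>2) has_derivative (\<lambda>h. - (2 * ((x - c) \<bullet> h)) / r\<^sup>2)) (at x)"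
    by (auto intro!: derivative_eq_intros simp: inner_commute divide_inverse algebra_simps)
  from has_derivative_compose[OF this flat_has_derivative[unfolded has_field_derivative_def], of 0]
  show ?thesis
    unfolding bump_def[abs_def] power2_norm_eq_inner
    by (rule has_derivative_eq_rhs) (simp add: fun_eq_iff flat_def power2_eq_square)
qed

lemma bump_grad:
  "classical_grad (bump c r) x = - (2 / r\<^sup>2 * flat 2 (1 - (norm (x - c))\<^sup>2 / r\<^sup>2)) *\<^sub>R (x - c)"
  by (rule classical_grad_eqI) (rule bump_has_derivative)

text \<open>With \<open>t = 1/s\<close> this is \<open>t\<^sup>2 / exp t \<le> 2\<close>, from the
  quadratic Taylor bound for \<open>exp\<close>. The index 2 is the one that occurs in the gradient
  of a bump.\<close>

lemma flat2_le: "flat 2 s \<le> 2"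
proof (cases "s > 0")
  case True
  have "(1/s)^2 / 2 \<le> exp (1/s)"
  proof -
    have "0 < 1/s" using True by simp
    then show ?thesis using exp_lower_Taylor_quadratic[of "1/s"] by linarith
  qed
  then show ?thesis using True by (simp add: flat_def exp_minus field_simps)
qed (simp add: flat_def)

lemma bump_grad_outside:
  assumes "r > 0" "x \<notin> ball c r" shows "classical_grad (bump c r) x = 0"
proof -
  have "(norm (x - c))\<^sup>2 \<ge> r\<^sup>2" using assms
    by (intro power_mono) (auto simp: dist_norm norm_minus_commute)
  then have "1 \<le> (norm (x - c))\<^sup>2 / r\<^sup>2" using assms by (simp add: field_simps)
  then show ?thesis unfolding bump_grad by (simp add: flat_def)
qed

lemma bump_grad_bound:
  assumes "r > 0" shows "norm (classical_grad (bump c r) x) \<le> 4 / r"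
proof (cases "x \<in> ball c r")
  case True
  have "norm (classical_grad (bump c r) x) = 2 / r\<^sup>2 * flat 2 (1 - (norm (x - c))\<^sup>2 / r\<^sup>2) * norm (x - c)"
    by (simp add: bump_grad flat_nonneg abs_mult)
  also have "\<dots> \<le> 2 / r\<^sup>2 * 2 * r"
    using True assms by (intro mult_mono flat2_le) (auto simp: dist_norm norm_minus_commute flat_nonneg)
  finally show ?thesis using assms by (simp add: power2_eq_square)
next
  case False
  then show ?thesis using assms bump_grad_outside[OF assms False] by simp
qed

lemma grad_outside:
  assumes "smooth \<phi>" "closed C" "\<And>x. x \<notin> C \<Longrightarrow> \<phi> x = 0" "x \<notin> C"
  shows "classical_grad \<phi> x = 0"
proof (rule classical_grad_eqI)
  have "((\<lambda>x. 0) has_derivative (\<lambda>h. 0 \<bullet> h)) (at x)" by simp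
  then show "(\<phi> has_derivative (\<lambda>h. 0 \<bullet> h)) (at x)"
    by (rule has_derivative_transform_within_open[where s="- C"]) (use assms in auto)
qed

lemma classical_grad_mult:
  assumes "smooth \<phi>" "smooth q"
  shows "classical_grad (\<lambda>x. \<phi> x * q x) x = \<phi> x *\<^sub>R classical_grad q x + q x *\<^sub>R classical_grad \<phi> x"
  by (rule classical_grad_eqI, rule has_derivative_eq_rhs[OF has_derivative_mult[OF smooth_has_derivative[OF assms(1)] smooth_has_derivative[OF assms(2)]]])
     (auto simp: inner_left_distrib classical_grad_inner assms)

lemma classical_grad_affine: "classical_grad (\<lambda>x. A + g \<bullet> x) x = g"
  by (rule classical_grad_eqI) (auto intro!: derivative_eq_intros)

section \<open>Square-integrable functions and integration by parts\<close>

lemma integrable_bounded_scaleR: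
  fixes f :: "'a \<Rightarrow> 'b::{banach, second_countable_topology}" and g :: "'a \<Rightarrow> real"
  assumes "integrable M f" "g \<in> borel_measurable M" "\<And>x. x \<in> space M \<Longrightarrow> \<bar>g x\<bar> \<le> B"
  shows "integrable M (\<lambda>x. g x *\<^sub>R f x)"
proof (rule Bochner_Integration.integrable_bound)
  show "integrable M (\<lambda>x. B *\<^sub>R f x)" using assms(1) by simp
  show "AE x in M. norm (g x *\<^sub>R f x) \<le> norm (B *\<^sub>R f x)"
  proof (rule AE_I2)
    fix x assume "x \<in> space M"
    then have "\<bar>g x\<bar> \<le> \<bar>B\<bar>" using assms(3)[of x] by linarith
    then show "norm (g x *\<^sub>R f x) \<le> norm (B *\<^sub>R f x)" by (simp add: mult_right_mono)
  qed
  show "(\<lambda>x. g x *\<^sub>R f x) \<in> borel_measurable M"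
    by (rule borel_measurable_scaleR[OF assms(2) borel_measurable_integrable[OF assms(1)]])
qed

lemma L2_D:
  assumes "f \<in> L2 S"
  shows "f \<in> borel_measurable (lebesgue_on S)" "integrable (lebesgue_on S) (\<lambda>x. (norm (f x))\<^sup>2)"
  using assms by (auto simp: L2_def)

lemma L2_norm_nonneg: "L2_norm S f \<ge> 0"
  by (simp add: L2_norm_def)

lemma L2_norm_sq: "(L2_norm S f)\<^sup>2 = (LINT x|lebesgue_on S. (norm (f x))\<^sup>2)"
  by (simp add: L2_norm_def)

lemma L2_bound:
  fixes f :: "'a::euclidean_space \<Rightarrow> 'b::euclidean_space" and g :: "'a \<Rightarrow> 'c::euclidean_space"
  assumes "g \<in> L2 S" "f \<in> borel_measurable (lebesgue_on S)"
    and "AE x in lebesgue_on S. norm (f x) \<le> norm (g x)"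
  shows "f \<in> L2 S" "L2_norm S f \<le> L2_norm S g"
proof -
  have AE: "AE x in lebesgue_on S. (norm (f x))\<^sup>2 \<le> (norm (g x))\<^sup>2"
    using assms(3) by eventually_elim (simp add: power_mono)
  have int: "integrable (lebesgue_on S) (\<lambda>x. (norm (f x))\<^sup>2)"
    by (rule Bochner_Integration.integrable_bound[OF L2_D(2)[OF assms(1)]]) (use AE assms(2) in auto)
  then show "f \<in> L2 S" using assms by (simp add: L2_def)
  show "L2_norm S f \<le> L2_norm S g"
    unfolding L2_norm_def
    by (intro real_sqrt_le_mono integral_mono_AE int AE L2_D(2)[OF assms(1)])
qed

lemma L2_norm_cong_AE:
  assumes "AE x in lebesgue_on S. f x = g x"
    "f \<in> borel_measurable (lebesgue_on S)" "g \<in> borel_measurable (lebesgue_on S)"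
  shows "L2_norm S f = L2_norm S g"
  unfolding L2_norm_def
  by (intro arg_cong[where f=sqrt] integral_cong_AE) (use assms in \<open>auto elim!: eventually_mono\<close>)

lemma L2_scaleR:
  fixes f :: "'a::euclidean_space \<Rightarrow> 'b::euclidean_space"
  assumes "f \<in> L2 S" shows "(\<lambda>x. c *\<^sub>R f x) \<in> L2 S"
  using assms by (auto simp: L2_def power_mult_distrib)

lemma L2_add:
  fixes f g :: "'a::euclidean_space \<Rightarrow> 'b::euclidean_space"
  assumes "f \<in> L2 S" "g \<in> L2 S" shows "(\<lambda>x. f x + g x) \<in> L2 S"
proof -
  note [measurable] = L2_D(1)[OF assms(1)] L2_D(1)[OF assms(2)]
  have "integrable (lebesgue_on S) (\<lambda>x. (norm (f x + g x))\<^sup>2)"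
  proof (rule Bochner_Integration.integrable_bound)
    show "integrable (lebesgue_on S) (\<lambda>x. 2 * ((norm (f x))\<^sup>2 + (norm (g x))\<^sup>2))"
      using assms L2_D by (intro integrable_mult_right Bochner_Integration.integrable_add) auto
    have "(norm (u + v))\<^sup>2 \<le> 2 * ((norm u)\<^sup>2 + (norm v)\<^sup>2)" for u v :: 'b
      using power_mono[OF norm_triangle_ineq[of u v], of 2] sum_squares_bound[of "norm u" "norm v"]
      by (simp add: power2_sum)
    then show "AE x in lebesgue_on S. norm ((norm (f x + g x))\<^sup>2) \<le> norm (2 * ((norm (f x))\<^sup>2 + (norm (g x))\<^sup>2))"
      by simp
  qed measurable
  moreover have "(\<lambda>x. f x + g x) \<in> borel_measurable (lebesgue_on S)"
    by (intro borel_measurable_add L2_D(1) assms)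
  ultimately show ?thesis by (simp add: L2_def)
qed

lemma L2_diff:
  fixes f g :: "'a::euclidean_space \<Rightarrow> 'b::euclidean_space"
  assumes "f \<in> L2 S" "g \<in> L2 S" shows "(\<lambda>x. f x - g x) \<in> L2 S"
  using L2_add[OF assms(1) L2_scaleR[OF assms(2), of "-1"]] by simp

lemma L2_inner_integrable:
  fixes f g :: "'a::euclidean_space \<Rightarrow> 'b::euclidean_space"
  assumes "f \<in> L2 S" "g \<in> L2 S"
  shows "integrable (lebesgue_on S) (\<lambda>x. norm (f x) * norm (g x))" "integrable (lebesgue_on S) (\<lambda>x. f x \<bullet> g x)"
proof -
  note [measurable] = L2_D(1)[OF assms(1)] L2_D(1)[OF assms(2)]
  show 1: "integrable (lebesgue_on S) (\<lambda>x. norm (f x) * norm (g x))"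
  proof (rule Bochner_Integration.integrable_bound)
    show "integrable (lebesgue_on S) (\<lambda>x. (norm (f x))\<^sup>2 + (norm (g x))\<^sup>2)"
      using assms L2_D by (intro Bochner_Integration.integrable_add) auto
    have "s * t \<le> s\<^sup>2 + t\<^sup>2" if "s \<ge> 0" "t \<ge> 0" for s t :: real
    proof -
      have "0 \<le> s * t" using that by simp
      then show ?thesis using sum_squares_bound[of s t] by linarith
    qed
    then show "AE x in lebesgue_on S. norm (norm (f x) * norm (g x)) \<le> norm ((norm (f x))\<^sup>2 + (norm (g x))\<^sup>2)"
      by simp
  qed measurable
  show "integrable (lebesgue_on S) (\<lambda>x. f x \<bullet> g x)"
    by (rule Bochner_Integration.integrable_bound[OF 1])
       (auto simp: Cauchy_Schwarz_ineq2 intro!: borel_measurable_inner L2_D(1) assms)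
qed

text \<open>Weighted Young inequality with weight close to \<open>B / A\<close>. Both norms are
  shifted by a positive \<open>e\<close>, so that no case of a vanishing norm has to be split off;
  \<open>e\<close> is chosen to keep the excess \<open>e * (A + B)\<close> below
  \<open>d\<close>.\<close>

lemma L2_Cauchy_Schwarz_norm:
  fixes f g :: "'a::euclidean_space \<Rightarrow> 'b::euclidean_space"
  assumes "f \<in> L2 S" "g \<in> L2 S"
  shows "(LINT x|lebesgue_on S. norm (f x) * norm (g x)) \<le> L2_norm S f * L2_norm S g"
proof (rule field_le_epsilon)
  fix d :: real assume d: "d > 0"
  define A where "A = L2_norm S f"
  define B where "B = L2_norm S g"
  have AB: "A \<ge> 0" "B \<ge> 0" by (auto simp: A_def B_def L2_norm_nonneg)
  define e where "e = d / (A + B + 1)"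
  have e: "e > 0" using d AB by (simp add: e_def)
  define t where "t = (B + e) / (A + e)"
  have t: "t > 0" using AB e by (simp add: t_def add_nonneg_pos)
  have pt: "2 * (u * v) \<le> t * u\<^sup>2 + v\<^sup>2 / t" for u v :: real
  proof -
    have "0 \<le> (t * u - v)\<^sup>2 / t" using t by simp
    also have "\<dots> = t * u\<^sup>2 + v\<^sup>2 / t - 2 * (u * v)" using t by (simp add: field_simps power2_eq_square)
    finally show ?thesis by simp
  qed
  have "2 * (LINT x|lebesgue_on S. norm (f x) * norm (g x)) = (LINT x|lebesgue_on S. 2 * (norm (f x) * norm (g x)))"
    by simp
  also have "\<dots> \<le> (LINT x|lebesgue_on S. t * (norm (f x))\<^sup>2 + (norm (g x))\<^sup>2 / t)"
    by (intro integral_mono) (use L2_inner_integrable(1)[OF assms] L2_D(2)[OF assms(1)] L2_D(2)[OF assms(2)] pt in auto)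
  also have "\<dots> = t * A\<^sup>2 + B\<^sup>2 / t"
    using L2_D(2)[OF assms(1)] L2_D(2)[OF assms(2)] by (simp add: A_def B_def L2_norm_sq)
  also have "t * A\<^sup>2 \<le> (B + e) * A"
  proof -
    have "A\<^sup>2 / (A + e) \<le> A" using AB e by (simp add: divide_simps power2_eq_square algebra_simps)
    then have "(B + e) * (A\<^sup>2 / (A + e)) \<le> (B + e) * A" using AB e by (intro mult_left_mono) auto
    then show ?thesis by (simp add: t_def)
  qed
  also have "B\<^sup>2 / t \<le> B * (A + e)"
  proof -
    have "B\<^sup>2 / (B + e) \<le> B" using AB e by (simp add: divide_simps power2_eq_square algebra_simps)
    then have "(A + e) * (B\<^sup>2 / (B + e)) \<le> (A + e) * B" using AB e by (intro mult_left_mono) auto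
    then show ?thesis by (simp add: t_def mult.commute)
  qed
  finally have "2 * (LINT x|lebesgue_on S. norm (f x) * norm (g x)) \<le> 2 * (A * B) + e * (A + B)"
    by (simp add: algebra_simps)
  also have "e * (A + B) \<le> d"
    using AB d by (simp add: e_def field_simps)
  finally show "(LINT x|lebesgue_on S. norm (f x) * norm (g x)) \<le> L2_norm S f * L2_norm S g + d"
    using d unfolding A_def B_def by linarith
qed

lemma L2_Cauchy_Schwarz:
  fixes f g :: "'a::euclidean_space \<Rightarrow> 'b::euclidean_space"
  assumes "f \<in> L2 S" "g \<in> L2 S"
  shows "\<bar>L2_inner S f g\<bar> \<le> L2_norm S f * L2_norm S g"
proof -
  have "\<bar>L2_inner S f g\<bar> \<le> (LINT x|lebesgue_on S. \<bar>f x \<bullet> g x\<bar>)"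
    using integral_norm_bound[of "lebesgue_on S" "\<lambda>x. f x \<bullet> g x"] by (simp add: L2_inner_def)
  also have "\<dots> \<le> (LINT x|lebesgue_on S. norm (f x) * norm (g x))"
    by (intro integral_mono integrable_abs L2_inner_integrable assms Cauchy_Schwarz_ineq2)
  also note L2_Cauchy_Schwarz_norm[OF assms]
  finally show ?thesis .
qed

lemma L2_triangle:
  fixes f g :: "'a::euclidean_space \<Rightarrow> 'b::euclidean_space"
  assumes "f \<in> L2 S" "g \<in> L2 S"
  shows "L2_norm S (\<lambda>x. f x + g x) \<le> L2_norm S f + L2_norm S g"
proof (rule power2_le_imp_le)
  have "(L2_norm S (\<lambda>x. f x + g x))\<^sup>2 = (LINT x|lebesgue_on S. (norm (f x))\<^sup>2 + 2 * (f x \<bullet> g x) + (norm (g x))\<^sup>2)"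
    by (simp add: L2_norm_sq power2_norm_eq_inner algebra_simps inner_commute)
  also have "\<dots> = (L2_norm S f)\<^sup>2 + 2 * L2_inner S f g + (L2_norm S g)\<^sup>2"
    using L2_inner_integrable(2)[OF assms] L2_D(2)[OF assms(1)] L2_D(2)[OF assms(2)]
    by (simp add: L2_norm_sq L2_inner_def)
  also have "\<dots> \<le> (L2_norm S f + L2_norm S g)\<^sup>2"
    using L2_Cauchy_Schwarz[OF assms] by (simp add: power2_sum)
  finally show "(L2_norm S (\<lambda>x. f x + g x))\<^sup>2 \<le> (L2_norm S f + L2_norm S g)\<^sup>2" .
qed (simp add: L2_norm_nonneg)

lemma L2_norm_scaleR:
  fixes f :: "'a::euclidean_space \<Rightarrow> 'b::euclidean_space"
  shows "L2_norm S (\<lambda>x. c *\<^sub>R f x) = \<bar>c\<bar> * L2_norm S f"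
  by (simp add: L2_norm_def power_mult_distrib real_sqrt_mult)

lemma L2_subset:
  fixes f :: "'a::euclidean_space \<Rightarrow> 'b::euclidean_space"
  assumes "f \<in> L2 S" "A \<subseteq> S" "A \<in> sets lebesgue" "S \<in> sets lebesgue"
  shows "f \<in> L2 A"
proof -
  have "f \<in> borel_measurable (lebesgue_on A)"
    using L2_D(1)[OF assms(1)] assms(2) by (metis measurable_restrict_mono)
  moreover have "integrable (lebesgue_on A) (\<lambda>x. (norm (f x))\<^sup>2)"
  proof -
    have "integrable lebesgue (\<lambda>x. indicator A x *\<^sub>R (indicator S x *\<^sub>R (norm (f x))\<^sup>2))"
      using L2_D(2)[OF assms(1)] assms(3,4)
      by (intro integrable_mult_indicator assms(3) iffD1[OF integrable_restrict_space]) auto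
    moreover have "(\<lambda>x. indicator A x *\<^sub>R (indicator S x *\<^sub>R (norm (f x))\<^sup>2)) = (\<lambda>x. indicat_real A x *\<^sub>R (norm (f x))\<^sup>2)"
      using assms by (auto simp: indicator_def fun_eq_iff)
    ultimately show ?thesis using assms by (simp add: integrable_restrict_space)
  qed
  ultimately show ?thesis by (simp add: L2_def)
qed

lemma L2_imp_integrable:
  fixes f :: "'a::euclidean_space \<Rightarrow> 'b::euclidean_space"
  assumes "f \<in> L2 S" "S \<in> lmeasurable"
  shows "integrable (lebesgue_on S) f"
proof -
  interpret finite_measure "lebesgue_on S" using assms(2) by (rule finite_measure_lebesgue_on)
  show ?thesis
  proof (rule Bochner_Integration.integrable_bound)
    show "integrable (lebesgue_on S) (\<lambda>x. 1 + (norm (f x))\<^sup>2)" using L2_D[OF assms(1)] by simp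
    have "t \<le> 1 + t\<^sup>2" for t :: real
    proof -
      have "2 * t \<le> 1 + t\<^sup>2" using sum_squares_bound[of 1 t] by simp
      moreover have "0 \<le> 1 + t\<^sup>2" by simp
      ultimately show ?thesis by linarith
    qed
    then show "AE x in lebesgue_on S. norm (f x) \<le> norm (1 + (norm (f x))\<^sup>2)" by simp
  qed (use L2_D[OF assms(1)] in simp)
qed

lemma L2_bounded:
  fixes f :: "'a::euclidean_space \<Rightarrow> 'b::euclidean_space"
  assumes "f \<in> borel_measurable (lebesgue_on S)" "S \<in> lmeasurable" "\<And>x. x \<in> S \<Longrightarrow> norm (f x) \<le> B"
  shows "f \<in> L2 S" "(L2_norm S f)\<^sup>2 \<le> B\<^sup>2 * measure lebesgue S"
proof -
  interpret finite_measure "lebesgue_on S" using assms(2) by (rule finite_measure_lebesgue_on)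
  have int: "integrable (lebesgue_on S) (\<lambda>x. (norm (f x))\<^sup>2)"
    by (rule integrable_const_bound[of _ "B\<^sup>2"]) (use assms in \<open>auto intro!: power_mono\<close>)
  then show "f \<in> L2 S" using assms by (simp add: L2_def)
  have "(L2_norm S f)\<^sup>2 \<le> (LINT x|lebesgue_on S. B\<^sup>2)"
    unfolding L2_norm_sq by (intro integral_mono int) (use assms in \<open>auto intro!: power_mono\<close>)
  also have "\<dots> = B\<^sup>2 * measure lebesgue S"
    using assms(2) by (simp add: measure_restrict_space fmeasurable_def mult.commute)
  finally show "(L2_norm S f)\<^sup>2 \<le> B\<^sup>2 * measure lebesgue S" .
qed

lemma L2_norm_mono_set:
  fixes f :: "'a::euclidean_space \<Rightarrow> 'b::euclidean_space"
  assumes "f \<in> L2 S" "A \<subseteq> S" "A \<in> sets lebesgue" "S \<in> sets lebesgue"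
  shows "L2_norm A f \<le> L2_norm S f"
proof -
  have "(LINT x|lebesgue_on A. (norm (f x))\<^sup>2) \<le> (LINT x|lebesgue_on S. (norm (f x))\<^sup>2)"
  proof -
    have "integrable lebesgue (\<lambda>x. indicator A x *\<^sub>R (norm (f x))\<^sup>2)" "integrable lebesgue (\<lambda>x. indicator S x *\<^sub>R (norm (f x))\<^sup>2)"
      using L2_D(2)[OF L2_subset[OF assms]] L2_D(2)[OF assms(1)] assms(3,4) by (simp_all add: integrable_restrict_space)
    then have "(\<integral>x. indicator A x *\<^sub>R (norm (f x))\<^sup>2 \<partial>lebesgue) \<le> (\<integral>x. indicator S x *\<^sub>R (norm (f x))\<^sup>2 \<partial>lebesgue)"
      by (rule integral_mono) (use assms(2) in \<open>auto split: split_indicator\<close>)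
    then show ?thesis using assms(3,4) by (simp add: integral_restrict_space)
  qed
  then show ?thesis by (simp add: L2_norm_def)
qed

section \<open>Vanishing integrals of derivatives\<close>

lemma integral_translate:
  fixes F :: "'a::euclidean_space \<Rightarrow> real"
  assumes "F \<in> borel_measurable borel"
  shows "(LINT x|lborel. F (x + c)) = (LINT x|lborel. F x)"
proof -
  have "(LINT x|lborel. F x) = (LINT x|distr lborel borel ((+) c). F x)"
    by (simp add: lborel_distr_plus)
  also have "\<dots> = (LINT x|lborel. F (c + x))"
    by (rule integral_distr) (use assms in auto)
  finally show ?thesis by (simp add: add.commute)
qed

text \<open>The integral of every difference quotient vanishes by translation invariance of Lebesgue measure; this
  avoids Fubini's theorem and a divergence theorem.\<close>

lemma integral_directional_derivative_0:
  fixes F :: "'a::euclidean_space \<Rightarrow> real"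
  assumes cont: "continuous_on UNIV F"
    and supp: "\<And>x. norm x \<ge> R \<Longrightarrow> F x = 0"
    and lip: "\<And>x h. 0 < h \<Longrightarrow> h \<le> 1 \<Longrightarrow> \<bar>F (x + h *\<^sub>R e) - F x\<bar> \<le> L * h"
    and der: "AE x in lebesgue. (F has_derivative F' x) (at x)"
    and meas: "(\<lambda>x. F' x e) \<in> borel_measurable lebesgue"
    and e: "norm e \<le> 1"
  shows "integrable lebesgue (\<lambda>x. F' x e)" "integral\<^sup>L lebesgue (\<lambda>x. F' x e) = 0"
proof -
  \<comment> \<open>Steps of length \<open>1 / (1 + n)\<close> are at most 1, as the hypothesis on
    increments requires, and they are defined also for \<open>n = 0\<close>.\<close>
  define s where "s n x = (F (x + (1 / (1 + real n)) *\<^sub>R e) - F x) * (1 + real n)" for n x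
  have Fb: "F \<in> borel_measurable borel" using cont by (rule borel_measurable_continuous_onI)
  have Ftb: "(\<lambda>x. F (x + c)) \<in> borel_measurable borel" for c
    by (intro borel_measurable_continuous_onI continuous_on_compose2[OF cont] continuous_intros) auto
  have Fint: "integrable lborel F"
  proof -
    have "integrable lborel (\<lambda>x. indicator (cball 0 R) x *\<^sub>R F x)"
      by (rule borel_integrable_compact) (auto intro: continuous_on_subset[OF cont])
    moreover have "(\<lambda>x. indicator (cball 0 R) x *\<^sub>R F x) = F"
      using supp by (auto simp: indicator_def fun_eq_iff)
    ultimately show ?thesis by (simp only:)
  qed
  have Fint': "integrable lborel (\<lambda>x. F (x + c))" for c
  proof -
    have "integrable (distr lborel borel ((+) c)) F" using Fint by (simp add: lborel_distr_plus)
    then have "integrable lborel (\<lambda>x. F (c + x))" by (subst (asm) integrable_distr_eq) (use Fb in auto)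
    then show ?thesis by (simp add: add.commute)
  qed
  have sb: "s n \<in> borel_measurable borel" for n
    unfolding s_def by (intro borel_measurable_times borel_measurable_diff Fb Ftb borel_measurable_const)
  have s0: "integral\<^sup>L lebesgue (s n) = 0" for n
  proof -
    have "integral\<^sup>L lebesgue (s n) = integral\<^sup>L lborel (s n)"
      using sb by (simp add: integral_completion)
    also have "\<dots> = 0"
      unfolding s_def using Fint Fint' by (simp add: integral_translate[OF Fb])
    finally show ?thesis .
  qed
  \<comment> \<open>A shift has length at most 1, so every difference quotient vanishes outside the
    ball of radius \<open>R + 1\<close> and is bounded by \<open>L\<close> inside it.\<close>
  have w: "integrable lebesgue (\<lambda>x::'a. L * indicat_real (ball 0 (R + 1)) x)"
    using emeasure_lborel_ball_finite[of "0::'a" "R + 1"]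
    by (intro integrable_mult_right) (simp add: integrable_indicator_iff)
  have lim: "(\<lambda>n. s n x) \<longlonglongrightarrow> F' x e" if D: "(F has_derivative F' x) (at x)" for x
  proof -
    interpret D: bounded_linear "F' x" using D has_derivative_bounded_linear by blast
    have g: "((\<lambda>t. x + t *\<^sub>R e) has_derivative (\<lambda>t. t *\<^sub>R e)) (at (0::real))"
      by (auto intro!: derivative_eq_intros)
    have "((\<lambda>t. F (x + t *\<^sub>R e)) has_derivative (\<lambda>t. F' x (t *\<^sub>R e))) (at 0)"
      using has_derivative_compose[OF g, of F "F' x"] D by simp
    then have "((\<lambda>t. F (x + t *\<^sub>R e)) has_field_derivative F' x e) (at 0)"
      by (simp add: has_field_derivative_def D.scaleR mult_commute_abs)
    then have "((\<lambda>h. (F (x + h *\<^sub>R e) - F x) / h) \<longlongrightarrow> F' x e) (at 0)"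
      by (simp add: DERIV_def)
    moreover have "filterlim (\<lambda>n. 1 / (1 + real n)) (at 0) sequentially"
      unfolding filterlim_at using LIMSEQ_inverse_real_of_nat
      by (auto simp: divide_inverse add.commute)
    ultimately have "(\<lambda>n. (F (x + (1 / (1 + real n)) *\<^sub>R e) - F x) / (1 / (1 + real n))) \<longlonglongrightarrow> F' x e"
      by (rule filterlim_compose)
    then show ?thesis by (simp add: s_def)
  qed
  have bnd: "norm (s n x) \<le> L * indicat_real (ball 0 (R + 1)) x" for n x
  proof (cases "x \<in> ball 0 (R + 1)")
    case True
    have "\<bar>F (x + (1 / (1 + real n)) *\<^sub>R e) - F x\<bar> * (1 + real n) \<le> L * (1 / (1 + real n)) * (1 + real n)"
      by (intro mult_right_mono lip) auto
    then show ?thesis using True by (simp add: s_def abs_mult)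
  next
    case False
    define z where "z = (1 / (1 + real n)) *\<^sub>R e"
    have "norm z \<le> 1 * 1"
      unfolding norm_scaleR z_def by (intro mult_mono e) auto
    moreover have "norm x \<le> norm (x + z) + norm z"
      by (metis add_diff_cancel norm_triangle_ineq4)
    ultimately have "R \<le> norm (x + z)" "R \<le> norm x" using False by auto
    then show ?thesis using supp False by (simp add: s_def z_def)
  qed
  note dom = integral_dominated_convergence[where f="\<lambda>x. F' x e" and s=s and M=lebesgue and w="\<lambda>x. L * indicat_real (ball 0 (R + 1)) x"]
    integrable_dominated_convergence[where f="\<lambda>x. F' x e" and s=s and M=lebesgue and w="\<lambda>x. L * indicat_real (ball 0 (R + 1)) x"]
  have sb': "s n \<in> borel_measurable lebesgue" for n using sb by (simp add: measurable_completion)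
  have AEl: "AE x in lebesgue. (\<lambda>n. s n x) \<longlonglongrightarrow> F' x e"
    using der by eventually_elim (rule lim)
  have AEb: "AE x in lebesgue. norm (s n x) \<le> L * indicat_real (ball 0 (R + 1)) x" for n
    by (rule AE_I2) (rule bnd)
  show "integrable lebesgue (\<lambda>x. F' x e)" by (rule dom(2)[OF meas sb' w AEl AEb])
  have "(\<lambda>n. integral\<^sup>L lebesgue (s n)) \<longlonglongrightarrow> integral\<^sup>L lebesgue (\<lambda>x. F' x e)"
    by (rule dom(1)[OF meas sb' w AEl AEb])
  then show "integral\<^sup>L lebesgue (\<lambda>x. F' x e) = 0"
    using s0 LIMSEQ_unique[OF _ tendsto_const] by simp
qed

section \<open>Bounded Lipschitz functions\<close>

definition lipb :: "('a::euclidean_space \<Rightarrow> real) \<Rightarrow> bool" where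
  "lipb f \<longleftrightarrow> (\<exists>M. \<forall>x. \<bar>f x\<bar> \<le> M) \<and> (\<exists>L\<ge>0. \<forall>x y. \<bar>f x - f y\<bar> \<le> L * norm (x - y))"

text \<open>This is why \<open>lipb\<close> asks for boundedness besides the Lipschitz bound:
  integration by parts and the Poincare inequality apply the class to products.\<close>

lemma lipb_mult:
  assumes "lipb f" "lipb g" shows "lipb (\<lambda>x. f x * g x)"
proof -
  obtain M L where f: "\<And>x. \<bar>f x\<bar> \<le> M" "\<And>x y. \<bar>f x - f y\<bar> \<le> L * norm (x - y)" "L \<ge> 0"
    using assms(1) unfolding lipb_def by blast
  obtain N K where g: "\<And>x. \<bar>g x\<bar> \<le> N" "\<And>x y. \<bar>g x - g y\<bar> \<le> K * norm (x - y)" "K \<ge> 0"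
    using assms(2) unfolding lipb_def by blast
  have MN: "M \<ge> 0" "N \<ge> 0" using f(1) g(1) by (meson abs_ge_zero order_trans)+
  have "\<bar>f x * g x - f y * g y\<bar> \<le> (M * K + N * L) * norm (x - y)" for x y
  proof -
    have "f x * g x - f y * g y = f x * (g x - g y) + g y * (f x - f y)" by (simp add: algebra_simps)
    also have "\<bar>\<dots>\<bar> \<le> \<bar>f x\<bar> * \<bar>g x - g y\<bar> + \<bar>g y\<bar> * \<bar>f x - f y\<bar>"
      by (metis abs_mult abs_triangle_ineq)
    also have "\<dots> \<le> M * (K * norm (x - y)) + N * (L * norm (x - y))"
      by (intro add_mono mult_mono f g) (use MN in auto)
    finally show ?thesis by (simp add: algebra_simps)
  qed
  moreover have "M * K + N * L \<ge> 0" using MN f g by simp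
  moreover have "\<bar>f x * g x\<bar> \<le> M * N" for x
    unfolding abs_mult by (intro mult_mono f g MN) auto
  ultimately show ?thesis unfolding lipb_def by blast
qed

lemma lipb_diff:
  assumes "lipb f" "lipb g" shows "lipb (\<lambda>x. f x - g x)"
proof -
  obtain M L where f: "\<And>x. \<bar>f x\<bar> \<le> M" "\<And>x y. \<bar>f x - f y\<bar> \<le> L * norm (x - y)" "L \<ge> 0"
    using assms(1) unfolding lipb_def by blast
  obtain N K where g: "\<And>x. \<bar>g x\<bar> \<le> N" "\<And>x y. \<bar>g x - g y\<bar> \<le> K * norm (x - y)" "K \<ge> 0"
    using assms(2) unfolding lipb_def by blast
  have "\<bar>(f x - g x) - (f y - g y)\<bar> \<le> (L + K) * norm (x - y)" for x y
    using f(2)[of x y] g(2)[of x y] by (simp add: algebra_simps)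
  moreover have "\<bar>f x - g x\<bar> \<le> M + N" for x using f(1)[of x] g(1)[of x] by simp
  moreover have "L + K \<ge> 0" using f g by simp
  ultimately show ?thesis unfolding lipb_def by blast
qed

lemma lipb_continuous: 
  assumes "lipb f" shows "continuous_on S f"
proof -
  obtain L where "\<And>x y. \<bar>f x - f y\<bar> \<le> L * norm (x - y)" "L \<ge> 0" using assms lipb_def by blast
  then have "L-lipschitz_on UNIV f" by (auto simp: lipschitz_on_def dist_norm)
  then show ?thesis using lipschitz_on_continuous_on continuous_on_subset by blast
qed

lemma lipb_inner_clamp: 
  assumes "R \<ge> 0"
  shows "lipb (\<lambda>x. max (- R) (min R (x \<bullet> e)))"
proof -
  have "\<bar>max (- R) (min R (x \<bullet> e)) - max (- R) (min R (y \<bullet> e))\<bar> \<le> norm e * norm (x - y)" for x y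
  proof -
    have "\<bar>max (- R) (min R (x \<bullet> e)) - max (- R) (min R (y \<bullet> e))\<bar> \<le> \<bar>(x - y) \<bullet> e\<bar>"
      by (auto simp: inner_diff_left)
    also have "\<dots> \<le> norm e * norm (x - y)" using Cauchy_Schwarz_ineq2[of "x - y" e] by (simp add: mult.commute)
    finally show ?thesis .
  qed
  moreover have "\<bar>max (- R) (min R (x \<bullet> e))\<bar> \<le> R" for x using assms by auto
  ultimately show ?thesis unfolding lipb_def using norm_ge_zero by blast
qed

lemma lipb_integral_derivative_0:
  assumes "lipb F" "\<And>x. norm x \<ge> R \<Longrightarrow> F x = 0"
    and "AE x in lebesgue. (F has_derivative F' x) (at x)"
    and "(\<lambda>x. F' x e) \<in> borel_measurable lebesgue" "norm e \<le> 1"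
  shows "integrable lebesgue (\<lambda>x. F' x e)" "integral\<^sup>L lebesgue (\<lambda>x. F' x e) = 0"
proof -
  obtain L where L: "\<And>x y. \<bar>F x - F y\<bar> \<le> L * norm (x - y)" "L \<ge> 0"
    using assms(1) unfolding lipb_def by blast
  have "\<bar>F (x + h *\<^sub>R e) - F x\<bar> \<le> L * h" if "0 < h" "h \<le> 1" for x h
  proof -
    have "\<bar>F (x + h *\<^sub>R e) - F x\<bar> \<le> L * (h * norm e)" using L(1)[of "x + h *\<^sub>R e" x] that by simp
    also have "\<dots> \<le> L * (h * 1)" using L(2) that assms(5) by (intro mult_left_mono) auto
    finally show ?thesis by simp
  qed
  from integral_directional_derivative_0[OF lipb_continuous[OF assms(1)] assms(2) this assms(3-5)]
  show "integrable lebesgue (\<lambda>x. F' x e)" "integral\<^sup>L lebesgue (\<lambda>x. F' x e) = 0" by auto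
qed

lemma test_function_bounds:
  assumes "\<phi> \<in> test_functions \<Omega>"
  obtains B where "B \<ge> 0" "\<And>x. \<bar>\<phi> x\<bar> \<le> B" "\<And>x. norm (classical_grad \<phi> x) \<le> B"
proof -
  define C where "C = closure {x. \<phi> x \<noteq> 0}"
  have C: "compact C" using assms by (simp add: test_functions_def C_def)
  have out: "\<phi> x = 0" if "x \<notin> C" for x using that closure_subset[of "{x. \<phi> x \<noteq> 0}"] by (auto simp: C_def)
  note sm = test_functions_smooth[OF assms]
  have gout: "classical_grad \<phi> x = 0" if "x \<notin> C" for x
    using grad_outside[OF sm compact_imp_closed[OF C] out that] .
  obtain B1 where B1: "\<And>x. x \<in> C \<Longrightarrow> \<bar>\<phi> x\<bar> \<le> B1"
    using compact_imp_bounded[OF compact_continuous_image[OF smooth_continuous[OF sm] C]] by (auto simp: bounded_iff)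
  obtain B2 where B2: "\<And>x. x \<in> C \<Longrightarrow> norm (classical_grad \<phi> x) \<le> B2"
    using compact_imp_bounded[OF compact_continuous_image[OF smooth_continuous_grad[OF sm] C]] by (auto simp: bounded_iff)
  show thesis
  proof (rule that[of "\<bar>B1\<bar> + \<bar>B2\<bar>"])
    show "\<bar>\<phi> x\<bar> \<le> \<bar>B1\<bar> + \<bar>B2\<bar>" for x using B1[of x] out[of x] by (cases "x \<in> C") auto
    show "norm (classical_grad \<phi> x) \<le> \<bar>B1\<bar> + \<bar>B2\<bar>" for x using B2[of x] gout[of x] by (cases "x \<in> C") auto
  qed simp
qed

lemma smooth_has_derivative_grad: "smooth \<phi> \<Longrightarrow> (\<phi> has_derivative (\<lambda>h. classical_grad \<phi> x \<bullet> h)) (at x)"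
  using smooth_has_derivative classical_grad_inner by (metis (no_types, lifting) ext)

lemma test_function_lipb:
  assumes "\<phi> \<in> test_functions \<Omega>" shows "lipb \<phi>"
proof -
  obtain B where B: "B \<ge> 0" "\<And>x. \<bar>\<phi> x\<bar> \<le> B" "\<And>x. norm (classical_grad \<phi> x) \<le> B"
    using test_function_bounds[OF assms] by blast
  have "norm (\<phi> x - \<phi> y) \<le> B * norm (x - y)" for x y
  proof (rule differentiable_bound[OF convex_UNIV])
    show "(\<phi> has_derivative (\<lambda>h. classical_grad \<phi> z \<bullet> h)) (at z within UNIV)" for z
      using smooth_has_derivative_grad[OF test_functions_smooth[OF assms]] by blast
    show "onorm (\<lambda>h. classical_grad \<phi> z \<bullet> h) \<le> B" for z
      using B(1,3) by (intro onorm_bound) (auto intro: order_trans[OF Cauchy_Schwarz_ineq2 mult_right_mono])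
  qed auto
  then show ?thesis using B unfolding lipb_def by fastforce
qed

section \<open>Smoothed box indicators and the fundamental lemma of the calculus of
  variations\<close>

definition box_bump :: "'a::euclidean_space \<Rightarrow> 'a \<Rightarrow> nat \<Rightarrow> 'a \<Rightarrow> real" where
  "box_bump p q n x = (\<Prod>i\<in>Basis. flat 0 ((1 + real n) * (x \<bullet> i - p \<bullet> i)) * flat 0 ((1 + real n) * (q \<bullet> i - x \<bullet> i)))"

lemma flat0_le_1: "flat 0 s \<le> 1" by (simp add: flat_def)

lemma flat0_zero: "s \<le> 0 \<Longrightarrow> flat n s = 0" by (simp add: flat_def)

lemma box_bump_range: "0 \<le> box_bump p q n x" "box_bump p q n x \<le> 1"
  unfolding box_bump_def
  by (auto intro!: prod_nonneg mult_nonneg_nonneg flat_nonneg prod_le_1 mult_le_one flat0_le_1)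

lemma box_bump_outside:
  assumes "x \<notin> box p q" shows "box_bump p q n x = 0"
proof -
  obtain i where i: "i \<in> Basis" "x \<bullet> i - p \<bullet> i \<le> 0 \<or> q \<bullet> i - x \<bullet> i \<le> 0"
    using assms by (force simp: mem_box not_less)
  then have "flat 0 ((1 + real n) * (x \<bullet> i - p \<bullet> i)) * flat 0 ((1 + real n) * (q \<bullet> i - x \<bullet> i)) = 0"
    by (auto intro!: flat0_zero mult_nonneg_nonpos simp del: diff_le_0_iff_le diff_le_eq)
  then show ?thesis unfolding box_bump_def using i(1) by (intro prod_zero) auto
qed

text \<open>Inside the box each argument is \<open>(1 + n) * s\<close> with \<open>s > 0\<close>,
  and \<open>exp (- 1 / ((1 + n) * s))\<close> tends to 1; outside, one factor is 0 for every
  \<open>n\<close>.\<close>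

lemma box_bump_limit:
  "(\<lambda>n. box_bump p q n x) \<longlonglongrightarrow> indicat_real (box p q) x"
proof (cases "x \<in> box p q")
  case True
  have "(\<lambda>n. flat 0 ((1 + real n) * s)) \<longlonglongrightarrow> 1" if "s > 0" for s
  proof -
    have "(\<lambda>n. exp (- (inverse (real (Suc n)) * (1 / s)))) \<longlonglongrightarrow> exp (- (0 * (1/s)))"
      by (intro tendsto_intros LIMSEQ_inverse_real_of_nat)
    then show ?thesis using that by (simp add: flat_def divide_inverse mult_ac add.commute)
  qed
  then have "(\<lambda>n. box_bump p q n x) \<longlonglongrightarrow> (\<Prod>i\<in>(Basis::'a set). 1 * 1)"
    unfolding box_bump_def using True by (intro tendsto_intros) (auto simp: mem_box)
  then show ?thesis using True by simp
qed (simp add: box_bump_outside)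

lemma smooth_box_bump: "smooth (box_bump p q n)"
  unfolding box_bump_def[abs_def]
  by (intro smooth_prod smooth_intros smooth_flat smooth_diff)

lemma box_bump_test: "cbox p q \<subseteq> \<Omega> \<Longrightarrow> box_bump p q n \<in> test_functions \<Omega>"
  by (rule test_functionsI[OF smooth_box_bump compact_cbox[of p q]])
     (use box_subset_cbox in \<open>auto intro!: box_bump_outside\<close>)

lemma smooth_borel [measurable]: "smooth \<phi> \<Longrightarrow> \<phi> \<in> borel_measurable borel"
  by (intro borel_measurable_continuous_onI smooth_continuous)

lemma borel_imp_lebesgue_on: "f \<in> borel_measurable borel \<Longrightarrow> f \<in> borel_measurable (lebesgue_on S)"
  by (intro measurable_restrict_space1 measurable_completion) simp

text \<open>Box bumps converge to indicators of boxes, which form an intersection-stable generator of the Borel sets.\<close>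

lemma test_orthogonal_AE_zero:
  fixes h :: "'a::euclidean_space \<Rightarrow> real"
  assumes \<Omega>: "open \<Omega>" and h: "integrable (lebesgue_on \<Omega>) h"
    and orth: "\<And>\<phi>. \<phi> \<in> test_functions \<Omega> \<Longrightarrow> (LINT x|lebesgue_on \<Omega>. \<phi> x * h x) = 0"
  shows "AE x in lebesgue_on \<Omega>. h x = 0"
proof -
  have \<Omega>m: "\<Omega> \<in> sets lebesgue" using \<Omega> by simp
  have "integrable lebesgue (\<lambda>x. indicator \<Omega> x *\<^sub>R h x)"
    using h \<Omega>m by (simp add: integrable_restrict_space)
  then have "(\<lambda>x. indicator \<Omega> x *\<^sub>R h x) \<in> borel_measurable lebesgue" by blast
  \<comment> \<open>A Borel representative, because the induction over generated sets below runs on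
    \<open>lborel\<close>.\<close>
  then obtain H where H: "H \<in> borel_measurable lborel" "AE x in lborel. indicator \<Omega> x *\<^sub>R h x = H x"
    using completion_ex_borel_measurable_real by blast
  have HL: "AE x in lebesgue. H x = indicator \<Omega> x *\<^sub>R h x" 
    using AE_completion[OF H(2)] by eventually_elim simp
  have HM: "H \<in> borel_measurable lebesgue" using H(1) by (rule measurable_completion)
  have "integrable lebesgue H"
    by (rule integrable_cong_AE_imp[OF \<open>integrable lebesgue (\<lambda>x. indicator \<Omega> x *\<^sub>R h x)\<close> HM])
       (use HL in \<open>auto elim: eventually_mono\<close>)
  then have Hint: "integrable lborel H" using H(1) by (simp add: integrable_completion)
  have box0: "(LINT x|lborel. indicator (box p q) x * H x) = 0" if "cbox p q \<subseteq> \<Omega>" for p q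
  proof -
    have "(\<lambda>n. LINT x|lborel. box_bump p q n x * H x) \<longlonglongrightarrow> (LINT x|lborel. indicator (box p q) x * H x)"
    proof (rule integral_dominated_convergence[where w="\<lambda>x. \<bar>H x\<bar>"])
      show "AE x in lborel. (\<lambda>n. box_bump p q n x * H x) \<longlonglongrightarrow> indicat_real (box p q) x * H x"
        by (intro AE_I2 tendsto_mult box_bump_limit tendsto_const)
      show "AE x in lborel. norm (box_bump p q n x * H x) \<le> \<bar>H x\<bar>" for n
        using box_bump_range[of p q n] by (intro AE_I2) (simp add: abs_mult mult_left_le_one_le)
    qed (use H(1) Hint smooth_borel[OF smooth_box_bump] in \<open>auto intro!: borel_measurable_times\<close>)
    moreover have "(LINT x|lborel. box_bump p q n x * H x) = 0" for n
    proof -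
      have m: "(\<lambda>x. box_bump p q n x * H x) \<in> borel_measurable lborel"
        using H(1) smooth_borel[OF smooth_box_bump] by (intro borel_measurable_times) auto
      have "(LINT x|lborel. box_bump p q n x * H x) = (LINT x|lebesgue. box_bump p q n x * H x)"
        using integral_completion[OF m] by simp
      also have "\<dots> = (LINT x|lebesgue. indicator \<Omega> x *\<^sub>R (box_bump p q n x * h x))"
      proof (rule integral_cong_AE)
        show "(\<lambda>x. box_bump p q n x * H x) \<in> borel_measurable lebesgue"
          using m by (rule measurable_completion)
        have "(\<lambda>x. box_bump p q n x * (indicator \<Omega> x *\<^sub>R h x)) \<in> borel_measurable lebesgue"
          by (rule borel_measurable_times[OF measurable_completion \<open>(\<lambda>x. indicator \<Omega> x *\<^sub>R h x) \<in> borel_measurable lebesgue\<close>])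
             (simp add: smooth_borel[OF smooth_box_bump])
        then show "(\<lambda>x. indicator \<Omega> x *\<^sub>R (box_bump p q n x * h x)) \<in> borel_measurable lebesgue"
          by (simp add: mult_ac)
        show "AE x in lebesgue. box_bump p q n x * H x = indicator \<Omega> x *\<^sub>R (box_bump p q n x * h x)"
          using HL by eventually_elim simp
      qed
      also have "\<dots> = 0"
        using orth[OF box_bump_test[OF that]] \<Omega>m by (simp add: integral_restrict_space)
      finally show ?thesis .
    qed
    ultimately show ?thesis using LIMSEQ_unique[OF _ tendsto_const] by simp
  qed
  have AEbox: "AE x in lborel. x \<in> box p q \<longrightarrow> H x = 0" if pq: "cbox p q \<subseteq> \<Omega>" for p q
  proof -
    define F where "F x = indicat_real (box p q) x * H x" for x
    have Fint: "integrable lborel F"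
      unfolding F_def using integrable_mult_indicator[OF _ Hint, of "box p q"] by simp
    \<comment> \<open>It suffices that \<open>F\<close> integrates to zero over every Borel set.
      This extends from boxes to all Borel sets by closure under complements and countable disjoint
      unions.\<close>
    have "AE x in lborel. F x = 0"
    proof (rule sigma_finite_measure.density_zero[OF sigma_finite_lborel Fint])
      fix A :: "'a set" assume "A \<in> sets lborel"
      then have A: "A \<in> sigma_sets UNIV (range (\<lambda>(a, b). box a b))"
        by (simp add: borel_eq_box)
      have Int: "Int_stable (range (\<lambda>(a::'a, b). box a b))"
      proof (rule Int_stableI, clarify)
        fix a b c d :: 'a
        show "box a b \<inter> box c d \<in> range (\<lambda>(a, b). box a b)" unfolding box_Int_box by auto
      qed
      have "range (\<lambda>(a::'a, b). box a b) \<subseteq> Pow UNIV" by simp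
      from Int this A show "set_lebesgue_integral lborel A F = 0"
      proof (induction rule: sigma_sets_induct_disjoint)
        case (basic A)
        then obtain a b where A: "A = box a b" by auto
        \<comment> \<open>Corners of the intersection of the two boxes. Its closed box stays inside
          \<open>cbox p q\<close>, hence inside \<open>\<Omega>\<close>, so \<open>box0\<close>
          applies.\<close>
        define p' where "p' = (\<Sum>i\<in>Basis. max (a \<bullet> i) (p \<bullet> i) *\<^sub>R i)"
        define q' where "q' = (\<Sum>i\<in>Basis. min (b \<bullet> i) (q \<bullet> i) *\<^sub>R i)"
        have "box a b \<inter> box p q = box p' q'" by (simp add: box_Int_box p'_def q'_def)
        moreover have "cbox p' q' \<subseteq> cbox p q" by (auto simp: mem_box p'_def q'_def)
        ultimately have "(LINT x|lborel. indicator (box a b \<inter> box p q) x * H x) = 0"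
          using box0[of p' q'] pq by auto
        then show ?case by (simp add: set_lebesgue_integral_def A F_def indicator_inter_arith mult.assoc)
      next
        case empty then show ?case by (simp add: set_lebesgue_integral_def)
      next
        case (compl A)
        have A: "A \<in> sets borel" using compl(1) by (simp add: borel_eq_box)
        have iA: "integrable lborel (\<lambda>x. indicator A x *\<^sub>R F x)"
          using A Fint by (intro integrable_mult_indicator) auto
        have "set_lebesgue_integral lborel (UNIV - A) F = (LINT x|lborel. F x - indicator A x *\<^sub>R F x)"
          unfolding set_lebesgue_integral_def by (intro Bochner_Integration.integral_cong) (auto simp: indicator_def)
        also have "\<dots> = integral\<^sup>L lborel F - set_lebesgue_integral lborel A F"
          unfolding set_lebesgue_integral_def using iA Fint by (rule Bochner_Integration.integral_diff[rotated])
        also have "integral\<^sup>L lborel F = 0" using box0[OF pq] by (simp add: F_def[abs_def])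
        finally show ?case using compl by simp
      next
        case (union A)
        have A: "A i \<in> sets lborel" for i using union(2) by (auto simp: borel_eq_box)
        have "set_lebesgue_integral lborel (\<Union>i. A i) F = (\<Sum>i. set_lebesgue_integral lborel (A i) F)"
        proof (rule lebesgue_integral_countable_add)
          show "A i \<in> sets lborel" for i by (rule A)
          show "A i \<inter> A j = {}" if "i \<noteq> j" for i j
            using union(1) that by (auto simp: disjoint_family_on_def)
          show "set_integrable lborel (\<Union>i. A i) F"
            unfolding set_integrable_def using A by (intro integrable_mult_indicator Fint) auto
        qed
        then show ?case using union(3) by simp
      qed
    qed
    then show ?thesis by eventually_elim (auto simp: F_def)
  qed
  \<comment> \<open>Countably many closed boxes exhaust \<open>\<Omega>\<close>; each differs from
    its open box by a null set.\<close>
  obtain \<D> where D: "countable \<D>" "\<And>X. X \<in> \<D> \<Longrightarrow> X \<subseteq> \<Omega>" "\<And>X. X \<in> \<D> \<Longrightarrow> \<exists>a b. X = cbox a b" "\<Union>\<D> = \<Omega>"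
    using open_countable_Union_open_cbox[OF \<Omega>] by (metis PowD subset_iff)
  have "AE x in lebesgue. \<forall>X\<in>\<D>. x \<in> X \<longrightarrow> H x = 0"
  proof (subst AE_ball_countable[OF D(1)], intro ballI)
    fix X assume "X \<in> \<D>"
    then obtain p q where X: "X = cbox p q" "cbox p q \<subseteq> \<Omega>" using D by blast
    have "AE x in lebesgue. x \<notin> cbox p q - box p q"
      using negligible_frontier_interval[of p q] by (intro AE_not_in) (simp add: negligible_iff_null_sets)
    with AE_completion[OF AEbox[OF X(2)]]
    show "AE x in lebesgue. x \<in> X \<longrightarrow> H x = 0" by eventually_elim (auto simp: X)
  qed
  with HL have "AE x in lebesgue. x \<in> \<Omega> \<longrightarrow> h x = 0"
    by eventually_elim (use D(4) in \<open>auto simp: indicator_def\<close>)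
  then show ?thesis using \<Omega>m by (simp add: AE_restrict_space_iff)
qed

section \<open>Weak gradients\<close>

lemma open_bounded_lmeasurable: "open S \<Longrightarrow> bounded S \<Longrightarrow> S \<in> lmeasurable"
  using lmeasurable_open by blast

lemma smooth_grad_borel: "smooth \<phi> \<Longrightarrow> classical_grad \<phi> \<in> borel_measurable borel"
  by (intro borel_measurable_continuous_onI smooth_continuous_grad)

lemma test_function_outside:
  assumes "\<phi> \<in> test_functions \<Omega>" "x \<notin> \<Omega>"
  shows "\<phi> x = 0" "classical_grad \<phi> x = 0"
proof -
  define C where "C = closure {x. \<phi> x \<noteq> 0}"
  have out: "\<phi> x = 0" if "x \<notin> C" for x using that closure_subset[of "{x. \<phi> x \<noteq> 0}"] by (auto simp: C_def)
  have "x \<notin> C" using assms by (auto simp: test_functions_def C_def)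
  then show "\<phi> x = 0" by (rule out)
  have "closed C" by (simp add: C_def)
  from grad_outside[OF test_functions_smooth[OF assms(1)] this out \<open>x \<notin> C\<close>]
  show "classical_grad \<phi> x = 0" .
qed

lemma test_function_L2:
  assumes "\<phi> \<in> test_functions \<Omega>" "S \<in> lmeasurable"
  shows "\<phi> \<in> L2 S" "classical_grad \<phi> \<in> L2 S"
proof -
  obtain B where B: "B \<ge> 0" "\<And>x. \<bar>\<phi> x\<bar> \<le> B" "\<And>x. norm (classical_grad \<phi> x) \<le> B"
    using test_function_bounds[OF assms(1)] by blast
  note sm = test_functions_smooth[OF assms(1)]
  show "\<phi> \<in> L2 S"
    by (rule L2_bounded[OF borel_imp_lebesgue_on[OF smooth_borel[OF sm]] assms(2)]) (use B in auto)
  show "classical_grad \<phi> \<in> L2 S"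
    by (rule L2_bounded[OF borel_imp_lebesgue_on[OF smooth_grad_borel[OF sm]] assms(2)]) (use B in auto)
qed

lemma weak_grad_pairing_integrable:
  assumes "\<phi> \<in> test_functions \<Omega>" "S \<in> lmeasurable" "v \<in> L2 S" "g \<in> L2 S"
  shows "integrable (lebesgue_on S) (\<lambda>x. v x *\<^sub>R classical_grad \<phi> x)" "integrable (lebesgue_on S) (\<lambda>x. \<phi> x *\<^sub>R g x)"
proof -
  obtain B where B: "B \<ge> 0" "\<And>x. \<bar>\<phi> x\<bar> \<le> B" "\<And>x. norm (classical_grad \<phi> x) \<le> B"
    using test_function_bounds[OF assms(1)] by blast
  note sm = test_functions_smooth[OF assms(1)]
  show "integrable (lebesgue_on S) (\<lambda>x. \<phi> x *\<^sub>R g x)"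
    by (rule integrable_bounded_scaleR[OF L2_imp_integrable[OF assms(4,2)] borel_imp_lebesgue_on[OF smooth_borel[OF sm]] B(2)])
  show "integrable (lebesgue_on S) (\<lambda>x. v x *\<^sub>R classical_grad \<phi> x)"
  proof (rule Bochner_Integration.integrable_bound)
    show "integrable (lebesgue_on S) (\<lambda>x. norm (v x) * norm (classical_grad \<phi> x))"
      using L2_inner_integrable(1)[OF assms(3), of "\<lambda>x. norm (classical_grad \<phi> x)"]
            L2_bound(1)[OF test_function_L2(2)[OF assms(1,2)], of "\<lambda>x. norm (classical_grad \<phi> x)"]
            borel_imp_lebesgue_on[OF smooth_grad_borel[OF sm]]
      by simp
    show "(\<lambda>x. v x *\<^sub>R classical_grad \<phi> x) \<in> borel_measurable (lebesgue_on S)"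
      by (rule borel_measurable_scaleR[OF L2_D(1)[OF assms(3)] borel_imp_lebesgue_on[OF smooth_grad_borel[OF sm]]])
  qed auto
qed

text \<open>The product of \<open>v\<close> with a test function is Lipschitz and vanishes outside
  \<open>\<Omega>\<close>, so its partial derivatives integrate to zero over the whole space. By the
  product rule this is the defining identity, one coordinate at a time.\<close>

lemma lipb_has_weak_grad:
  fixes v :: "'a::euclidean_space \<Rightarrow> real"
  assumes \<Omega>: "open \<Omega>" "bounded \<Omega>" and v: "lipb v"
    and der: "AE x in lebesgue. (v has_derivative (\<lambda>h. g x \<bullet> h)) (at x)"
    and g: "g \<in> borel_measurable lebesgue" "\<And>x. norm (g x) \<le> B"
  shows "v \<in> L2 \<Omega>" "g \<in> L2 \<Omega>" "has_weak_grad \<Omega> v g"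
proof -
  note \<Omega>m = open_bounded_lmeasurable[OF \<Omega>]
  obtain M where M: "\<And>x. \<bar>v x\<bar> \<le> M" using v lipb_def by blast
  have vb: "v \<in> borel_measurable borel" by (intro borel_measurable_continuous_onI lipb_continuous v)
  show v2: "v \<in> L2 \<Omega>" by (rule L2_bounded[OF borel_imp_lebesgue_on[OF vb] \<Omega>m]) (use M in auto)
  have gm: "g \<in> borel_measurable (lebesgue_on S)" for S using g(1) by (rule measurable_restrict_space1)
  show g2: "g \<in> L2 \<Omega>" by (rule L2_bounded[OF gm \<Omega>m g(2)])
  show "has_weak_grad \<Omega> v g"
    unfolding has_weak_grad_def
  proof
    fix \<phi> assume \<phi>: "\<phi> \<in> test_functions \<Omega>"
    note sm = test_functions_smooth[OF \<phi>]
    note int = weak_grad_pairing_integrable[OF \<phi> \<Omega>m v2 g2]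
    obtain R where R: "\<Omega> \<subseteq> ball 0 R" using bounded_subset_ballD[OF \<Omega>(2)] by blast
    define G where "G x = v x *\<^sub>R classical_grad \<phi> x + \<phi> x *\<^sub>R g x" for x
    have Gm: "G \<in> borel_measurable lebesgue"
    proof -
      have "v \<in> borel_measurable lebesgue" "\<phi> \<in> borel_measurable lebesgue" "classical_grad \<phi> \<in> borel_measurable lebesgue"
        using vb smooth_borel[OF sm] smooth_grad_borel[OF sm] by (auto intro!: measurable_completion)
      then show ?thesis unfolding G_def[abs_def] using g(1) by (intro borel_measurable_add borel_measurable_scaleR)
    qed
    have "(LINT x|lebesgue. G x \<bullet> b) = 0" if b: "b \<in> Basis" for b
    proof (rule lipb_integral_derivative_0(2)[where F="\<lambda>x. v x * \<phi> x" and F'="\<lambda>x h. G x \<bullet> h" and e=b and R=R])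
      show "lipb (\<lambda>x. v x * \<phi> x)" by (rule lipb_mult[OF v test_function_lipb[OF \<phi>]])
      show "v x * \<phi> x = 0" if "R \<le> norm x" for x
        using that R test_function_outside(1)[OF \<phi>, of x] by (cases "x \<in> \<Omega>") auto
      show "AE x in lebesgue. ((\<lambda>x. v x * \<phi> x) has_derivative (\<lambda>h. G x \<bullet> h)) (at x)"
        using der
      proof eventually_elim
        case (elim x)
        show ?case
          by (rule has_derivative_eq_rhs[OF has_derivative_mult[OF elim smooth_has_derivative_grad[OF sm]]])
             (auto simp: G_def inner_left_distrib)
      qed
      show "(\<lambda>x. G x \<bullet> b) \<in> borel_measurable lebesgue" using Gm by simp
    qed (use b in simp)
    moreover have "(LINT x|lebesgue. G x \<bullet> b) = (LINT x|lebesgue_on \<Omega>. G x) \<bullet> b" for b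
    proof -
      have "(LINT x|lebesgue_on \<Omega>. G x) \<bullet> b = (LINT x|lebesgue_on \<Omega>. G x \<bullet> b)"
        using int by (intro integral_inner_left[symmetric]) (simp add: G_def[abs_def])
      also have "\<dots> = (LINT x|lebesgue. indicator \<Omega> x *\<^sub>R (G x \<bullet> b))"
        using \<Omega>m by (intro integral_restrict_space) auto
      also have "(\<lambda>x. indicator \<Omega> x *\<^sub>R (G x \<bullet> b)) = (\<lambda>x. G x \<bullet> b)"
        using test_function_outside[OF \<phi>] by (auto simp: G_def indicator_def fun_eq_iff)
      finally show ?thesis by simp
    qed
    ultimately have "(LINT x|lebesgue_on \<Omega>. G x) = 0" by (metis euclidean_all_zero_iff)
    then have "(LINT x|lebesgue_on \<Omega>. v x *\<^sub>R classical_grad \<phi> x) + (LINT x|lebesgue_on \<Omega>. \<phi> x *\<^sub>R g x) = 0"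
      using int by (simp add: G_def[abs_def])
    then show "(LINT x|lebesgue_on \<Omega>. v x *\<^sub>R classical_grad \<phi> x) = - (LINT x|lebesgue_on \<Omega>. \<phi> x *\<^sub>R g x)"
      by (simp add: eq_neg_iff_add_eq_0)
  qed
qed

lemma has_weak_grad_cong:
  assumes "\<And>x. x \<in> \<Omega> \<Longrightarrow> v x = w x"
  shows "has_weak_grad \<Omega> v g = has_weak_grad \<Omega> w g"
proof -
  have "(LINT x|lebesgue_on \<Omega>. v x *\<^sub>R classical_grad \<phi> x) = (LINT x|lebesgue_on \<Omega>. w x *\<^sub>R classical_grad \<phi> x)" for \<phi>
    by (rule Bochner_Integration.integral_cong) (use assms in auto)
  then show ?thesis by (simp add: has_weak_grad_def)
qed

lemma L2_cong:
  fixes f g :: "'a::euclidean_space \<Rightarrow> 'b::euclidean_space"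
  assumes "\<And>x. x \<in> S \<Longrightarrow> f x = g x"
  shows "f \<in> L2 S \<longleftrightarrow> g \<in> L2 S" "L2_norm S f = L2_norm S g"
proof -
  have "integrable (lebesgue_on S) (\<lambda>x. (norm (f x))\<^sup>2) \<longleftrightarrow> integrable (lebesgue_on S) (\<lambda>x. (norm (g x))\<^sup>2)"
    by (rule Bochner_Integration.integrable_cong) (use assms in auto)
  then show "f \<in> L2 S \<longleftrightarrow> g \<in> L2 S"
    using measurable_lebesgue_cong[of S f g borel, OF assms] by (simp add: L2_def)
  have "(LINT x|lebesgue_on S. (norm (f x))\<^sup>2) = (LINT x|lebesgue_on S. (norm (g x))\<^sup>2)"
    by (rule Bochner_Integration.integral_cong) (use assms in auto)
  then show "L2_norm S f = L2_norm S g" by (simp add: L2_norm_def)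
qed

text \<open>Every coordinate of the difference is orthogonal to all test functions. This pins down
  \<open>weak_grad\<close>, which is only a choice, whenever an explicit gradient is known.\<close>

lemma has_weak_grad_unique:
  fixes g1 g2 :: "'a::euclidean_space \<Rightarrow> 'a"
  assumes \<Omega>: "open \<Omega>" "bounded \<Omega>"
    and v: "v \<in> L2 \<Omega>" and g: "g1 \<in> L2 \<Omega>" "g2 \<in> L2 \<Omega>" "has_weak_grad \<Omega> v g1" "has_weak_grad \<Omega> v g2"
  shows "AE x in lebesgue_on \<Omega>. g1 x = g2 x"
proof -
  note \<Omega>m = open_bounded_lmeasurable[OF \<Omega>]
  have "AE x in lebesgue_on \<Omega>. (g1 x - g2 x) \<bullet> b = 0" for b
  proof (rule test_orthogonal_AE_zero[OF \<Omega>(1)])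
    show "integrable (lebesgue_on \<Omega>) (\<lambda>x. (g1 x - g2 x) \<bullet> b)"
      by (intro integrable_inner_left L2_imp_integrable L2_diff g \<Omega>m)
    fix \<phi> assume \<phi>: "\<phi> \<in> test_functions \<Omega>"
    note int = weak_grad_pairing_integrable(2)[OF \<phi> \<Omega>m v g(1)] weak_grad_pairing_integrable(2)[OF \<phi> \<Omega>m v g(2)]
    have "(LINT x|lebesgue_on \<Omega>. \<phi> x * ((g1 x - g2 x) \<bullet> b)) = (LINT x|lebesgue_on \<Omega>. (\<phi> x *\<^sub>R g1 x - \<phi> x *\<^sub>R g2 x) \<bullet> b)"
      by (simp add: inner_diff_left algebra_simps)
    also have "\<dots> = (LINT x|lebesgue_on \<Omega>. \<phi> x *\<^sub>R g1 x - \<phi> x *\<^sub>R g2 x) \<bullet> b"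
      using int by (intro integral_inner_left) simp
    also have "(LINT x|lebesgue_on \<Omega>. \<phi> x *\<^sub>R g1 x - \<phi> x *\<^sub>R g2 x) = (LINT x|lebesgue_on \<Omega>. \<phi> x *\<^sub>R g1 x) - (LINT x|lebesgue_on \<Omega>. \<phi> x *\<^sub>R g2 x)"
      using int by simp
    also have "\<dots> = 0" using g(3,4) \<phi> by (simp add: has_weak_grad_def)
    finally show "(LINT x|lebesgue_on \<Omega>. \<phi> x * ((g1 x - g2 x) \<bullet> b)) = 0" by simp
  qed
  then have "AE x in lebesgue_on \<Omega>. \<forall>b\<in>Basis. (g1 x - g2 x) \<bullet> b = 0"
    by (subst AE_ball_countable) (auto simp: countable_finite)
  then show ?thesis by eventually_elim (metis eq_iff_diff_eq_0 euclidean_all_zero_iff)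
qed

lemma H1_D:
  assumes "v \<in> H1 \<Omega>"
  shows "v \<in> L2 \<Omega>" "weak_grad \<Omega> v \<in> L2 \<Omega>" "has_weak_grad \<Omega> v (weak_grad \<Omega> v)"
proof -
  show "v \<in> L2 \<Omega>" using assms by (simp add: H1_def)
  have "\<exists>g. g \<in> L2 \<Omega> \<and> has_weak_grad \<Omega> v g" using assms by (auto simp: H1_def)
  from someI_ex[OF this] show "weak_grad \<Omega> v \<in> L2 \<Omega>" "has_weak_grad \<Omega> v (weak_grad \<Omega> v)"
    by (auto simp: weak_grad_def)
qed

lemma H1_I:
  assumes "open \<Omega>" "bounded \<Omega>" "v \<in> L2 \<Omega>" "g \<in> L2 \<Omega>" "has_weak_grad \<Omega> v g"
  shows "v \<in> H1 \<Omega>" "AE x in lebesgue_on \<Omega>. weak_grad \<Omega> v x = g x"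
proof -
  show H: "v \<in> H1 \<Omega>" using assms by (auto simp: H1_def)
  show "AE x in lebesgue_on \<Omega>. weak_grad \<Omega> v x = g x"
    by (rule has_weak_grad_unique[OF assms(1,2,3) H1_D(2)[OF H] assms(4) H1_D(3)[OF H] assms(5)])
qed

lemma has_weak_grad_diff:
  assumes "open \<Omega>" "bounded \<Omega>" "u \<in> L2 \<Omega>" "v \<in> L2 \<Omega>" "g \<in> L2 \<Omega>" "k \<in> L2 \<Omega>"
    "has_weak_grad \<Omega> u g" "has_weak_grad \<Omega> v k"
  shows "has_weak_grad \<Omega> (\<lambda>x. u x - v x) (\<lambda>x. g x - k x)"
  unfolding has_weak_grad_def
proof
  fix \<phi> assume \<phi>: "\<phi> \<in> test_functions \<Omega>"
  note \<Omega>m = open_bounded_lmeasurable[OF assms(1,2)]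
  note int = weak_grad_pairing_integrable[OF \<phi> \<Omega>m assms(3,5)] weak_grad_pairing_integrable[OF \<phi> \<Omega>m assms(4,6)]
  show "(LINT x|lebesgue_on \<Omega>. (u x - v x) *\<^sub>R classical_grad \<phi> x) = - (LINT x|lebesgue_on \<Omega>. \<phi> x *\<^sub>R (g x - k x))"
    using int assms(7,8) \<phi> by (simp add: scaleR_diff_left scaleR_diff_right has_weak_grad_def)
qed

lemma weak_grad_diff:
  assumes "open \<Omega>" "bounded \<Omega>" "u \<in> H1 \<Omega>" "v \<in> H1 \<Omega>"
  shows "(\<lambda>x. u x - v x) \<in> H1 \<Omega>"
    "AE x in lebesgue_on \<Omega>. weak_grad \<Omega> (\<lambda>x. u x - v x) x = weak_grad \<Omega> u x - weak_grad \<Omega> v x"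
proof -
  note u = H1_D[OF assms(3)] and v = H1_D[OF assms(4)]
  note * = H1_I[OF assms(1,2) L2_diff[OF u(1) v(1)] L2_diff[OF u(2) v(2)] has_weak_grad_diff[OF assms(1,2) u(1) v(1) u(2) v(2) u(3) v(3)]]
  show "(\<lambda>x. u x - v x) \<in> H1 \<Omega>"
    "AE x in lebesgue_on \<Omega>. weak_grad \<Omega> (\<lambda>x. u x - v x) x = weak_grad \<Omega> u x - weak_grad \<Omega> v x"
    using * by auto
qed

lemma H1_seminorm_cong_AE:
  assumes "v \<in> H1 \<Omega>" "AE x in lebesgue_on \<Omega>. weak_grad \<Omega> v x = g x" "g \<in> L2 \<Omega>"
  shows "H1_seminorm \<Omega> v = L2_norm \<Omega> g"
  unfolding H1_seminorm_def
  by (rule L2_norm_cong_AE[OF assms(2) L2_D(1)[OF H1_D(2)[OF assms(1)]] L2_D(1)[OF assms(3)]])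

lemma test_function_weak_grad:
  assumes "open \<Omega>" "bounded \<Omega>" "\<phi> \<in> test_functions \<Omega>"
  shows "\<phi> \<in> H1 \<Omega>" "AE x in lebesgue_on \<Omega>. weak_grad \<Omega> \<phi> x = classical_grad \<phi> x"
proof -
  obtain B where B: "B \<ge> 0" "\<And>x. \<bar>\<phi> x\<bar> \<le> B" "\<And>x. norm (classical_grad \<phi> x) \<le> B"
    using test_function_bounds[OF assms(3)] by blast
  note sm = test_functions_smooth[OF assms(3)]
  have m: "classical_grad \<phi> \<in> borel_measurable lebesgue"
    by (rule measurable_completion) (simp add: smooth_grad_borel[OF sm])
  have d: "AE x in lebesgue. (\<phi> has_derivative (\<lambda>h. classical_grad \<phi> x \<bullet> h)) (at x)"
    by (rule AE_I2) (rule smooth_has_derivative_grad[OF sm])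
  note * = lipb_has_weak_grad[OF assms(1,2) test_function_lipb[OF assms(3)] d m B(3)]
  show "\<phi> \<in> H1 \<Omega>" "AE x in lebesgue_on \<Omega>. weak_grad \<Omega> \<phi> x = classical_grad \<phi> x"
    using H1_I[OF assms(1,2) *] by auto
qed

lemma test_function_H10:
  assumes "open \<Omega>" "bounded \<Omega>" "\<phi> \<in> test_functions \<Omega>"
  shows "\<phi> \<in> H10 \<Omega>"
proof -
  note t = test_function_weak_grad[OF assms]
  have z: "(\<lambda>x. 0) \<in> test_functions \<Omega>"
    by (rule test_functionsI[of _ "{}"]) (auto intro: smooth_intros)
  note tz = test_function_weak_grad[OF assms(1,2) z]
  have g0: "classical_grad (\<lambda>x::'a. 0) = (\<lambda>x. 0)"
    using classical_grad_affine[of 0 "0::'a"] by auto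
  \<comment> \<open>Even for the zero function the chosen weak gradient is known to vanish only
    almost everywhere, so the seminorm is computed from the classical gradient.\<close>
  have "H1_seminorm \<Omega> (\<lambda>x. 0) = 0"
    using H1_seminorm_cong_AE[OF tz] by (simp add: g0 L2_norm_def L2_def)
  then show ?thesis
    unfolding H10_def using t(1) assms(3) by (auto intro!: bexI[of _ \<phi>] simp: L2_norm_def)
qed

lemma AE_lebesgue_on: "AE x in lebesgue. P x \<Longrightarrow> S \<in> sets lebesgue \<Longrightarrow> AE x in lebesgue_on S. P x"
  by (simp add: AE_restrict_space_iff eventually_mono)

text \<open>Integrate the derivative of \<open>w\<^sup>2 (x \<bullet> e)\<close> in direction \<open>e\<close>; clamping \<open>x \<bullet> e\<close> makes the
  factor bounded without changing it near \<open>\<Omega>\<close>.\<close>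

lemma Poincare_lipb:
  fixes w :: "'a::euclidean_space \<Rightarrow> real"
  assumes \<Omega>: "open \<Omega>" "bounded \<Omega>" and R: "\<Omega> \<subseteq> ball 0 R" "R > 0" and w: "lipb w" "\<And>x. x \<notin> \<Omega> \<Longrightarrow> w x = 0"
    and der: "AE x in lebesgue. (w has_derivative (\<lambda>h. g x \<bullet> h)) (at x)"
    and g: "g \<in> borel_measurable lebesgue" "\<And>x. norm (g x) \<le> B"
  shows "L2_norm \<Omega> w \<le> 2 * (R + 1) * L2_norm \<Omega> g"
proof -
  note \<Omega>m = open_bounded_lmeasurable[OF \<Omega>]
  note L2s = lipb_has_weak_grad(1,2)[OF \<Omega> w(1) der g]
  obtain e :: 'a where e: "e \<in> Basis" using nonempty_Basis by blast
  \<comment> \<open>Clamping at \<open>R + 1\<close> instead of \<open>R\<close> keeps the clamp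
    equal to the coordinate on an open ball containing the closure of \<open>\<Omega>\<close>, so
    that it can be differentiated there.\<close>
  define cl where "cl x = max (- (R + 1)) (min (R + 1) (x \<bullet> e))" for x
  have clb: "\<bar>cl x\<bar> \<le> R + 1" for x using R(2) by (auto simp: cl_def)
  have lcl: "lipb cl" unfolding cl_def[abs_def] using R(2) by (intro lipb_inner_clamp) simp
  define F' where "F' x h = (w x * w x) * (e \<bullet> h) + (w x * (g x \<bullet> h) + (g x \<bullet> h) * w x) * cl x" for x h
  have wm: "w \<in> borel_measurable lebesgue" "cl \<in> borel_measurable lebesgue"
    by (auto intro!: measurable_completion borel_measurable_continuous_onI lipb_continuous w lcl)
  have 0: "(LINT x|lebesgue. F' x e) = 0"
  proof (rule lipb_integral_derivative_0(2)[where F="\<lambda>x. (w x * w x) * cl x" and R=R])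
    show "lipb (\<lambda>x. w x * w x * cl x)" by (intro lipb_mult w lcl)
    show "w x * w x * cl x = 0" if "R \<le> norm x" for x using w(2)[of x] R that by (cases "x \<in> \<Omega>") auto
    show "AE x in lebesgue. ((\<lambda>x. w x * w x * cl x) has_derivative F' x) (at x)"
      using der
    proof eventually_elim
      case (elim x)
      show ?case
      proof (cases "norm x < R + 1")
        case True
        have "((\<lambda>x. x \<bullet> e) has_derivative (\<lambda>h. h \<bullet> e)) (at x)" by (auto intro!: derivative_eq_intros)
        then have "(cl has_derivative (\<lambda>h. h \<bullet> e)) (at x)"
        proof (rule has_derivative_transform_within_open[where s="ball 0 (R + 1)"])
          show "y \<bullet> e = cl y" if "y \<in> ball 0 (R + 1)" for y
            using that Basis_le_norm[OF e, of y] by (auto simp: cl_def abs_le_iff)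
        qed (use True in auto)
        from has_derivative_mult[OF has_derivative_mult[OF elim elim] this]
        show ?thesis by (rule has_derivative_eq_rhs) (auto simp: F'_def inner_commute)
      next
        case False
        have "((\<lambda>x. 0) has_derivative (\<lambda>h. 0)) (at x)" by simp
        then have "((\<lambda>x. w x * w x * cl x) has_derivative (\<lambda>h. 0)) (at x)"
          by (rule has_derivative_transform_within_open[where s="- cball 0 R"])
             (use False R w(2) in \<open>force+\<close>)
        moreover have "w x = 0" using False R by (intro w(2)) auto
        ultimately show ?thesis by (simp add: F'_def[abs_def])
      qed
    qed
    show "(\<lambda>x. F' x e) \<in> borel_measurable lebesgue"
      unfolding F'_def using wm g(1)
      by (intro borel_measurable_add borel_measurable_times borel_measurable_inner borel_measurable_const)
  qed (use e in simp)
  have "(LINT x|lebesgue_on \<Omega>. F' x e) = (LINT x|lebesgue. indicator \<Omega> x *\<^sub>R F' x e)"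
    using \<Omega>m by (intro integral_restrict_space) auto
  also have "\<dots> = (LINT x|lebesgue. F' x e)"
    by (intro Bochner_Integration.integral_cong) (auto simp: indicator_def F'_def w(2))
  finally have 1: "(LINT x|lebesgue_on \<Omega>. F' x e) = 0" using 0 by simp
  have gm: "g \<in> borel_measurable (lebesgue_on \<Omega>)" "w \<in> borel_measurable (lebesgue_on \<Omega>)" "cl \<in> borel_measurable (lebesgue_on \<Omega>)"
    using g(1) wm by (auto intro: measurable_restrict_space1)
  define q where "q x = w x * (g x \<bullet> e) * cl x" for x
  have wg: "integrable (lebesgue_on \<Omega>) (\<lambda>x. norm (w x) * norm (norm (g x)))"
    by (rule L2_inner_integrable(1)[OF L2s(1) L2_bound(1)[OF L2s(2)]]) (use gm in auto)
  have qb: "\<bar>q x\<bar> \<le> (R + 1) * (norm (w x) * norm (norm (g x)))" for x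
  proof -
    have "\<bar>g x \<bullet> e\<bar> \<le> norm (g x)" using Basis_le_norm[OF e] .
    then have "\<bar>w x\<bar> * \<bar>g x \<bullet> e\<bar> * \<bar>cl x\<bar> \<le> \<bar>w x\<bar> * norm (g x) * (R + 1)"
      by (intro mult_mono clb) auto
    then show ?thesis by (simp add: q_def abs_mult mult_ac)
  qed
  have qi: "integrable (lebesgue_on \<Omega>) q"
  proof (rule Bochner_Integration.integrable_bound[OF integrable_mult_right[OF wg, of "R + 1"]])
    show "q \<in> borel_measurable (lebesgue_on \<Omega>)"
      unfolding q_def[abs_def] using gm by (intro borel_measurable_times borel_measurable_inner borel_measurable_const)
    show "AE x in lebesgue_on \<Omega>. norm (q x) \<le> norm ((R + 1) * (norm (w x) * norm (norm (g x))))"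
      using qb R(2) by (intro AE_I2) (simp add: abs_mult)
  qed
  \<comment> \<open>\<open>F' x e\<close> equals \<open>(w x)\<^sup>2 + 2 * q x\<close> and
    integrates to zero, so the squared norm is minus twice the integral of \<open>q\<close>.
    Cauchy-Schwarz produces a factor \<open>L2_norm \<Omega> w\<close>, which is cancelled at the
    end.\<close>
  have "(L2_norm \<Omega> w)\<^sup>2 = (LINT x|lebesgue_on \<Omega>. F' x e - 2 * q x)"
    unfolding L2_norm_sq using e
    by (intro Bochner_Integration.integral_cong) (auto simp: F'_def q_def power2_eq_square algebra_simps inner_Basis)
  also have "\<dots> = (LINT x|lebesgue_on \<Omega>. F' x e) - 2 * (LINT x|lebesgue_on \<Omega>. q x)"
  proof -
    have "integrable (lebesgue_on \<Omega>) (\<lambda>x. (norm (w x))\<^sup>2 + 2 * q x)"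
      using L2_D(2)[OF L2s(1)] qi by simp
    moreover have "(\<lambda>x. (norm (w x))\<^sup>2 + 2 * q x) = (\<lambda>x. F' x e)"
      using e by (auto simp: F'_def q_def power2_eq_square algebra_simps inner_Basis fun_eq_iff)
    ultimately show ?thesis using qi by simp
  qed
  also have "\<dots> = 2 * (LINT x|lebesgue_on \<Omega>. - q x)" using 1 by simp
  also have "(LINT x|lebesgue_on \<Omega>. - q x) \<le> (LINT x|lebesgue_on \<Omega>. (R + 1) * (norm (w x) * norm (norm (g x))))"
    using qb by (intro integral_mono integrable_mult_right wg Bochner_Integration.integrable_minus qi)
      (metis abs_le_D2)
  also have "\<dots> = (R + 1) * (LINT x|lebesgue_on \<Omega>. norm (w x) * norm (norm (g x)))" by simp
  finally have le: "(L2_norm \<Omega> w)\<^sup>2 \<le> 2 * ((R + 1) * (LINT x|lebesgue_on \<Omega>. norm (w x) * norm (norm (g x))))" by simp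
  have "(LINT x|lebesgue_on \<Omega>. norm (w x) * norm (norm (g x))) \<le> L2_norm \<Omega> w * L2_norm \<Omega> (\<lambda>x. norm (g x))"
    by (rule L2_Cauchy_Schwarz_norm[OF L2s(1) L2_bound(1)[OF L2s(2)]]) (use gm in auto)
  also have "L2_norm \<Omega> (\<lambda>x. norm (g x)) = L2_norm \<Omega> g" by (simp add: L2_norm_def)
  finally have "2 * (R + 1) * (LINT x|lebesgue_on \<Omega>. norm (w x) * norm (norm (g x))) \<le> 2 * (R + 1) * (L2_norm \<Omega> w * L2_norm \<Omega> g)"
    using R(2) by (intro mult_left_mono) auto
  with le have "L2_norm \<Omega> w * L2_norm \<Omega> w \<le> L2_norm \<Omega> w * (2 * (R + 1) * L2_norm \<Omega> g)"
    by (simp only: power2_eq_square mult_ac)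
  then show ?thesis
    using L2_norm_nonneg[of \<Omega> w] L2_norm_nonneg[of \<Omega> g] R(2)
    by (cases "L2_norm \<Omega> w = 0") (auto simp: mult_le_cancel_left)
qed

section \<open>Mesh geometry\<close>

text \<open>A functional that is constant on a disc of a hyperplane annihilates all directions
  tangent to it. Here \<open>w\<close> is the tangential part of \<open>\<nu>'\<close>, and moving
  from \<open>c\<close> along \<open>w\<close> shows that it vanishes.\<close>

lemma normal_unique:
  fixes \<nu> \<nu>' :: "'a::euclidean_space"
  assumes "norm \<nu> = 1" "norm \<nu>' = 1" "r > 0" "\<nu> \<bullet> c = \<beta>"
    and \<gamma>: "\<And>x. x \<in> cball c r \<Longrightarrow> \<nu> \<bullet> x = \<beta> \<Longrightarrow> \<nu>' \<bullet> x = \<beta>'"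
  shows "\<nu>' = \<nu> \<or> \<nu>' = - \<nu>"
proof -
  define k where "k = \<nu>' \<bullet> \<nu>"
  define w where "w = \<nu>' - k *\<^sub>R \<nu>"
  have nn: "\<nu> \<bullet> \<nu> = 1" using assms(1) by (simp add: norm_eq_1)
  have w\<nu>: "\<nu> \<bullet> w = 0" using nn by (simp add: w_def k_def inner_diff_right inner_commute)
  have "w = 0"
  proof (rule ccontr)
    assume w0: "w \<noteq> 0"
    define x where "x = c + (r / norm w) *\<^sub>R w"
    have "x \<in> cball c r" using assms(3) w0 by (simp add: x_def dist_norm)
    moreover have "\<nu> \<bullet> x = \<beta>" using assms(4) w\<nu> by (simp add: x_def inner_add_right)
    ultimately have "\<nu>' \<bullet> x = \<beta>'" by (rule \<gamma>)
    moreover have "\<nu>' \<bullet> c = \<beta>'" using \<gamma>[of c] assms(3,4) by simp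
    ultimately have "\<nu>' \<bullet> w = 0" using assms(3) w0 by (simp add: x_def inner_add_right)
    moreover have "w \<bullet> w = \<nu>' \<bullet> w - k * (\<nu> \<bullet> w)"
      by (subst (1) w_def) (simp add: inner_diff_left)
    ultimately show False using w0 w\<nu> by simp
  qed
  then have *: "\<nu>' = k *\<^sub>R \<nu>" by (simp add: w_def)
  then have "\<bar>k\<bar> = 1" using assms(1,2) by (metis mult.right_neutral norm_scaleR)
  then show ?thesis using * by (auto simp: abs_if split: if_splits)
qed

text \<open>\<open>outward_normal\<close> is a definite description. A disc in the side fixes the
  normal up to sign, and a point of \<open>K\<close> strictly below the hyperplane fixes the
  sign.\<close>

lemma outward_normalI:
  fixes \<nu> :: "'a::euclidean_space"
  assumes "norm \<nu> = 1" "r > 0" "\<nu> \<bullet> c = \<beta>" "\<And>x. x \<in> cball c r \<Longrightarrow> \<nu> \<bullet> x = \<beta> \<Longrightarrow> x \<in> \<gamma>"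
    and "\<And>x. x \<in> \<gamma> \<Longrightarrow> \<nu> \<bullet> x = \<beta>" "\<And>x. x \<in> K \<Longrightarrow> \<nu> \<bullet> x \<le> \<beta>" "z \<in> K" "\<nu> \<bullet> z < \<beta>"
  shows "outward_normal K \<gamma> = \<nu>"
  unfolding outward_normal_def
proof (rule the_equality)
  show "norm \<nu> = 1 \<and> (\<exists>c. (\<forall>x\<in>\<gamma>. \<nu> \<bullet> x = c) \<and> (\<forall>x\<in>K. \<nu> \<bullet> x \<le> c))" using assms by auto
  fix \<nu>' assume *: "norm \<nu>' = 1 \<and> (\<exists>c. (\<forall>x\<in>\<gamma>. \<nu>' \<bullet> x = c) \<and> (\<forall>x\<in>K. \<nu>' \<bullet> x \<le> c))"
  then obtain c' where c': "\<forall>x\<in>\<gamma>. \<nu>' \<bullet> x = c'" "\<forall>x\<in>K. \<nu>' \<bullet> x \<le> c'" by blast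
  have "\<nu>' = \<nu> \<or> \<nu>' = - \<nu>"
    by (rule normal_unique[OF assms(1) _ assms(2,3)]) (use * c' assms(4) in auto)
  moreover have "\<nu>' \<noteq> - \<nu>"
  proof
    assume n: "\<nu>' = - \<nu>"
    have "c \<in> \<gamma>" using assms(2,3,4) by simp
    then have "c' = - \<beta>" using c' n assms(3) by auto
    then show False using c'(2) assms(7,8) n by force
  qed
  ultimately show "\<nu>' = \<nu>" by blast
qed

text \<open>The homothety centred at the opposite vertex that moves the centre of the inscribed ball into the facet
  enlarges the ball and preserves the cone spanned by the simplex at that vertex.\<close>

lemma facet_relative_ball:
  fixes C :: "'a::euclidean_space set"
  assumes C: "\<not> affine_dependent C" and \<gamma>: "\<gamma> facet_of convex hull C"
    and z: "cball z r \<subseteq> convex hull C" "r > 0"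
  obtains \<nu> \<beta> c where "norm \<nu> = 1" "\<gamma> = convex hull C \<inter> {x. \<nu> \<bullet> x = \<beta>}" "convex hull C \<subseteq> {x. \<nu> \<bullet> x \<le> \<beta>}"
    "c \<in> \<gamma>" "cball c r \<inter> {x. \<nu> \<bullet> x = \<beta>} \<subseteq> \<gamma>"
proof -
  have finC: "finite C" using C aff_independent_finite by blast
  define K where "K = convex hull C"
  have poly: "polyhedron K" unfolding K_def using finC by (simp add: polyhedron_convex_hull)
  have face: "\<gamma> face_of K" "\<gamma> \<noteq> {}" "\<gamma> \<noteq> K"
    using \<gamma> facet_of_irrefl[of K] by (auto simp: facet_of_def K_def)
  from face(1) poly have "\<gamma> exposed_face_of K" by (simp add: exposed_face_of_polyhedron)
  then obtain a b where ab: "K \<subseteq> {x. a \<bullet> x \<le> b}" "\<gamma> = K \<inter> {x. a \<bullet> x = b}"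
    unfolding exposed_face_of_def by blast
  have a0: "a \<noteq> 0" using ab face by (cases "b = 0") auto
  define \<nu> where "\<nu> = (1 / norm a) *\<^sub>R a"
  define \<beta> where "\<beta> = b / norm a"
  have \<nu>: "norm \<nu> = 1" using a0 by (simp add: \<nu>_def)
  have iff: "(\<nu> \<bullet> x = \<beta>) = (a \<bullet> x = b)" "(\<nu> \<bullet> x \<le> \<beta>) = (a \<bullet> x \<le> b)" for x
    using a0 by (auto simp: \<nu>_def \<beta>_def field_simps)
  have \<gamma>eq: "\<gamma> = K \<inter> {x. \<nu> \<bullet> x = \<beta>}" and Ksub: "K \<subseteq> {x. \<nu> \<bullet> x \<le> \<beta>}" using ab iff by auto
  obtain v where v: "v \<in> C" "\<gamma> = convex hull (C - {v})"
    using \<gamma> facet_of_convex_hull_affine_independent[OF C] by blast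
  have vn: "v \<notin> \<gamma>"
    using C v convex_hull_subset_affine_hull[of "C - {v}"] by (auto simp: affine_dependent_def)
  have vK: "v \<in> K" using v by (simp add: K_def hull_inc)
  have vlt: "\<nu> \<bullet> v < \<beta>" using vn vK \<gamma>eq Ksub by force
  have C1: "C - {v} \<noteq> {}" using v(2) face(2) by auto
  \<comment> \<open>The simplex is the cone over the facet with apex \<open>v\<close>.\<close>
  have rep: "\<exists>t y. 0 \<le> t \<and> t \<le> 1 \<and> y \<in> \<gamma> \<and> x = v + t *\<^sub>R (y - v)" if "x \<in> K" for x
  proof -
    have "x \<in> convex hull (insert v (C - {v}))" using v(1) that by (simp add: K_def insert_absorb)
    then obtain u w y where "u \<ge> 0" "w \<ge> 0" "u + w = 1" "y \<in> \<gamma>" "x = u *\<^sub>R v + w *\<^sub>R y"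
      unfolding convex_hull_insert[OF C1] v(2) by blast
    moreover have "u = 1 - w" using \<open>u + w = 1\<close> by simp
    then have "u *\<^sub>R v + w *\<^sub>R y = v + w *\<^sub>R (y - v)" by (simp only:) (simp add: algebra_simps)
    ultimately show ?thesis by (intro exI[of _ w] exI[of _ y]) auto
  qed
  have zK: "z \<in> K" using z by (auto simp: K_def)
  obtain t c where tc: "0 \<le> t" "t \<le> 1" "c \<in> \<gamma>" "z = v + t *\<^sub>R (c - v)" using rep[OF zK] by blast
  \<comment> \<open>If \<open>t = 0\<close> then \<open>z = v\<close>, but \<open>v\<close> is a
    lowest point of the simplex in direction \<open>\<nu>\<close>, while the ball reaches
    \<open>r\<close> below \<open>z\<close>.\<close>
  have t0: "t > 0"
  proof (rule ccontr)
    assume "\<not> t > 0"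
    then have "z = v" using tc by simp
    have "z - r *\<^sub>R \<nu> \<in> K" using z \<nu> by (auto simp: K_def subset_iff dist_norm)
    then obtain s y where s: "0 \<le> s" "y \<in> \<gamma>" "z - r *\<^sub>R \<nu> = v + s *\<^sub>R (y - v)" using rep by blast
    have "\<nu> \<bullet> (z - r *\<^sub>R \<nu>) = \<nu> \<bullet> v - r" using \<open>z = v\<close> \<nu> by (simp add: inner_diff_right norm_eq_1)
    moreover have "\<nu> \<bullet> (v + s *\<^sub>R (y - v)) = \<nu> \<bullet> v + s * (\<beta> - \<nu> \<bullet> v)"
      using s(2) \<gamma>eq by (simp add: inner_add_right inner_diff_right)
    moreover have "s * (\<beta> - \<nu> \<bullet> v) \<ge> 0" using s(1) vlt by simp
    ultimately show False using s(3) z(2) by simp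
  qed
  have "x \<in> \<gamma>" if x: "x \<in> cball c r" "\<nu> \<bullet> x = \<beta>" for x
  proof -
    \<comment> \<open>Pull \<open>x\<close> towards \<open>v\<close> by the same factor
      \<open>t \<le> 1\<close> that takes \<open>c\<close> to \<open>z\<close>. The image lies in
      the inscribed ball, hence in the simplex, and its height identifies the facet point
      \<open>y\<close> on its ray as \<open>x\<close> itself.\<close>
    define x' where "x' = v + t *\<^sub>R (x - v)"
    have "x' - z = t *\<^sub>R (x - c)" by (simp add: x'_def tc(4) algebra_simps)
    then have "norm (x' - z) = t * norm (x - c)" using t0 by simp
    also have "\<dots> \<le> 1 * r" using x(1) tc t0 z(2) by (intro mult_mono) (auto simp: dist_norm norm_minus_commute)
    finally have "x' \<in> K" using z by (auto simp: K_def dist_norm norm_minus_commute)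
    then obtain s y where s: "y \<in> \<gamma>" "x' = v + s *\<^sub>R (y - v)" using rep by blast
    have "\<nu> \<bullet> x' = \<nu> \<bullet> v + t * (\<beta> - \<nu> \<bullet> v)" using x(2) by (simp add: x'_def inner_add_right inner_diff_right)
    moreover have "\<nu> \<bullet> x' = \<nu> \<bullet> v + s * (\<beta> - \<nu> \<bullet> v)"
      using s \<gamma>eq by (simp add: inner_add_right inner_diff_right)
    ultimately have "s = t" using vlt by simp
    then have "x = y" using s(2) t0 by (simp add: x'_def)
    then show ?thesis using s(1) by simp
  qed
  then show thesis using that[of \<nu> \<beta> c] \<nu> \<gamma>eq Ksub tc(3) unfolding K_def by blast
qed

text \<open>A point near \<open>c\<close> lies on a segment from \<open>z\<close> to a point of the hyperplane that is still close to \<open>c\<close>.\<close>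

lemma half_ball_subset:
  fixes K :: "'a::euclidean_space set"
  assumes K: "convex K" "cball z r \<subseteq> K" "r > 0" "K \<subseteq> {x. \<nu> \<bullet> x \<le> \<beta>}" and \<nu>: "norm \<nu> = 1"
    and c: "\<nu> \<bullet> c = \<beta>" "cball c R \<inter> {x. \<nu> \<bullet> x = \<beta>} \<subseteq> K" "dist z c \<le> s * r"
    and \<rho>: "\<rho> > 0" "\<rho> \<le> r / 2" "2 * \<rho> * (1 + s) \<le> R"
  shows "cball c \<rho> \<inter> {x. \<nu> \<bullet> x \<le> \<beta>} \<subseteq> K"
proof clarify
  fix w assume w: "w \<in> cball c \<rho>" "\<nu> \<bullet> w \<le> \<beta>"
  define \<tau> where "\<tau> = \<beta> - \<nu> \<bullet> w"
  define \<delta> where "\<delta> = \<beta> - \<nu> \<bullet> z"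
  have "\<nu> \<bullet> (c - w) \<le> norm \<nu> * norm (c - w)" by (rule norm_cauchy_schwarz)
  then have \<tau>: "0 \<le> \<tau>" "\<tau> \<le> \<rho>" using w c(1) \<nu> by (auto simp: \<tau>_def inner_diff_right dist_norm)
  have "z + r *\<^sub>R \<nu> \<in> K" using K(2,3) \<nu> by (auto simp: subset_iff dist_norm)
  then have "\<nu> \<bullet> (z + r *\<^sub>R \<nu>) \<le> \<beta>" using K(4) by blast
  then have \<delta>: "\<delta> \<ge> r" using \<nu> by (simp add: \<delta>_def inner_add_right norm_eq_1)
  \<comment> \<open>The ratio of the depths of \<open>w\<close> and \<open>z\<close> below the
    hyperplane; with this weight the ray from \<open>z\<close> through \<open>w\<close> is extended
    to a point \<open>x\<close> of the hyperplane.\<close>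
  define t where "t = \<tau> / \<delta>"
  have t0: "0 \<le> t" using \<tau> \<delta> K(3) by (simp add: t_def)
  have t1: "t \<le> \<rho> / r" unfolding t_def using \<tau> \<delta> K(3) by (intro frac_le) auto
  have "\<rho> / r \<le> 1/2" using \<rho>(2) K(3) by (simp add: field_simps)
  with t1 have t2: "t \<le> 1/2" by linarith
  define x where "x = (1 / (1 - t)) *\<^sub>R (w - t *\<^sub>R z)"
  have wx: "w = (1 - t) *\<^sub>R x + t *\<^sub>R z" using t2 by (simp add: x_def)
  have "\<nu> \<bullet> x = (\<beta> - \<tau> - t * (\<beta> - \<delta>)) / (1 - t)"
    by (simp add: x_def inner_diff_right \<tau>_def \<delta>_def)
  also have "\<beta> - \<tau> - t * (\<beta> - \<delta>) = \<beta> * (1 - t)"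
    using \<delta> K(3) by (simp add: t_def field_simps)
  finally have \<nu>x: "\<nu> \<bullet> x = \<beta>" using t2 by simp
  have eq: "(1 - t) *\<^sub>R (x - c) = (w - c) - t *\<^sub>R (z - c)"
    using wx by (simp add: algebra_simps)
  \<comment> \<open>The factor 2 in the last hypothesis on \<open>\<rho>\<close> pays for dividing
    by \<open>1 - t \<ge> 1/2\<close>.\<close>
  have "(1 - t) * norm (x - c) = norm ((1 - t) *\<^sub>R (x - c))" using t2 by simp
  also have "\<dots> = norm ((w - c) - t *\<^sub>R (z - c))" by (simp only: eq)
  also have "\<dots> \<le> norm (w - c) + t * norm (z - c)"
    using norm_triangle_ineq4[of "w - c" "t *\<^sub>R (z - c)"] t0 by simp
  also have "\<dots> \<le> \<rho> + \<rho> / r * (s * r)"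
    using w(1) c(3) t0 t1 \<rho>(1) K(3) by (intro add_mono mult_mono) (auto simp: dist_norm norm_minus_commute)
  also have "\<dots> = \<rho> * (1 + s)" using K(3) by (simp add: field_simps)
  also have "\<dots> \<le> R / 2" using \<rho>(3) by simp
  finally have "(1 - t) * norm (x - c) \<le> R / 2" .
  moreover have "1/2 * norm (x - c) \<le> (1 - t) * norm (x - c)" using t2 by (intro mult_right_mono) auto
  ultimately have "norm (x - c) \<le> R" by simp
  then have "x \<in> K" using c(2) \<nu>x by (auto simp: dist_norm norm_minus_commute)
  moreover have "z \<in> K" using K(2,3) by auto
  ultimately show "w \<in> K" unfolding wx using K(1) t0 t2 by (intro convexD) auto
qed

text \<open>Near a boundary point the domain lies strictly below a Lipschitz graph, so moving up
  along \<open>\<nu>\<close> leaves the closure. Slits are thus excluded, and interiors of elements,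
  as well as balls covered by two elements, lie in \<open>\<Omega>\<close> and not merely in its
  closure.\<close>

lemma interior_closure_domain:
  assumes "open \<Omega>" "lipschitz_boundary \<Omega>"
  shows "interior (closure \<Omega>) = \<Omega>"
proof
  show "\<Omega> \<subseteq> interior (closure \<Omega>)" using assms(1) by (simp add: closure_subset interior_maximal)
  show "interior (closure \<Omega>) \<subseteq> \<Omega>"
  proof (rule ccontr)
    assume "\<not> interior (closure \<Omega>) \<subseteq> \<Omega>"
    then obtain x where x: "x \<in> interior (closure \<Omega>)" "x \<notin> \<Omega>" by blast
    then have "x \<in> frontier \<Omega>" using assms(1) interior_subset by (auto simp: frontier_def interior_open)
    then obtain r \<nu> g L where r: "r > 0" "norm \<nu> = 1" "L-lipschitz_on UNIV (g :: 'a \<Rightarrow> real)"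
      "\<Omega> \<inter> ball x r = {z \<in> ball x r. z \<bullet> \<nu> < g (z - (z \<bullet> \<nu>) *\<^sub>R \<nu>)}"
      using assms(2) unfolding lipschitz_boundary_def by blast
    obtain e where e: "e > 0" "ball x e \<subseteq> closure \<Omega>" using x(1) by (auto simp: mem_interior)
    define t where "t = min e r / 2"
    have t: "t > 0" "t < e" "t < r" using e(1) r(1) by (auto simp: t_def)
    define y where "y = x + t *\<^sub>R \<nu>"
    have nn: "\<nu> \<bullet> \<nu> = 1" using r(2) by (simp add: norm_eq_1)
    have yb: "y \<in> ball x e" "y \<in> ball x r" using t r(2) by (auto simp: y_def dist_norm)
    define W where "W = {z. z \<bullet> \<nu> > g (z - (z \<bullet> \<nu>) *\<^sub>R \<nu>)}"
    have gc: "continuous_on UNIV g" using r(3) lipschitz_on_continuous_on by blast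
    have "open W"
      unfolding W_def by (intro open_Collect_less continuous_intros continuous_on_compose2[OF gc]) auto
    then have oW: "open (W \<inter> ball x r)" by blast
    have "x \<in> ball x r" using r(1) by simp
    then have "\<not> x \<bullet> \<nu> < g (x - (x \<bullet> \<nu>) *\<^sub>R \<nu>)" using r(4) x(2) by blast
    moreover have "y - (y \<bullet> \<nu>) *\<^sub>R \<nu> = x - (x \<bullet> \<nu>) *\<^sub>R \<nu>" "y \<bullet> \<nu> = x \<bullet> \<nu> + t"
      using nn by (auto simp: y_def inner_add_left algebra_simps)
    ultimately have "y \<in> W \<inter> ball x r" using t yb by (simp add: W_def)
    moreover have "(W \<inter> ball x r) \<inter> \<Omega> = {}"
    proof -
      have False if "z \<in> W" "z \<in> ball x r" "z \<in> \<Omega>" for z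
      proof -
        have "z \<bullet> \<nu> < g (z - (z \<bullet> \<nu>) *\<^sub>R \<nu>)" using that(2,3) r(4) by blast
        then show False using that(1) by (simp add: W_def)
      qed
      then show ?thesis by blast
    qed
    ultimately have "y \<notin> closure \<Omega>"
      using oW open_Int_closure_eq_empty by blast
    then show False using yb(1) e(2) by blast
  qed
qed

text \<open>One mesh with a shape constant \<open>\<sigma>\<close> that its whole family can share,
  so that estimates with constants in \<open>\<sigma>\<close> and \<open>\<Omega>\<close> are
  uniform over the family. Enlarging the constant allows \<open>\<sigma> \<ge> 1\<close>; dimension
  at least 2 provides a direction tangent to a side.\<close>

locale fe_mesh =
  fixes \<Omega> :: "'a::euclidean_space set" and \<T> :: "'a set set" and \<sigma> :: real
  assumes domain: "polytopal_lipschitz_domain \<Omega>"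
    and mesh: "conforming_mesh \<Omega> \<T>"
    and shape: "\<And>K. K \<in> \<T> \<Longrightarrow> \<exists>c. \<exists>r>0. cball c r \<subseteq> K \<and> diameter K \<le> \<sigma> * r"
    and \<sigma>1: "\<sigma> \<ge> 1" and dim2: "DIM('a) \<ge> 2"
begin

lemma open_\<Omega>: "open \<Omega>" and bounded_\<Omega>: "bounded \<Omega>" and int_cl_\<Omega>: "interior (closure \<Omega>) = \<Omega>"
  using domain interior_closure_domain by (auto simp: polytopal_lipschitz_domain_def)

lemma \<Omega>_lmeasurable: "\<Omega> \<in> lmeasurable"
  by (rule open_bounded_lmeasurable[OF open_\<Omega> bounded_\<Omega>])

lemma finite_\<T>: "finite \<T>" and Union_\<T>: "\<Union>\<T> = closure \<Omega>"
  using mesh by (auto simp: conforming_mesh_def triangulation_def)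

lemma element_hull:
  assumes "K \<in> \<T>"
  obtains C where "\<not> affine_dependent C" "card C = Suc DIM('a)" "finite C" "K = convex hull C"
proof -
  have "int DIM('a) simplex K" using mesh assms by (simp add: conforming_mesh_def)
  then obtain C where "\<not> affine_dependent C" "int (card C) = int DIM('a) + 1" "K = convex hull C"
    unfolding simplex_def by blast
  then show thesis using that[of C] aff_independent_finite by fastforce
qed

lemma element_props:
  assumes "K \<in> \<T>"
  shows "compact K" "convex K" "K \<subseteq> closure \<Omega>" "interior K \<noteq> {}" "closed K" "bounded K" "K \<in> lmeasurable" "K \<in> sets lebesgue"
proof -
  obtain C where C: "finite C" "K = convex hull C" using element_hull[OF assms] .
  then show k: "compact K" "convex K" by (auto simp: finite_imp_compact compact_convex_hull convex_convex_hull)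
  then show "closed K" "bounded K" by (auto simp: compact_imp_closed compact_imp_bounded)
  show "K \<subseteq> closure \<Omega>" using assms Union_\<T> by blast
  show "K \<in> lmeasurable" using k(1) by (rule lmeasurable_compact)
  then show "K \<in> sets lebesgue" by blast
  obtain c r where "r > 0" "cball c r \<subseteq> K" using shape[OF assms] by blast
  then have "c \<in> interior K" by (meson ball_subset_cball mem_interior subset_trans)
  then show "interior K \<noteq> {}" by blast
qed

lemma interior_element_subset: "K \<in> \<T> \<Longrightarrow> interior K \<subseteq> \<Omega>"
  using interior_mono[OF element_props(3)] int_cl_\<Omega> by blast

text \<open>By conformity the intersection is a face of both elements, and it is proper in at least
  one of them; a proper face misses the interior.\<close>

lemma interiors_disjoint:
  assumes "K \<in> \<T>" "K' \<in> \<T>" "K \<noteq> K'"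
  shows "interior K \<inter> interior K' = {}"
proof -
  have f: "(K \<inter> K') face_of K" "(K' \<inter> K) face_of K'"
    using mesh assms by (auto simp: conforming_mesh_def triangulation_def)
  show ?thesis
  proof (cases "K \<inter> K' = K")
    case False
    then have "(K \<inter> K') \<inter> interior K = {}" using f(1) face_of_disjoint_interior by blast
    then show ?thesis using interior_subset by blast
  next
    case True
    then have "K' \<inter> K \<noteq> K'" using assms(3) by blast
    then have "(K' \<inter> K) \<inter> interior K' = {}" using f(2) face_of_disjoint_interior by blast
    then show ?thesis using interior_subset by blast
  qed
qed

definition skeleton :: "'a set" where "skeleton = (\<Union>K\<in>\<T>. frontier K)"

lemma skeleton_negligible: "negligible skeleton"
  unfolding skeleton_def using finite_\<T> element_props(2)
  by (intro negligible_Union) (auto simp: negligible_convex_frontier)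

lemma off_skeleton:
  assumes "x \<in> closure \<Omega>" "x \<notin> skeleton"
  obtains K where "K \<in> \<T>" "x \<in> interior K"
proof -
  obtain K where "K \<in> \<T>" "x \<in> K" using assms Union_\<T> by blast
  moreover then have "x \<notin> frontier K" using assms(2) by (auto simp: skeleton_def)
  ultimately have "x \<in> interior K" using closure_subset by (auto simp: frontier_def)
  then show thesis using that \<open>K \<in> \<T>\<close> by blast
qed

lemma facets_finite:
  assumes "K \<in> \<T>"
  shows "finite {\<gamma>. \<gamma> facet_of K}" "card {\<gamma>. \<gamma> facet_of K} \<le> Suc DIM('a)"
proof -
  obtain C where C: "\<not> affine_dependent C" "card C = Suc DIM('a)" "finite C" "K = convex hull C"
    using element_hull[OF assms] .
  have sub: "{\<gamma>. \<gamma> facet_of K} \<subseteq> (\<lambda>u. convex hull (C - {u})) ` C"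
    using facet_of_convex_hull_affine_independent[OF C(1)] C(4) by auto
  then show "finite {\<gamma>. \<gamma> facet_of K}" using C(3) finite_surj by blast
  show "card {\<gamma>. \<gamma> facet_of K} \<le> Suc DIM('a)"
    using surj_card_le[OF C(3) sub] C(2) by simp
qed

text \<open>Each element contributes a normal and a disc in \<open>\<gamma>\<close>. The normals
  agree up to sign, and equal signs would make the interiors overlap. Shape regularity makes the two
  half balls at \<open>c\<close> comparable to \<open>K\<close>, as a bump centred on the side
  requires.\<close>

lemma internal_side:
  assumes K: "K \<in> \<T>" "K' \<in> \<T>" "K \<noteq> K'" "\<gamma> facet_of K" "\<gamma> facet_of K'"
  obtains \<nu> \<beta> c \<rho> where "norm \<nu> = 1" "\<nu> \<bullet> c = \<beta>" "\<rho> > 0" "c \<in> \<gamma>"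
    "outward_normal K \<gamma> = \<nu>" "outward_normal K' \<gamma> = - \<nu>"
    "cball c \<rho> \<inter> {x. \<nu> \<bullet> x \<le> \<beta>} \<subseteq> K" "cball c \<rho> \<inter> {x. \<nu> \<bullet> x \<ge> \<beta>} \<subseteq> K'"
    "diameter K \<le> 2 * \<sigma> * (1 + \<sigma>) * \<rho>" "\<rho> \<le> diameter K"
proof -
  obtain z r where z: "r > 0" "cball z r \<subseteq> K" "diameter K \<le> \<sigma> * r" using shape[OF K(1)] by blast
  obtain z' r' where z': "r' > 0" "cball z' r' \<subseteq> K'" "diameter K' \<le> \<sigma> * r'" using shape[OF K(2)] by blast
  obtain C where C: "\<not> affine_dependent C" "K = convex hull C" using element_hull[OF K(1)] .
  obtain C' where C': "\<not> affine_dependent C'" "K' = convex hull C'" using element_hull[OF K(2)] .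
  obtain \<nu> \<beta> c where n: "norm \<nu> = 1" "\<gamma> = K \<inter> {x. \<nu> \<bullet> x = \<beta>}" "K \<subseteq> {x. \<nu> \<bullet> x \<le> \<beta>}"
    "c \<in> \<gamma>" "cball c r \<inter> {x. \<nu> \<bullet> x = \<beta>} \<subseteq> \<gamma>"
    using facet_relative_ball[OF C(1), of \<gamma> z r] z K(4) C(2) by blast
  obtain \<nu>' \<beta>' c' where n': "norm \<nu>' = 1" "\<gamma> = K' \<inter> {x. \<nu>' \<bullet> x = \<beta>'}" "K' \<subseteq> {x. \<nu>' \<bullet> x \<le> \<beta>'}"
    "c' \<in> \<gamma>" "cball c' r' \<inter> {x. \<nu>' \<bullet> x = \<beta>'} \<subseteq> \<gamma>"
    using facet_relative_ball[OF C'(1), of \<gamma> z' r'] z' K(5) C'(2) by blast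
  have c\<beta>: "\<nu> \<bullet> c = \<beta>" and c\<beta>': "\<nu>' \<bullet> c = \<beta>'" using n(2,4) n'(2) by auto
  have inK: "z \<in> K" "c \<in> K" "z' \<in> K'" "c \<in> K'" using z z' n(2,4) n'(2) by auto
  have dzc: "dist z c \<le> \<sigma> * r" using diameter_bounded_bound[OF element_props(6)[OF K(1)] inK(1,2)] z(3) by simp
  have dzc': "dist z' c \<le> \<sigma> * r'" using diameter_bounded_bound[OF element_props(6)[OF K(2)] inK(3,4)] z'(3) by simp
  have pm: "\<nu>' = \<nu> \<or> \<nu>' = - \<nu>"
    by (rule normal_unique[OF n(1) n'(1) z(1) c\<beta>, of \<beta>']) (use n(5) n'(2) in auto)
  \<comment> \<open>Inradii of neighbours are comparable: the disc of radius \<open>r\<close> in the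
    common side lies in \<open>K'\<close>, so \<open>r\<close> is at most the diameter of
    \<open>K'\<close>.\<close>
  have rr': "r \<le> \<sigma> * r'"
  proof -
    obtain e where e: "e \<noteq> 0" "e \<bullet> \<nu> = 0"
      using orthogonal_to_vector_exists[OF dim2, of \<nu>]
      by (auto simp: orthogonal_def inner_commute)
    define y where "y = c + (r / norm e) *\<^sub>R e"
    have "y \<in> cball c r" using e z(1) by (simp add: y_def dist_norm)
    moreover have "\<nu> \<bullet> y = \<beta>" using c\<beta> e(2) by (simp add: y_def inner_add_right inner_commute)
    ultimately have "y \<in> K'" using n(5) n'(2) by blast
    from diameter_bounded_bound[OF element_props(6)[OF K(2)] this inK(4)]
    have "dist y c \<le> diameter K'" .
    moreover have "dist y c = r" using e z(1) by (simp add: y_def dist_norm)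
    ultimately show ?thesis using z'(3) by simp
  qed
  \<comment> \<open>With \<open>s = \<sigma>\<close> and \<open>R = r\<close> this is the largest
    radius allowed by the last condition of \<open>half_ball_subset\<close>; the comparison of
    inradii makes it admissible for \<open>K'\<close> too.\<close>
  define \<rho> where "\<rho> = r / (2 * (1 + \<sigma>))"
  have \<rho>: "\<rho> > 0" "\<rho> \<le> r / 2" "2 * \<rho> * (1 + \<sigma>) \<le> r" "\<rho> \<le> r"
    using z(1) \<sigma>1 by (auto simp: \<rho>_def field_simps add_pos_pos)
  have \<rho>': "\<rho> \<le> r' / 2"
  proof -
    have "r \<le> (1 + \<sigma>) * r'" using rr' z'(1) by (simp add: algebra_simps)
    then show ?thesis using \<sigma>1 by (simp add: \<rho>_def field_simps)
  qed
  have half: "cball c \<rho> \<inter> {x. \<nu> \<bullet> x \<le> \<beta>} \<subseteq> K"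
    by (rule half_ball_subset[OF element_props(2)[OF K(1)] z(2,1) n(3,1) c\<beta> _ dzc \<rho>(1,2,3)]) (use n in auto)
  have half': "cball c \<rho> \<inter> {x. \<nu>' \<bullet> x \<le> \<beta>'} \<subseteq> K'"
  proof (rule half_ball_subset[OF element_props(2)[OF K(2)] z'(2,1) n'(3,1) c\<beta>' _ dzc' \<rho>(1) \<rho>' \<rho>(3)])
    have "\<nu> \<bullet> x = \<beta>" if "\<nu>' \<bullet> x = \<beta>'" for x
      using pm that c\<beta> c\<beta>' by auto
    then show "cball c r \<inter> {x. \<nu>' \<bullet> x = \<beta>'} \<subseteq> K'" using n(5) n'(2) by blast
  qed
  \<comment> \<open>With equal normals both half balls would be the same set, and a ball of radius
    \<open>\<rho> / 2\<close> inside it would lie in both elements.\<close>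
  have opp: "\<nu>' = - \<nu>"
  proof (rule ccontr)
    assume "\<nu>' \<noteq> - \<nu>"
    then have eq: "\<nu>' = \<nu>" "\<beta>' = \<beta>" using pm c\<beta> c\<beta>' by auto
    define q where "q = c - (\<rho> / 2) *\<^sub>R \<nu>"
    have "ball q (\<rho> / 2) \<subseteq> cball c \<rho> \<inter> {x. \<nu> \<bullet> x \<le> \<beta>}"
    proof clarify
      fix x assume x: "x \<in> ball q (\<rho> / 2)"
      have "norm (c - x) \<le> norm (c - q) + norm (q - x)" by (metis norm_triangle_ineq add_diff_eq diff_add_cancel)
      also have "norm (c - q) = \<rho> / 2" using n(1) \<rho> by (simp add: q_def)
      finally have 1: "norm (c - x) \<le> \<rho>" using x by (simp add: dist_norm)
      have "\<nu> \<bullet> (x - q) \<le> norm \<nu> * norm (x - q)" by (rule norm_cauchy_schwarz)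
      also have "\<dots> \<le> \<rho> / 2" using x n(1) by (simp add: dist_norm norm_minus_commute)
      finally have "\<nu> \<bullet> x \<le> \<beta>"
        using c\<beta> n(1) by (simp add: q_def inner_diff_right norm_eq_1)
      with 1 show "x \<in> cball c \<rho> \<inter> {x. \<nu> \<bullet> x \<le> \<beta>}" by (simp add: dist_norm)
    qed
    then have "ball q (\<rho> / 2) \<subseteq> K" "ball q (\<rho> / 2) \<subseteq> K'" using half half' eq by blast+
    then have "q \<in> interior K \<inter> interior K'" using \<rho>(1) by (auto simp: mem_interior intro!: exI[of _ "\<rho>/2"])
    then show False using interiors_disjoint[OF K(1-3)] by blast
  qed
  then have b': "\<beta>' = - \<beta>" using c\<beta> c\<beta>' by simp
  have zlt: "\<nu> \<bullet> z < \<beta>"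
  proof -
    have "z + r *\<^sub>R \<nu> \<in> K" using z(1,2) n(1) by (auto simp: subset_iff dist_norm)
    then have "\<nu> \<bullet> (z + r *\<^sub>R \<nu>) \<le> \<beta>" using n(3) by blast
    then show ?thesis using n(1) z(1) by (simp add: inner_add_right norm_eq_1)
  qed
  have zlt': "\<nu>' \<bullet> z' < \<beta>'"
  proof -
    have "z' + r' *\<^sub>R \<nu>' \<in> K'" using z'(1,2) n'(1) by (auto simp: subset_iff dist_norm)
    then have "\<nu>' \<bullet> (z' + r' *\<^sub>R \<nu>') \<le> \<beta>'" using n'(3) by blast
    then show ?thesis using n'(1) z'(1) by (simp add: inner_add_right norm_eq_1)
  qed
  show thesis
  proof (rule that[of \<nu> c \<beta> \<rho>])
    show "outward_normal K \<gamma> = \<nu>"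
      by (rule outward_normalI[OF n(1) z(1) c\<beta> _ _ _ inK(1) zlt]) (use n in auto)
    have c'\<beta>': "\<nu>' \<bullet> c' = \<beta>'" using n'(2,4) by auto
    have "outward_normal K' \<gamma> = \<nu>'"
      by (rule outward_normalI[OF n'(1) z'(1) c'\<beta>' _ _ _ inK(3) zlt']) (use n' in auto)
    then show "outward_normal K' \<gamma> = - \<nu>" using opp by simp
    show "cball c \<rho> \<inter> {x. \<nu> \<bullet> x \<ge> \<beta>} \<subseteq> K'" using half' opp b' by auto
    have "\<sigma> * r = 2 * \<sigma> * (1 + \<sigma>) * \<rho>" using \<sigma>1 by (simp add: \<rho>_def field_simps)
    then show "diameter K \<le> 2 * \<sigma> * (1 + \<sigma>) * \<rho>" using z(3) by linarith
    have "z + r *\<^sub>R \<nu> \<in> K" using z(1,2) n(1) by (auto simp: subset_iff dist_norm)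
    from diameter_bounded_bound[OF element_props(6)[OF K(1)] this inK(1)]
    have "r \<le> diameter K" using n(1) z(1) by (simp add: dist_norm)
    then show "\<rho> \<le> diameter K" using \<rho>(4) by simp
  qed (use n \<rho>(1) c\<beta> half in auto)
qed

text \<open>The normals of three elements at a common side would be pairwise opposite, forcing a
  unit vector to be its own negative.\<close>

lemma third_element:
  assumes "K \<in> \<T>" "K' \<in> \<T>" "K'' \<in> \<T>" "\<gamma> facet_of K" "\<gamma> facet_of K'" "\<gamma> facet_of K''" "K \<noteq> K'"
  shows "K'' = K \<or> K'' = K'"
proof (rule ccontr)
  assume "\<not> (K'' = K \<or> K'' = K')"
  then have ne: "K \<noteq> K''" "K' \<noteq> K''" by auto
  have "outward_normal K' \<gamma> = - outward_normal K \<gamma>" "norm (outward_normal K \<gamma>) = 1"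
    using internal_side[OF assms(1,2,7,4,5)] by metis+
  moreover have "outward_normal K'' \<gamma> = - outward_normal K \<gamma>"
    using internal_side[OF assms(1,3) ne(1) assms(4,6)] by metis
  moreover have "outward_normal K'' \<gamma> = - outward_normal K' \<gamma>"
    using internal_side[OF assms(2,3) ne(2) assms(5,6)] by metis
  ultimately have "outward_normal K \<gamma> + outward_normal K \<gamma> = 0" "norm (outward_normal K \<gamma>) = 1"
    by (simp_all add: eq_neg_iff_add_eq_0)
  then show False by (simp flip: scaleR_2)
qed

lemma elements_at_side:
  assumes "K \<in> \<T>" "K' \<in> \<T>" "\<gamma> facet_of K" "\<gamma> facet_of K'" "K \<noteq> K'"
  shows "{K. K \<in> \<T> \<and> \<gamma> facet_of K} = {K, K'}"
  using third_element[of K K' _ \<gamma>] assms by blast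

lemma normal_jump_eq:
  assumes "K \<in> \<T>" "K' \<in> \<T>" "\<gamma> facet_of K" "\<gamma> facet_of K'" "K \<noteq> K'"
  shows "normal_jump \<T> z \<gamma> = outward_normal K \<gamma> \<bullet> (elem_grad K z - elem_grad K' z)"
proof -
  have "outward_normal K' \<gamma> = - outward_normal K \<gamma>"
    using internal_side[OF assms(1,2,5,3,4)] by metis
  then show ?thesis
    unfolding normal_jump_def elements_at_side[OF assms] using assms(5)
    by (simp add: inner_diff_right)
qed

lemma card_elements_at_side: "card {K \<in> \<T>. \<gamma> facet_of K} \<le> 2"
proof (rule ccontr)
  assume a: "\<not> ?thesis"
  then have "{K \<in> \<T>. \<gamma> facet_of K} \<noteq> {}" by (metis card.empty zero_le)
  then obtain K where K: "K \<in> \<T>" "\<gamma> facet_of K" by blast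
  show False
  proof (cases "\<exists>K'\<in>\<T>. \<gamma> facet_of K' \<and> K' \<noteq> K")
    case True
    then obtain K' where K': "K' \<in> \<T>" "\<gamma> facet_of K'" "K \<noteq> K'" by blast
    then show False using elements_at_side[OF K(1) K'(1) K(2) K'(2,3)] a by simp
  next
    case False
    then have "{K \<in> \<T>. \<gamma> facet_of K} = {K}" using K by blast
    then show False using a by simp
  qed
qed

end

section \<open>Finite element functions\<close>

context fe_mesh
begin

lemma affine_coeff_unique:
  assumes "K \<in> \<T>" "\<And>x. x \<in> K \<Longrightarrow> c + g \<bullet> x = c' + g' \<bullet> x"
  shows "g = g'"
proof (rule ccontr)
  assume "g \<noteq> g'"
  define d where "d = g - g'"
  have d0: "d \<noteq> 0" using \<open>g \<noteq> g'\<close> by (simp add: d_def)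
  obtain p r where p: "r > 0" "cball p r \<subseteq> K" using shape[OF assms(1)] by blast
  have *: "d \<bullet> x = c' - c" if "x \<in> K" for x using assms(2)[OF that] by (simp add: d_def inner_diff_left)
  have "p \<in> K" "p + (r / norm d) *\<^sub>R d \<in> K" using p d0 by (auto simp: subset_iff dist_norm)
  then have "d \<bullet> (p + (r / norm d) *\<^sub>R d) = d \<bullet> p" using * by simp
  then show False using p d0 by (simp add: inner_add_right)
qed

lemma elem_grad_eq:
  assumes "K \<in> \<T>" "\<And>x. x \<in> K \<Longrightarrow> z x = c + g \<bullet> x"
  shows "elem_grad K z = g"
  unfolding elem_grad_def
proof (rule the_equality)
  show "\<exists>c. \<forall>x\<in>K. z x = c + g \<bullet> x" using assms(2) by blast
  show "g' = g" if "\<exists>c. \<forall>x\<in>K. z x = c + g' \<bullet> x" for g'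
    using that assms affine_coeff_unique[OF assms(1)] by metis
qed

lemma fe_affine:
  assumes "z \<in> fe_space \<Omega> \<T>" "K \<in> \<T>"
  obtains c where "\<And>x. x \<in> K \<Longrightarrow> z x = c + elem_grad K z \<bullet> x"
proof -
  obtain q where "q \<in> Poly01 1" "\<And>x. x \<in> K \<Longrightarrow> z x = q x" using assms by (auto simp: fe_space_def)
  then obtain c g where "\<And>x. x \<in> K \<Longrightarrow> z x = c + g \<bullet> x" by (auto simp: Poly01_def)
  then show thesis using elem_grad_eq[OF assms(2)] that by metis
qed

section \<open>Extension by zero and its piecewise gradient\<close>

definition fe_ext :: "('a \<Rightarrow> real) \<Rightarrow> 'a \<Rightarrow> real" where
  "fe_ext z x = (if x \<in> closure \<Omega> then z x else 0)"

text \<open>Indicators of the disjoint interiors make this a bounded Borel function on the whole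
  space; its values on element boundaries concern a null set only.\<close>

definition pw_grad :: "('a \<Rightarrow> real) \<Rightarrow> 'a \<Rightarrow> 'a" where
  "pw_grad z x = (\<Sum>K\<in>\<T>. indicat_real (interior K) x *\<^sub>R elem_grad K z)"

lemma pw_grad_interior:
  assumes "K \<in> \<T>" "x \<in> interior K"
  shows "pw_grad z x = elem_grad K z"
proof -
  have "x \<notin> interior K'" if "K' \<in> \<T> - {K}" for K'
    using interiors_disjoint[of K K'] that assms by blast
  then have "(\<Sum>K'\<in>\<T> - {K}. indicat_real (interior K') x *\<^sub>R elem_grad K' z) = 0"
    by (intro sum.neutral) auto
  then show ?thesis unfolding pw_grad_def using assms finite_\<T> by (subst sum.remove[of _ K]) auto
qed

lemma pw_grad_outside: "x \<notin> closure \<Omega> \<Longrightarrow> pw_grad z x = 0"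
  unfolding pw_grad_def using interior_element_subset closure_subset
  by (intro sum.neutral) (auto simp: indicator_def)

lemma pw_grad_borel: "pw_grad z \<in> borel_measurable borel"
  unfolding pw_grad_def[abs_def] by (intro borel_measurable_sum borel_measurable_scaleR) auto

lemma pw_grad_bound: "norm (pw_grad z x) \<le> (\<Sum>K\<in>\<T>. norm (elem_grad K z))"
  unfolding pw_grad_def by (intro order_trans[OF norm_sum] sum_mono) (auto simp: indicator_def)

lemma fe_ext_outside: "z \<in> fe_space \<Omega> \<T> \<Longrightarrow> x \<notin> \<Omega> \<Longrightarrow> fe_ext z x = 0"
  using open_\<Omega> by (auto simp: fe_ext_def fe_space_def frontier_def interior_open)

lemma fe_ext_continuous:
  assumes "z \<in> fe_space \<Omega> \<T>" shows "continuous_on UNIV (fe_ext z)"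
proof -
  have "continuous_on (closure \<Omega> \<union> - \<Omega>) (\<lambda>x. if x \<in> closure \<Omega> then z x else 0)"
    using assms open_\<Omega>
    by (intro continuous_on_cases) (auto simp: fe_space_def frontier_def interior_open)
  moreover have "closure \<Omega> \<union> - \<Omega> = UNIV" using closure_subset by blast
  ultimately show ?thesis by (simp add: fe_ext_def[abs_def])
qed

lemma fe_ext_has_derivative:
  assumes z: "z \<in> fe_space \<Omega> \<T>"
  shows "AE x in lebesgue. (fe_ext z has_derivative (\<lambda>h. pw_grad z x \<bullet> h)) (at x)"
proof -
  have "AE x in lebesgue. x \<notin> skeleton"
    using skeleton_negligible by (intro AE_not_in) (simp add: negligible_iff_null_sets)
  then show ?thesis
  proof eventually_elim
    case (elim x)
    show ?case
    proof (cases "x \<in> closure \<Omega>")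
      case True
      then obtain K where K: "K \<in> \<T>" "x \<in> interior K" using off_skeleton elim by blast
      obtain c where c: "\<And>x. x \<in> K \<Longrightarrow> z x = c + elem_grad K z \<bullet> x" using fe_affine[OF z K(1)] by blast
      have "((\<lambda>x. c + elem_grad K z \<bullet> x) has_derivative (\<lambda>h. elem_grad K z \<bullet> h)) (at x)"
        by (auto intro!: derivative_eq_intros)
      then have "(fe_ext z has_derivative (\<lambda>h. elem_grad K z \<bullet> h)) (at x)"
      proof (rule has_derivative_transform_within_open[where s="interior K"])
        show "c + elem_grad K z \<bullet> y = fe_ext z y" if "y \<in> interior K" for y
          using that c[of y] interior_subset[of K] element_props(3)[OF K(1)] by (auto simp: fe_ext_def)
      qed (use K in auto)
      then show ?thesis using pw_grad_interior[OF K] by simp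
    next
      case False
      have "((\<lambda>x. 0) has_derivative (\<lambda>h. 0)) (at x)" by simp
      then have "(fe_ext z has_derivative (\<lambda>h. 0)) (at x)"
        by (rule has_derivative_transform_within_open[where s="- closure \<Omega>"]) (use False in \<open>auto simp: fe_ext_def\<close>)
      then show ?thesis using pw_grad_outside[OF False] by simp
    qed
  qed
qed

text \<open>A line may run inside element boundaries, so differentiability almost everywhere in
  space says nothing about it. But by convexity and compactness the line meets \<open>K\<close> in a
  compact interval of parameters, and only its two ends have to be excluded.\<close>

lemma segment_parameters:
  assumes "K \<in> \<T>" "x \<noteq> y"
  obtains E where "finite E" "\<And>t. x + t *\<^sub>R (y - x) \<in> K \<Longrightarrow> t \<notin> E \<Longrightarrow>
     \<exists>U. open U \<and> t \<in> U \<and> (\<forall>s\<in>U. x + s *\<^sub>R (y - x) \<in> K)"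
proof -
  define I where "I = (\<lambda>t::real. x + t *\<^sub>R (y - x)) -` K"
  note Kp = element_props[OF assms(1)]
  have "closed I" unfolding I_def by (intro closed_vimage Kp(5) continuous_intros)
  moreover have "bounded I"
  proof -
    obtain B where B: "\<And>p. p \<in> K \<Longrightarrow> norm p \<le> B" using Kp(6) bounded_iff by blast
    have "\<bar>t\<bar> \<le> (B + norm x) / norm (y - x)" if "t \<in> I" for t
    proof -
      have "\<bar>t\<bar> * norm (y - x) = norm ((x + t *\<^sub>R (y - x)) - x)" by simp
      also have "\<dots> \<le> B + norm x"
        using B[of "x + t *\<^sub>R (y - x)"] that norm_triangle_ineq4[of "x + t *\<^sub>R (y - x)" x] by (simp add: I_def)
      finally show ?thesis using assms(2) by (simp add: field_simps)
    qed
    then show ?thesis unfolding bounded_iff by auto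
  qed
  ultimately have cI: "compact I" by (simp add: compact_eq_bounded_closed)
  have "convex I"
  proof (rule convexI)
    fix s t u v :: real assume st: "s \<in> I" "t \<in> I" "0 \<le> u" "0 \<le> v" "u + v = 1"
    have "u *\<^sub>R (x + s *\<^sub>R (y - x)) + v *\<^sub>R (x + t *\<^sub>R (y - x)) \<in> K"
      using Kp(2) st by (intro convexD) (auto simp: I_def)
    moreover have "u *\<^sub>R (x + s *\<^sub>R (y - x)) + v *\<^sub>R (x + t *\<^sub>R (y - x)) = (u + v) *\<^sub>R x + (u * s + v * t) *\<^sub>R (y - x)"
      by (simp add: algebra_simps)
    ultimately show "u *\<^sub>R s + v *\<^sub>R t \<in> I" using st(5) by (simp add: I_def)
  qed
  then obtain a b where ab: "I = {a..b}" using cI connected_compact_interval_1[of I] convex_connected by blast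
  show thesis
  proof (rule that[of "{a, b}"])
    fix t assume "x + t *\<^sub>R (y - x) \<in> K" "t \<notin> {a, b}"
    then have "t \<in> {a<..<b}" using ab by (auto simp: I_def set_eq_iff)
    moreover have "x + s *\<^sub>R (y - x) \<in> K" if "s \<in> {a<..<b}" for s
    proof -
      have "s \<in> I" using that ab by simp
      then show ?thesis by (simp add: I_def)
    qed
    ultimately show "\<exists>U. open U \<and> t \<in> U \<and> (\<forall>s\<in>U. x + s *\<^sub>R (y - x) \<in> K)"
      by (intro exI[of _ "{a<..<b}"]) auto
  qed simp
qed

text \<open>On a line the extension is piecewise affine with finitely many breakpoints, so the fundamental theorem of
  calculus with finitely many exceptions applies.\<close>

lemma fe_ext_lipb:
  assumes z: "z \<in> fe_space \<Omega> \<T>" shows "lipb (fe_ext z)"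
proof -
  define G where "G = (\<Sum>K\<in>\<T>. norm (elem_grad K z))"
  have G0: "G \<ge> 0" unfolding G_def by (intro sum_nonneg) auto
  have GK: "norm (elem_grad K z) \<le> G" if "K \<in> \<T>" for K
    unfolding G_def using that finite_\<T> by (intro member_le_sum) auto
  have "\<bar>fe_ext z x - fe_ext z y\<bar> \<le> G * norm (x - y)" for x y
  proof (cases "x = y")
    case False
    define p where "p t = x + t *\<^sub>R (y - x)" for t :: real
    have "\<exists>E. finite E \<and> (\<forall>t. p t \<in> K \<longrightarrow> t \<notin> E \<longrightarrow> (\<exists>U. open U \<and> t \<in> U \<and> (\<forall>s\<in>U. p s \<in> K)))" if "K \<in> \<T>" for K
      using segment_parameters[OF that False] unfolding p_def by metis
    then obtain E where E: "\<And>K. K \<in> \<T> \<Longrightarrow> finite (E K)"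
      "\<And>K t. K \<in> \<T> \<Longrightarrow> p t \<in> K \<Longrightarrow> t \<notin> E K \<Longrightarrow> \<exists>U. open U \<and> t \<in> U \<and> (\<forall>s\<in>U. p s \<in> K)"
      by metis
    define S where "S = (\<Union>K\<in>\<T>. E K)"
    have finS: "finite S" unfolding S_def using finite_\<T> E(1) by blast
    define f where "f t = fe_ext z (p t)" for t
    have pc: "continuous_on A p" for A unfolding p_def[abs_def] by (intro continuous_intros)
    have "\<exists>d. (f has_vector_derivative d) (at t) \<and> \<bar>d\<bar> \<le> G * norm (y - x)" if tS: "t \<notin> S" for t
    proof (cases "p t \<in> closure \<Omega>")
      case True
      \<comment> \<open>Any element containing the points for all parameters near \<open>t\<close>
        will do, even if the segment lies in its boundary: there the extension is affine along the
        line with slope \<open>elem_grad K z \<bullet> (y - x)\<close>.\<close>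
      then obtain K where K: "K \<in> \<T>" "p t \<in> K" using Union_\<T> by blast
      obtain U where U: "open U" "t \<in> U" "\<And>s. s \<in> U \<Longrightarrow> p s \<in> K"
      proof -
        have "t \<notin> E K" using tS K(1) by (auto simp: S_def)
        from E(2)[OF K this] show thesis using that by blast
      qed
      obtain c where c: "\<And>x. x \<in> K \<Longrightarrow> z x = c + elem_grad K z \<bullet> x" using fe_affine[OF z K(1)] by blast
      have "((\<lambda>s. c + elem_grad K z \<bullet> p s) has_derivative (\<lambda>h. h *\<^sub>R (elem_grad K z \<bullet> (y - x)))) (at t)"
        unfolding p_def by (auto intro!: derivative_eq_intros)
      then have "(f has_derivative (\<lambda>h. h *\<^sub>R (elem_grad K z \<bullet> (y - x)))) (at t)"
      proof (rule has_derivative_transform_within_open[OF _ U(1,2)])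
        show "c + elem_grad K z \<bullet> p s = f s" if "s \<in> U" for s
          using c[OF U(3)[OF that]] U(3)[OF that] element_props(3)[OF K(1)] by (auto simp: f_def fe_ext_def)
      qed
      moreover have "\<bar>elem_grad K z \<bullet> (y - x)\<bar> \<le> G * norm (y - x)"
        by (intro order_trans[OF Cauchy_Schwarz_ineq2] mult_right_mono GK K) auto
      ultimately show ?thesis unfolding has_vector_derivative_def by blast
    next
      case False
      have op: "open (p -` (- closure \<Omega>))" by (intro open_vimage pc) auto
      have "((\<lambda>s. 0) has_derivative (\<lambda>h. h *\<^sub>R 0)) (at t)" by simp
      then have "(f has_derivative (\<lambda>h. h *\<^sub>R 0)) (at t)"
        by (rule has_derivative_transform_within_open[OF _ op]) (use False in \<open>auto simp: f_def fe_ext_def\<close>)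
      then show ?thesis using G0 unfolding has_vector_derivative_def by (intro exI[of _ 0]) auto
    qed
    then obtain f' where f': "\<And>t. t \<notin> S \<Longrightarrow> (f has_vector_derivative f' t) (at t)" "\<And>t. t \<notin> S \<Longrightarrow> \<bar>f' t\<bar> \<le> G * norm (y - x)"
      by metis
    define f'' where "f'' t = (if t \<in> S then 0 else f' t)" for t
    have "(f'' has_integral (f 1 - f 0)) {0..1}"
    proof (rule fundamental_theorem_of_calculus_interior_strong[OF finS])
      show "continuous_on {0..1} f" unfolding f_def
        by (intro continuous_on_compose2[OF fe_ext_continuous[OF z]] pc) auto
    qed (use f'(1) in \<open>auto simp: f''_def\<close>)
    then have "norm (f 1 - f 0) \<le> G * norm (y - x) * measure lborel {0..1::real}"
      by (intro has_integral_bound_real[where f=f'']) (use G0 f'(2) in \<open>auto simp: f''_def\<close>)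
    then show ?thesis by (simp add: f_def p_def norm_minus_commute abs_minus_commute)
  qed simp
  moreover have "\<exists>M. \<forall>x. \<bar>fe_ext z x\<bar> \<le> M"
  proof -
    have "bounded (fe_ext z ` closure \<Omega>)"
      using bounded_\<Omega> by (intro compact_imp_bounded compact_continuous_image continuous_on_subset[OF fe_ext_continuous[OF z]]) auto
    then obtain M where M: "\<And>x. x \<in> closure \<Omega> \<Longrightarrow> \<bar>fe_ext z x\<bar> \<le> M" by (auto simp: bounded_iff)
    have "\<bar>fe_ext z x\<bar> \<le> \<bar>M\<bar>" for x using M[of x] by (cases "x \<in> closure \<Omega>") (auto simp: fe_ext_def)
    then show ?thesis by blast
  qed
  ultimately show ?thesis using G0 unfolding lipb_def by blast
qed

lemma pw_grad_lebesgue: "pw_grad z \<in> borel_measurable lebesgue"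
  by (rule measurable_completion) (simp add: pw_grad_borel)

lemma fe_weak_grad:
  assumes z: "z \<in> fe_space \<Omega> \<T>"
  shows "z \<in> H1 \<Omega>" "pw_grad z \<in> L2 \<Omega>" "AE x in lebesgue_on \<Omega>. weak_grad \<Omega> z x = pw_grad z x"
proof -
  note * = lipb_has_weak_grad[OF open_\<Omega> bounded_\<Omega> fe_ext_lipb[OF z] fe_ext_has_derivative[OF z] pw_grad_lebesgue pw_grad_bound]
  have eq: "fe_ext z x = z x" if "x \<in> \<Omega>" for x using that closure_subset by (auto simp: fe_ext_def)
  have 1: "z \<in> L2 \<Omega>" using *(1) L2_cong(1)[of \<Omega> "fe_ext z" z, OF eq] by simp
  have 3: "has_weak_grad \<Omega> z (pw_grad z)" using *(3) has_weak_grad_cong[of \<Omega> "fe_ext z" z, OF eq] by simp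
  show "pw_grad z \<in> L2 \<Omega>" by (rule *(2))
  show "z \<in> H1 \<Omega>" "AE x in lebesgue_on \<Omega>. weak_grad \<Omega> z x = pw_grad z x"
    using H1_I[OF open_\<Omega> bounded_\<Omega> 1 *(2) 3] by auto
qed

lemma H1_seminorm_fe:
  assumes "v \<in> H1 \<Omega>" "z \<in> fe_space \<Omega> \<T>"
  shows "H1_seminorm \<Omega> (\<lambda>x. v x - z x) = L2_norm \<Omega> (\<lambda>x. weak_grad \<Omega> v x - pw_grad z x)"
proof -
  note zH = fe_weak_grad[OF assms(2)]
  note vz = weak_grad_diff[OF open_\<Omega> bounded_\<Omega> assms(1) zH(1)]
  show ?thesis
  proof (rule H1_seminorm_cong_AE[OF vz(1)])
    show "AE x in lebesgue_on \<Omega>. weak_grad \<Omega> (\<lambda>x. v x - z x) x = weak_grad \<Omega> v x - pw_grad z x"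
      using vz(2) zH(3) by eventually_elim simp
  qed (intro L2_diff H1_D(2)[OF assms(1)] zH(2))
qed

text \<open>A test function minus the extension by zero of \<open>z\<close> is Lipschitz and
  vanishes outside \<open>\<Omega>\<close>, so \<open>Poincare_lipb\<close> applies to it with a
  constant that does not see the mesh. Then the test function tends to \<open>v\<close>.\<close>

lemma Poincare_fe:
  assumes v: "v \<in> H10 \<Omega>" and z: "z \<in> fe_space \<Omega> \<T>" and R: "\<Omega> \<subseteq> ball 0 R" "R > 0"
  shows "L2_norm \<Omega> (\<lambda>x. v x - z x) \<le> 2 * (R + 1) * H1_seminorm \<Omega> (\<lambda>x. v x - z x)"
proof -
  have vH: "v \<in> H1 \<Omega>" using v by (simp add: H10_def)
  note zH = fe_weak_grad[OF z] and v2 = H1_D[OF vH]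
  note z2 = H1_D[OF zH(1)]
  define C where "C = 2 * (R + 1)"
  have C0: "C > 0" using R(2) by (simp add: C_def)
  have "L2_norm \<Omega> (\<lambda>x. v x - z x) \<le> C * H1_seminorm \<Omega> (\<lambda>x. v x - z x) + d" if d: "d > 0" for d
  proof -
    \<comment> \<open>Replacing \<open>v\<close> by the test function costs \<open>e\<close> once
      directly and \<open>C * e\<close> through the gradient, in total \<open>d\<close>.\<close>
    define e where "e = d / (1 + C)"
    have e: "e > 0" using d C0 by (simp add: e_def)
    obtain \<phi> where \<phi>: "\<phi> \<in> test_functions \<Omega>"
      "(L2_norm \<Omega> (\<lambda>x. v x - \<phi> x))\<^sup>2 + (H1_seminorm \<Omega> (\<lambda>x. v x - \<phi> x))\<^sup>2 < e\<^sup>2"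
    proof -
      have "e\<^sup>2 > 0" using e by simp
      moreover have "\<forall>\<epsilon>>0. \<exists>\<phi>\<in>test_functions \<Omega>.
          (L2_norm \<Omega> (\<lambda>x. v x - \<phi> x))\<^sup>2 + (H1_seminorm \<Omega> (\<lambda>x. v x - \<phi> x))\<^sup>2 < \<epsilon>"
        using v by (simp add: H10_def)
      ultimately show thesis using that by blast
    qed
    have sum_less: "s \<le> e" "t \<le> e" if "s\<^sup>2 + t\<^sup>2 < e\<^sup>2" for s t :: real
    proof -
      have "s\<^sup>2 \<le> e\<^sup>2" "t\<^sup>2 \<le> e\<^sup>2" using that zero_le_power2[of s] zero_le_power2[of t] by linarith+
      then show "s \<le> e" "t \<le> e" using e by (auto intro: power2_le_imp_le)
    qed
    note l1 = sum_less(1)[OF \<phi>(2)] and l2 = sum_less(2)[OF \<phi>(2)]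
    note \<phi>H = test_function_weak_grad[OF open_\<Omega> bounded_\<Omega> \<phi>(1)]
    note v\<phi> = weak_grad_diff[OF open_\<Omega> bounded_\<Omega> vH \<phi>H(1)]
    note \<phi>2 = test_function_L2[OF \<phi>(1) \<Omega>_lmeasurable]
    have s1: "H1_seminorm \<Omega> (\<lambda>x. v x - \<phi> x) = L2_norm \<Omega> (\<lambda>x. weak_grad \<Omega> v x - classical_grad \<phi> x)"
    proof (rule H1_seminorm_cong_AE[OF v\<phi>(1)])
      show "AE x in lebesgue_on \<Omega>. weak_grad \<Omega> (\<lambda>x. v x - \<phi> x) x = weak_grad \<Omega> v x - classical_grad \<phi> x"
        using v\<phi>(2) \<phi>H(2) by eventually_elim simp
    qed (intro L2_diff v2 \<phi>2)
    note s2 = H1_seminorm_fe[OF vH z]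
    define w where "w x = \<phi> x - fe_ext z x" for x
    define g where "g x = classical_grad \<phi> x - pw_grad z x" for x
    obtain B where B: "\<And>x. norm (classical_grad \<phi> x) \<le> B" using test_function_bounds[OF \<phi>(1)] by blast
    note sm = test_functions_smooth[OF \<phi>(1)]
    have P: "L2_norm \<Omega> w \<le> C * L2_norm \<Omega> g"
      unfolding C_def
    proof (rule Poincare_lipb[OF open_\<Omega> bounded_\<Omega> R])
      show "lipb w" unfolding w_def[abs_def] by (intro lipb_diff test_function_lipb[OF \<phi>(1)] fe_ext_lipb[OF z])
      show "w x = 0" if "x \<notin> \<Omega>" for x
        using that fe_ext_outside[OF z] test_function_outside[OF \<phi>(1)] by (simp add: w_def)
      show "AE x in lebesgue. (w has_derivative (\<lambda>h. g x \<bullet> h)) (at x)"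
        using fe_ext_has_derivative[OF z]
      proof eventually_elim
        case (elim x)
        show ?case unfolding w_def[abs_def]
          by (rule has_derivative_eq_rhs[OF has_derivative_diff[OF smooth_has_derivative_grad[OF sm] elim]])
             (simp add: g_def inner_diff_left)
      qed
      have "classical_grad \<phi> \<in> borel_measurable lebesgue"
        by (rule measurable_completion) (simp add: smooth_grad_borel[OF sm])
      then show "g \<in> borel_measurable lebesgue"
        unfolding g_def[abs_def] using pw_grad_lebesgue by (intro borel_measurable_diff)
      show "norm (g x) \<le> B + (\<Sum>K\<in>\<T>. norm (elem_grad K z))" for x
        unfolding g_def by (intro order_trans[OF norm_triangle_ineq4] add_mono B pw_grad_bound)
    qed
    have wz: "L2_norm \<Omega> w = L2_norm \<Omega> (\<lambda>x. \<phi> x - z x)"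
      using closure_subset by (intro L2_cong(2)) (auto simp: w_def fe_ext_def)
    have comm: "L2_norm \<Omega> (\<lambda>x. a x - b x) = L2_norm \<Omega> (\<lambda>x. b x - a x)" for a b :: "'a \<Rightarrow> 'a"
      by (simp add: L2_norm_def norm_minus_commute)
    have "L2_norm \<Omega> g = L2_norm \<Omega> (\<lambda>x. (classical_grad \<phi> x - weak_grad \<Omega> v x) + (weak_grad \<Omega> v x - pw_grad z x))"
      by (simp add: g_def[abs_def])
    also have "\<dots> \<le> L2_norm \<Omega> (\<lambda>x. classical_grad \<phi> x - weak_grad \<Omega> v x) + L2_norm \<Omega> (\<lambda>x. weak_grad \<Omega> v x - pw_grad z x)"
      by (intro L2_triangle L2_diff v2 \<phi>2 zH)
    also have "\<dots> \<le> e + H1_seminorm \<Omega> (\<lambda>x. v x - z x)"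
      using l2 s1 s2 comm[of "classical_grad \<phi>" "weak_grad \<Omega> v"] by simp
    finally have gb: "C * L2_norm \<Omega> g \<le> C * (e + H1_seminorm \<Omega> (\<lambda>x. v x - z x))"
      using C0 by (intro mult_left_mono) auto
    have "L2_norm \<Omega> (\<lambda>x. v x - z x) = L2_norm \<Omega> (\<lambda>x. (v x - \<phi> x) + (\<phi> x - z x))" by simp
    also have "\<dots> \<le> L2_norm \<Omega> (\<lambda>x. v x - \<phi> x) + L2_norm \<Omega> (\<lambda>x. \<phi> x - z x)"
      by (intro L2_triangle L2_diff v2 \<phi>2 z2)
    also have "\<dots> \<le> e + C * (e + H1_seminorm \<Omega> (\<lambda>x. v x - z x))"
      using l1 P wz gb by simp
    also have "\<dots> = C * H1_seminorm \<Omega> (\<lambda>x. v x - z x) + e * (1 + C)" by (simp add: algebra_simps)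
    also have "e * (1 + C) = d" using C0 by (simp add: e_def)
    finally show ?thesis .
  qed
  then have "L2_norm \<Omega> (\<lambda>x. v x - z x) \<le> C * H1_seminorm \<Omega> (\<lambda>x. v x - z x)"
    by (rule field_le_epsilon)
  then show ?thesis by (simp add: C_def)
qed

end

section \<open>Elementwise projections and measures\<close>

lemma lebesgue_measurable_cong_AE:
  fixes f g :: "'a::euclidean_space \<Rightarrow> 'b::euclidean_space"
  assumes "f \<in> borel_measurable lebesgue" "AE x in lebesgue. f x = g x"
  shows "g \<in> borel_measurable lebesgue"
proof (rule measurableI)
  fix A :: "'b set" assume A: "A \<in> sets borel"
  have "f -` A \<inter> space lebesgue \<in> sets lebesgue" using assms(1) A by (rule measurable_sets)
  moreover have "AE x in lebesgue. (x \<in> f -` A \<inter> space lebesgue) = (x \<in> g -` A \<inter> space lebesgue)"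
    using assms(2) by eventually_elim auto
  ultimately show "g -` A \<inter> space lebesgue \<in> sets lebesgue"
    using completion.in_sets_AE by blast
qed simp

text \<open>Elements are closed and may touch the boundary of \<open>\<Omega>\<close>, where members
  of \<open>L2 \<Omega>\<close> are arbitrary. Since that part is null, norms over \<open>K\<close>
  may be computed on \<open>interior K\<close>, which lies in \<open>\<Omega>\<close>.\<close>

lemma L2_extend_null:
  fixes f :: "'a::euclidean_space \<Rightarrow> 'b::euclidean_space"
  assumes "f \<in> L2 A" "A \<subseteq> B" "A \<in> sets lebesgue" "B \<in> sets lebesgue" "negligible (B - A)"
  shows "f \<in> L2 B" "L2_norm B f = L2_norm A f"
proof -
  have AE: "AE x in lebesgue. x \<notin> B - A"
    using assms(5) by (intro AE_not_in) (simp add: negligible_iff_null_sets)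
  have "(\<lambda>x. indicat_real A x *\<^sub>R f x) \<in> borel_measurable lebesgue"
    using L2_D(1)[OF assms(1)] assms(3) by (simp add: borel_measurable_restrict_space_iff)
  then have "(\<lambda>x. indicat_real B x *\<^sub>R f x) \<in> borel_measurable lebesgue"
  proof (rule lebesgue_measurable_cong_AE)
    show "AE x in lebesgue. indicat_real A x *\<^sub>R f x = indicat_real B x *\<^sub>R f x"
      using AE by eventually_elim (use assms(2) in \<open>auto simp: indicator_def\<close>)
  qed
  then have m: "f \<in> borel_measurable (lebesgue_on B)"
    using assms(4) by (simp add: borel_measurable_restrict_space_iff)
  have i: "integrable lebesgue (\<lambda>x. indicat_real A x *\<^sub>R (norm (f x))\<^sup>2)"
    using L2_D(2)[OF assms(1)] assms(3) by (simp add: integrable_restrict_space)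
  have AE2: "AE x in lebesgue. indicat_real A x *\<^sub>R (norm (f x))\<^sup>2 = indicat_real B x *\<^sub>R (norm (f x))\<^sup>2"
    using AE by eventually_elim (use assms(2) in \<open>auto simp: indicator_def\<close>)
  have m2: "(\<lambda>x. indicat_real B x *\<^sub>R (norm (f x))\<^sup>2) \<in> borel_measurable lebesgue"
    using lebesgue_measurable_cong_AE[OF borel_measurable_integrable[OF i] AE2] .
  have "integrable (lebesgue_on B) (\<lambda>x. (norm (f x))\<^sup>2)"
    using integrable_cong_AE_imp[OF i m2] AE2 assms(4)
    by (auto simp: integrable_restrict_space elim: eventually_mono)
  with m show "f \<in> L2 B" by (simp add: L2_def)
  have "(LINT x|lebesgue. indicat_real A x *\<^sub>R (norm (f x))\<^sup>2) = (LINT x|lebesgue. indicat_real B x *\<^sub>R (norm (f x))\<^sup>2)"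
    by (rule integral_cong_AE[OF borel_measurable_integrable[OF i] m2 AE2])
  then show "L2_norm B f = L2_norm A f"
    using assms(3,4) by (simp add: L2_norm_def integral_restrict_space)
qed

lemma L2_inner_diff_left:
  assumes "f \<in> L2 S" "g \<in> L2 S" "h \<in> L2 S"
  shows "L2_inner S (\<lambda>x. f x - g x) h = L2_inner S f h - L2_inner S g h"
  using L2_inner_integrable(2)[OF assms(1,3)] L2_inner_integrable(2)[OF assms(2,3)]
  by (simp add: L2_inner_def inner_diff_left)

lemma L2_inner_add_left:
  assumes "f \<in> L2 S" "g \<in> L2 S" "h \<in> L2 S"
  shows "L2_inner S (\<lambda>x. f x + g x) h = L2_inner S f h + L2_inner S g h"
  using L2_inner_integrable(2)[OF assms(1,3)] L2_inner_integrable(2)[OF assms(2,3)]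
  by (simp add: L2_inner_def inner_add_left)

lemma L2_inner_restrict:
  fixes F h :: "'a::euclidean_space \<Rightarrow> 'b::euclidean_space"
  assumes "B \<subseteq> S" "B \<in> sets lebesgue" "S \<in> sets lebesgue" "\<And>x. x \<in> S - B \<Longrightarrow> h x = 0"
  shows "L2_inner S F h = L2_inner B F h"
proof -
  have "L2_inner S F h = (LINT x|lebesgue. indicat_real S x *\<^sub>R (F x \<bullet> h x))"
    using assms(3) by (simp add: L2_inner_def integral_restrict_space)
  also have "(\<lambda>x. indicat_real S x *\<^sub>R (F x \<bullet> h x)) = (\<lambda>x. indicat_real B x *\<^sub>R (F x \<bullet> h x))"
    using assms(1,4) by (auto simp: indicator_def fun_eq_iff)
  also have "(LINT x|lebesgue. indicat_real B x *\<^sub>R (F x \<bullet> h x)) = L2_inner B F h"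
    using assms(2) by (simp add: L2_inner_def integral_restrict_space)
  finally show ?thesis .
qed

text \<open>A step of length \<open>\<rho>/2\<close> from \<open>c\<close> along the gradient,
  oriented by the sign of the value at \<open>c\<close>, raises the absolute value by
  \<open>norm g * \<rho>/2\<close>; within radius \<open>\<rho>/4\<close> at most half of this gain
  is lost. The ball stays within distance \<open>3/4 * \<rho>\<close> of \<open>c\<close>, where
  bumps are bounded below.\<close>

lemma affine_ball_bounds:
  fixes c g :: "'a::euclidean_space"
  assumes "\<rho> > 0"
  obtains p where "ball p (\<rho>/4) \<subseteq> cball c (3/4 * \<rho>)"
    "\<And>x. x \<in> ball p (\<rho>/4) \<Longrightarrow> (\<bar>A + g \<bullet> c\<bar> + norm g * \<rho>) / 4 \<le> \<bar>A + g \<bullet> x\<bar>"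
proof -
  define s :: real where "s = (if A + g \<bullet> c \<ge> 0 then 1 else -1)"
  define e where "e = (if g = 0 then 0 else (1 / norm g) *\<^sub>R g)"
  have s: "s * s = 1" "s * (A + g \<bullet> c) = \<bar>A + g \<bullet> c\<bar>" "\<bar>s\<bar> = 1" by (auto simp: s_def)
  have e: "norm e \<le> 1" "g \<bullet> e = norm g" by (auto simp: e_def dot_square_norm power2_eq_square)
  define p where "p = c + (s * (\<rho>/2)) *\<^sub>R e"
  show thesis
  proof (rule that[of p])
    have pc: "norm (p - c) \<le> \<rho>/2"
      using mult_left_mono[OF e(1), of "\<rho>/2"] assms s(3) by (simp add: p_def abs_mult)
    show "ball p (\<rho>/4) \<subseteq> cball c (3/4 * \<rho>)"
    proof
      fix x assume "x \<in> ball p (\<rho>/4)"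
      then have "dist c x \<le> dist c p + \<rho>/4" using dist_triangle[of c x p] by simp
      then show "x \<in> cball c (3/4 * \<rho>)" using pc by (simp add: dist_norm norm_minus_commute)
    qed
    fix x assume x: "x \<in> ball p (\<rho>/4)"
    have gx: "\<bar>g \<bullet> (x - p)\<bar> \<le> norm g * (\<rho>/4)"
      using x by (intro order_trans[OF Cauchy_Schwarz_ineq2] mult_left_mono) (auto simp: dist_norm norm_minus_commute)
    have "A + g \<bullet> x = (A + g \<bullet> c) + s * (\<rho>/2) * norm g + g \<bullet> (x - p)"
      using e(2) by (simp add: p_def inner_diff_right inner_add_right)
    then have "s * (A + g \<bullet> x) = s * (A + g \<bullet> c) + (s * s) * (\<rho>/2) * norm g + s * (g \<bullet> (x - p))"
      by (simp add: algebra_simps)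
    then have 1: "s * (A + g \<bullet> x) = \<bar>A + g \<bullet> c\<bar> + (\<rho>/2) * norm g + s * (g \<bullet> (x - p))" using s by simp
    have 2: "\<bar>s * (g \<bullet> (x - p))\<bar> \<le> norm g * (\<rho>/4)" using gx s(3) by (simp add: abs_mult)
    have 3: "s * (A + g \<bullet> x) \<le> \<bar>A + g \<bullet> x\<bar>" by (auto simp: s_def)
    have 4: "norm g * \<rho> \<ge> 0" using assms by simp
    have "(a + n * t) / 4 \<le> m"
      if "X = a + (t / 2) * n + y" "- y \<le> n * (t / 4)" "X \<le> m" "n * t \<ge> 0" "a \<ge> 0" for X a t n y m :: real
      using that by (simp add: mult.commute)
    from this[OF 1 abs_le_D2[OF 2] 3 4 abs_ge_zero] show "(\<bar>A + g \<bullet> c\<bar> + norm g * \<rho>) / 4 \<le> \<bar>A + g \<bullet> x\<bar>" .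
  qed
qed

definition unit_vol :: "'a::euclidean_space itself \<Rightarrow> real" where
  "unit_vol _ = measure lebesgue (ball (0::'a) 1)"

lemma unit_vol_pos: "unit_vol TYPE('a::euclidean_space) > 0"
  unfolding unit_vol_def by (simp add: content_ball_pos)

lemma measure_ball_unit_vol:
  assumes "r \<ge> 0"
  shows "measure lebesgue (ball (c::'a::euclidean_space) r) = unit_vol TYPE('a) * r ^ DIM('a)"
    "measure lebesgue (cball (c::'a::euclidean_space) r) = unit_vol TYPE('a) * r ^ DIM('a)"
  using content_ball_conv_unit_ball[OF assms, of c] content_cball_conv_ball[of c r]
  by (simp_all add: unit_vol_def mult.commute)

text \<open>Definiteness of the Gram form, which existence and uniqueness of the projection rest on.
  A vanishing norm forces \<open>M = 0\<close>, since \<open>M / 4\<close> is a lower bound for the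
  absolute value on a small ball.\<close>

lemma affine_L2_definite:
  fixes c g :: "'a::euclidean_space"
  assumes "S \<in> lmeasurable" "cball c \<rho> \<subseteq> S" "\<rho> > 0" "(\<lambda>x. A + g \<bullet> x) \<in> L2 S"
    and 0: "L2_inner S (\<lambda>x. A + g \<bullet> x) (\<lambda>x. A + g \<bullet> x) = 0"
  shows "A = 0 \<and> g = 0"
proof -
  obtain p where p: "ball p (\<rho>/4) \<subseteq> cball c (3/4 * \<rho>)"
    "\<And>x. x \<in> ball p (\<rho>/4) \<Longrightarrow> (\<bar>A + g \<bullet> c\<bar> + norm g * \<rho>) / 4 \<le> \<bar>A + g \<bullet> x\<bar>"
    using affine_ball_bounds[OF assms(3), of c A g] by blast
  define M where "M = \<bar>A + g \<bullet> c\<bar> + norm g * \<rho>"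
  have M0: "M \<ge> 0" using assms(3) by (simp add: M_def)
  have sub: "ball p (\<rho>/4) \<subseteq> S" using p(1) assms(2,3) by (fastforce simp: subset_iff)
  have "(M/4)\<^sup>2 * measure lebesgue (ball p (\<rho>/4)) = (LINT x|lebesgue_on (ball p (\<rho>/4)). (M/4)\<^sup>2)"
    by (simp add: measure_restrict_space mult.commute)
  also have "\<dots> \<le> (LINT x|lebesgue_on (ball p (\<rho>/4)). (norm (A + g \<bullet> x))\<^sup>2)"
  proof (rule integral_mono)
    show "integrable (lebesgue_on (ball p (\<rho>/4))) (\<lambda>x. (norm (A + g \<bullet> x))\<^sup>2)"
      by (rule L2_D(2)[OF L2_subset[OF assms(4) sub]]) (use assms(1) in auto)
    show "integrable (lebesgue_on (ball p (\<rho>/4))) (\<lambda>x. (M/4)\<^sup>2)"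
      by (rule finite_measure.integrable_const[OF finite_measure_lebesgue_on]) simp
    show "(M/4)\<^sup>2 \<le> (norm (A + g \<bullet> x))\<^sup>2" if "x \<in> space (lebesgue_on (ball p (\<rho>/4)))" for x
    proof (rule power_mono)
      show "M / 4 \<le> norm (A + g \<bullet> x)" using p(2)[of x] that by (simp add: M_def)
    qed (use M0 in auto)
  qed
  also have "\<dots> = (L2_norm (ball p (\<rho>/4)) (\<lambda>x. A + g \<bullet> x))\<^sup>2" by (simp add: L2_norm_sq)
  also have "\<dots> \<le> (L2_norm S (\<lambda>x. A + g \<bullet> x))\<^sup>2"
    using sub assms(1,4) by (intro power_mono L2_norm_mono_set L2_norm_nonneg) auto
  also have "\<dots> = 0" unfolding L2_norm_sq using 0 by (simp add: L2_inner_def power2_eq_square)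
  finally have "(M/4)\<^sup>2 * measure lebesgue (ball p (\<rho>/4)) \<le> 0" .
  moreover have "measure lebesgue (ball p (\<rho>/4)) > 0" using assms(3) by (simp add: content_ball_pos)
  ultimately have "(M/4)\<^sup>2 \<le> 0" by (meson mult_pos_pos not_le)
  then have "M = 0" by simp
  then have "A + g \<bullet> c = 0" "norm g * \<rho> = 0"
    using assms(3) by (auto simp: M_def add_nonneg_eq_0_iff)
  then show ?thesis using assms(3) by auto
qed

text \<open>The Gram map of the coefficient space is injective by definiteness, hence surjective.\<close>

lemma L2_projection_exists:
  fixes Q :: "'e::euclidean_space \<Rightarrow> 'a::euclidean_space \<Rightarrow> real"
  assumes lin: "\<And>x. linear (\<lambda>e. Q e x)" and L2: "\<And>e. Q e \<in> L2 S" and g: "g \<in> L2 S"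
    and def: "\<And>e. L2_inner S (Q e) (Q e) = 0 \<Longrightarrow> e = 0"
  obtains e where "\<And>e'. L2_inner S (\<lambda>x. g x - Q e x) (Q e') = 0"
proof -
  have functional: "linear (\<lambda>e. L2_inner S h (Q e))" if h: "h \<in> L2 S" for h
  proof (rule linearI)
    fix e e' :: 'e and k :: real
    show "L2_inner S h (Q (e + e')) = L2_inner S h (Q e) + L2_inner S h (Q e')"
      using L2_inner_integrable(2)[OF h L2[of e]] L2_inner_integrable(2)[OF h L2[of e']] linear_add[OF lin]
      by (simp add: L2_inner_def distrib_left)
    show "L2_inner S h (Q (k *\<^sub>R e)) = k *\<^sub>R L2_inner S h (Q e)"
      by (simp add: L2_inner_def linear_cmul[OF lin] mult.left_commute)
  qed
  have rep: "L2_inner S h (Q e) = (\<Sum>b\<in>Basis. L2_inner S h (Q b) *\<^sub>R b) \<bullet> e" if h: "h \<in> L2 S" for h e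
  proof -
    have "L2_inner S h (Q e) = L2_inner S h (Q (\<Sum>b\<in>Basis. (e \<bullet> b) *\<^sub>R b))" by (simp add: euclidean_representation)
    also have "\<dots> = (\<Sum>b\<in>Basis. (e \<bullet> b) * L2_inner S h (Q b))"
      using linear_sum[OF functional[OF h], of "\<lambda>b. (e \<bullet> b) *\<^sub>R b" Basis] linear_cmul[OF functional[OF h]] by simp
    finally show ?thesis by (simp add: inner_sum_left inner_commute[of e] mult.commute)
  qed
  define T where "T e = (\<Sum>b\<in>Basis. L2_inner S (Q b) (Q e) *\<^sub>R b)" for e
  have comm: "L2_inner S h k = L2_inner S k h" for h k :: "'a \<Rightarrow> real"
    by (simp add: L2_inner_def mult.commute)
  have T_eq: "T e = (\<Sum>b\<in>Basis. L2_inner S (Q e) (Q b) *\<^sub>R b)" for e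
    unfolding T_def by (intro sum.cong refl) (metis comm)
  have "linear T"
  proof (rule linearI)
    fix e e' :: 'e and k :: real
    show "T (e + e') = T e + T e'"
      unfolding T_def by (simp only: linear_add[OF functional[OF L2]] scaleR_add_left sum.distrib)
    show "T (k *\<^sub>R e) = k *\<^sub>R T e"
      unfolding T_def by (simp only: linear_cmul[OF functional[OF L2]] scaleR_sum_right scaleR_scaleR real_scaleR_def)
  qed
  moreover have "inj T"
  proof (subst linear_injective_0[OF \<open>linear T\<close>], intro allI impI)
    fix e assume "T e = 0"
    then have "L2_inner S (Q e) (Q e) = 0" using rep[OF L2, of e e] by (simp add: T_eq)
    then show "e = 0" by (rule def)
  qed
  ultimately have "surj T" using linear_injective_imp_surjective[of T] by simp
  then obtain e where e: "T e = (\<Sum>b\<in>Basis. L2_inner S g (Q b) *\<^sub>R b)" by (metis surjD)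
  have "L2_inner S (\<lambda>x. g x - Q e x) (Q e') = 0" for e'
    using L2_inner_diff_left[OF g L2 L2, of e e'] rep[OF g, of e'] rep[OF L2, of e e'] e by (simp add: T_eq)
  then show thesis by (rule that)
qed

lemma affine_L2:
  assumes "bounded S" "S \<in> lmeasurable"
  shows "(\<lambda>x::'a::euclidean_space. A + g \<bullet> x) \<in> L2 S"
proof -
  obtain B where B: "\<And>x. x \<in> S \<Longrightarrow> norm x \<le> B" using assms(1) bounded_iff by blast
  have "\<bar>A + g \<bullet> x\<bar> \<le> \<bar>A\<bar> + norm g * B" if "x \<in> S" for x
  proof -
    have "\<bar>g \<bullet> x\<bar> \<le> norm g * norm x" by (rule Cauchy_Schwarz_ineq2)
    also have "\<dots> \<le> norm g * B" using B[OF that] by (intro mult_left_mono) auto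
    finally show ?thesis by linarith
  qed
  moreover have "(\<lambda>x. A + g \<bullet> x) \<in> borel_measurable (lebesgue_on S)"
    by (intro borel_imp_lebesgue_on borel_measurable_continuous_onI continuous_intros)
  ultimately show ?thesis using assms(2) by (intro L2_bounded) auto
qed

text \<open>\<open>L2_proj\<close> is a definite description, so existence and uniqueness must be
  settled first. Existence uses the coefficient spaces \<open>real\<close> and
  \<open>real \<times> 'a\<close> for the two degrees; for uniqueness, the difference of two
  candidates is a polynomial orthogonal to itself.\<close>

lemma L2_proj_affine:
  fixes g :: "'a::euclidean_space \<Rightarrow> real"
  assumes S: "bounded S" "S \<in> lmeasurable" "cball c \<rho> \<subseteq> S" "\<rho> > 0" and g: "g \<in> L2 S" and l: "l = 0 \<or> l = 1"
  obtains A k where "\<And>x. L2_proj S l g x = A + k \<bullet> x"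
proof -
  have def: "A = 0 \<and> k = 0" if "L2_inner S (\<lambda>x. A + k \<bullet> x) (\<lambda>x. A + k \<bullet> x) = 0" for A k
    by (rule affine_L2_definite[OF S(2,3,4) affine_L2[OF S(1,2)] that])
  have ex: "\<exists>q. q \<in> Poly01 l \<and> (\<forall>r\<in>Poly01 l. L2_inner S (\<lambda>x. g x - q x) r = 0)"
  proof (cases "l = 0")
    case True
    obtain e :: real where e: "\<And>e'. L2_inner S (\<lambda>x. g x - e) (\<lambda>x. e') = 0"
    proof (rule L2_projection_exists[of "\<lambda>e x. e :: real" S g])
      show "linear (\<lambda>e::real. e)" by (rule linearI) auto
      show "(\<lambda>x. e) \<in> L2 S" for e :: real using affine_L2[OF S(1,2), of e 0] by simp
      show "e = 0" if "L2_inner S (\<lambda>x. e) (\<lambda>x. e) = 0" for e :: real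
        using def[of e 0] that by simp
    qed (use g in auto)
    then show ?thesis using True by (intro exI[of _ "\<lambda>x. e"]) (auto simp: Poly01_def)
  next
    case False
    obtain e :: "real \<times> 'a" where e: "\<And>e'. L2_inner S (\<lambda>x. g x - (fst e + snd e \<bullet> x)) (\<lambda>x. fst e' + snd e' \<bullet> x) = 0"
    proof (rule L2_projection_exists[of "\<lambda>(e::real \<times> 'a) x. fst e + snd e \<bullet> x" S g])
      show "linear (\<lambda>e::real \<times> 'a. fst e + snd e \<bullet> x)" for x
        by (rule linearI) (auto simp: inner_add_left algebra_simps)
      show "(\<lambda>x. fst e + snd e \<bullet> x) \<in> L2 S" for e :: "real \<times> 'a" by (rule affine_L2[OF S(1,2)])
      show "e = 0" if "L2_inner S (\<lambda>x. fst e + snd e \<bullet> x) (\<lambda>x. fst e + snd e \<bullet> x) = 0" for e :: "real \<times> 'a"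
        using def[OF that] by (simp add: prod_eq_iff)
    qed (use g in auto)
    have "L2_inner S (\<lambda>x. g x - (fst e + snd e \<bullet> x)) r = 0" if "r \<in> Poly01 l" for r
    proof -
      obtain c' k' where r: "r = (\<lambda>x. c' + k' \<bullet> x)" using \<open>r \<in> Poly01 l\<close> by (auto simp: Poly01_def)
      show ?thesis unfolding r using e[of "(c', k')"] by simp
    qed
    then show ?thesis using False by (intro exI[of _ "\<lambda>x. fst e + snd e \<bullet> x"]) (auto simp: Poly01_def)
  qed
  have uniq: "q = q'" if q: "q \<in> Poly01 l \<and> (\<forall>r\<in>Poly01 l. L2_inner S (\<lambda>x. g x - q x) r = 0)"
    "q' \<in> Poly01 l \<and> (\<forall>r\<in>Poly01 l. L2_inner S (\<lambda>x. g x - q' x) r = 0)" for q q'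
  proof -
    obtain A k where qe: "q = (\<lambda>x. A + k \<bullet> x)" "l = 0 \<longrightarrow> k = 0" using q(1) by (auto simp: Poly01_def)
    obtain A' k' where qe': "q' = (\<lambda>x. A' + k' \<bullet> x)" "l = 0 \<longrightarrow> k' = 0" using q(2) by (auto simp: Poly01_def)
    define r where "r x = (A - A') + (k - k') \<bullet> x" for x
    have r: "r \<in> Poly01 l" using qe(2) qe'(2) unfolding Poly01_def r_def[abs_def]
      by (intro CollectI exI[of _ "A - A'"] exI[of _ "k - k'"]) auto
    have rL: "r \<in> L2 S" unfolding r_def[abs_def] by (rule affine_L2[OF S(1,2)])
    have qL: "q \<in> L2 S" "q' \<in> L2 S" unfolding qe(1) qe'(1) by (rule affine_L2[OF S(1,2)])+
    have "L2_inner S (\<lambda>x. (g x - q' x) - (g x - q x)) r = 0"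
      using q r by (subst L2_inner_diff_left) (auto intro!: L2_diff g qL rL)
    moreover have "(\<lambda>x. (g x - q' x) - (g x - q x)) = r"
      by (auto simp: qe qe' r_def inner_diff_left)
    ultimately have "A - A' = 0 \<and> k - k' = 0" using def[of "A - A'" "k - k'"] by (simp add: r_def[abs_def])
    then show ?thesis by (simp add: qe qe')
  qed
  have "L2_proj S l g \<in> Poly01 l"
    unfolding L2_proj_def using theI'[of "\<lambda>q. q \<in> Poly01 l \<and> (\<forall>r\<in>Poly01 l. L2_inner S (\<lambda>x. g x - q x) r = 0)"] ex uniq by blast
  then obtain A k where "L2_proj S l g = (\<lambda>x. A + k \<bullet> x)" unfolding Poly01_def by blast
  then show thesis using that by simp
qed

section \<open>Sums over elements and the size of a side\<close>

context fe_mesh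
begin

lemma element_L2:
  fixes f :: "'a \<Rightarrow> 'b::euclidean_space"
  assumes "f \<in> L2 \<Omega>" "K \<in> \<T>"
  shows "f \<in> L2 (interior K)" "f \<in> L2 K" "L2_norm K f = L2_norm (interior K) f"
proof -
  show 1: "f \<in> L2 (interior K)"
    by (rule L2_subset[OF assms(1) interior_element_subset[OF assms(2)]]) (use open_\<Omega> in auto)
  have "negligible (K - interior K)"
    using negligible_convex_frontier[OF element_props(2)[OF assms(2)]] element_props(5)[OF assms(2)]
    by (simp add: frontier_def)
  then show "f \<in> L2 K" "L2_norm K f = L2_norm (interior K) f"
    using L2_extend_null[OF 1 interior_subset _ element_props(8)[OF assms(2)]] by auto
qed

lemma sum_elements_le:
  fixes f :: "'a \<Rightarrow> 'b::euclidean_space"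
  assumes "f \<in> L2 \<Omega>"
  shows "(\<Sum>K\<in>\<T>. (L2_norm (interior K) f)\<^sup>2) \<le> (L2_norm \<Omega> f)\<^sup>2"
proof -
  have int: "integrable lebesgue (\<lambda>x. indicat_real (interior K) x *\<^sub>R (norm (f x))\<^sup>2)" if "K \<in> \<T>" for K
    using L2_D(2)[OF element_L2(1)[OF assms that]] by (simp add: integrable_restrict_space)
  have "(\<Sum>K\<in>\<T>. (L2_norm (interior K) f)\<^sup>2) = (\<Sum>K\<in>\<T>. LINT x|lebesgue. indicat_real (interior K) x *\<^sub>R (norm (f x))\<^sup>2)"
    by (simp add: L2_norm_sq integral_restrict_space)
  also have "\<dots> = (LINT x|lebesgue. (\<Sum>K\<in>\<T>. indicat_real (interior K) x *\<^sub>R (norm (f x))\<^sup>2))"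
    by (rule Bochner_Integration.integral_sum[symmetric]) (rule int)
  also have "\<dots> \<le> (LINT x|lebesgue. indicat_real \<Omega> x *\<^sub>R (norm (f x))\<^sup>2)"
  proof (rule integral_mono)
    show "integrable lebesgue (\<lambda>x. \<Sum>K\<in>\<T>. indicat_real (interior K) x *\<^sub>R (norm (f x))\<^sup>2)"
      by (rule Bochner_Integration.integrable_sum) (rule int)
    show "integrable lebesgue (\<lambda>x. indicat_real \<Omega> x *\<^sub>R (norm (f x))\<^sup>2)"
      using L2_D(2)[OF assms] \<Omega>_lmeasurable by (simp add: integrable_restrict_space fmeasurableD)
    fix x
    show "(\<Sum>K\<in>\<T>. indicat_real (interior K) x *\<^sub>R (norm (f x))\<^sup>2) \<le> indicat_real \<Omega> x *\<^sub>R (norm (f x))\<^sup>2"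
    proof (cases "\<exists>K\<in>\<T>. x \<in> interior K")
      case True
      then obtain K where K: "K \<in> \<T>" "x \<in> interior K" by blast
      have "x \<notin> interior K'" if "K' \<in> \<T> - {K}" for K'
        using interiors_disjoint[of K K'] that K by blast
      then have "(\<Sum>K'\<in>\<T> - {K}. indicat_real (interior K') x *\<^sub>R (norm (f x))\<^sup>2) = 0"
        by (intro sum.neutral) auto
      then have "(\<Sum>K\<in>\<T>. indicat_real (interior K) x *\<^sub>R (norm (f x))\<^sup>2) = (norm (f x))\<^sup>2"
        using K finite_\<T> by (subst sum.remove[of _ K]) auto
      moreover have "x \<in> \<Omega>" using K interior_element_subset by blast
      ultimately show ?thesis by simp
    next
      case False
      then have "(\<Sum>K\<in>\<T>. indicat_real (interior K) x *\<^sub>R (norm (f x))\<^sup>2) = 0"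
        by (intro sum.neutral) auto
      then show ?thesis by simp
    qed
  qed
  also have "\<dots> = (L2_norm \<Omega> f)\<^sup>2"
    using \<Omega>_lmeasurable by (simp add: L2_norm_sq integral_restrict_space fmeasurableD)
  finally show ?thesis .
qed

lemma diameter_pos: "K \<in> \<T> \<Longrightarrow> diameter K > 0"
proof -
  assume K: "K \<in> \<T>"
  obtain c r where c: "r > 0" "cball c r \<subseteq> K" using shape[OF K] by blast
  obtain e :: 'a where e: "e \<in> Basis" using nonempty_Basis by blast
  have "c \<in> K" "c + r *\<^sub>R e \<in> K" using c e by (auto simp: subset_iff dist_norm)
  then have "dist c (c + r *\<^sub>R e) \<le> diameter K" using diameter_bounded_bound[OF element_props(6)[OF K]] by blast
  then show ?thesis using c e by (simp add: dist_norm)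
qed

lemma diameter_le: "K \<in> \<T> \<Longrightarrow> diameter K \<le> diameter (closure \<Omega>)"
  using element_props(3) bounded_\<Omega> by (intro diameter_subset) auto

text \<open>The prism of height one in \<^const>\<open>side_area\<close> has about \<open>1 / h\<close> slabs of height \<open>h\<close>, each inside a ball of radius \<open>2 h\<close>.\<close>

lemma side_area_bound:
  assumes K: "K \<in> \<T>" and \<gamma>: "\<gamma> \<subseteq> K" "closed \<gamma>" and n: "norm (outward_normal K \<gamma>) = 1"
  shows "diameter K * side_area K \<gamma>
    \<le> (1 + diameter (closure \<Omega>)) * 2 ^ DIM('a) * unit_vol TYPE('a) * diameter K ^ DIM('a)"
proof (cases "\<gamma> = {}")
  case True
  then show ?thesis
    using diameter_pos[OF K] diameter_ge_0[OF bounded_closure[OF bounded_\<Omega>]] unit_vol_pos[where 'a='a]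
    by (simp add: side_area_def)
next
  case False
  then obtain p where p: "p \<in> \<gamma>" by blast
  define h where "h = diameter K"
  define \<nu> where "\<nu> = outward_normal K \<gamma>"
  define P where "P = {x + t *\<^sub>R \<nu> | x t. x \<in> \<gamma> \<and> 0 \<le> t \<and> t \<le> 1}"
  \<comment> \<open>Index of the last slab: \<open>t \<le> 1\<close> keeps the index
    \<open>i\<close> of a point at most \<open>n\<close>, so \<open>n + 1\<close> balls
    suffice.\<close>
  define n :: nat where "n = nat \<lfloor>1/h\<rfloor>"
  define \<omega> where "\<omega> = unit_vol TYPE('a)"
  have \<omega>: "\<omega> \<ge> 0" using unit_vol_pos[where 'a='a] by (simp add: \<omega>_def)
  have h: "h > 0" using diameter_pos[OF K] by (simp add: h_def)
  have \<nu>: "norm \<nu> = 1" using n by (simp add: \<nu>_def)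
  have "compact \<gamma>"
    using \<gamma> element_props(1)[OF K] by (metis compact_Int_closed inf.absorb_iff2)
  then have "compact ((\<lambda>(x, t). x + t *\<^sub>R \<nu>) ` (\<gamma> \<times> {0..1}))"
    by (intro compact_continuous_image compact_Times) (auto intro!: continuous_intros simp: split_beta)
  moreover have "(\<lambda>(x, t). x + t *\<^sub>R \<nu>) ` (\<gamma> \<times> {0..1}) = P"
    by (force simp: P_def image_iff)
  ultimately have Pc: "compact P" by simp
  have sub: "P \<subseteq> (\<Union>i\<in>{..n}. cball (p + (real i * h) *\<^sub>R \<nu>) (2 * h))"
  proof
    fix y assume "y \<in> P"
    then obtain x t where y: "y = x + t *\<^sub>R \<nu>" "x \<in> \<gamma>" "0 \<le> t" "t \<le> 1" by (auto simp: P_def)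
    have xp: "norm (x - p) \<le> h"
      using diameter_bounded_bound[OF element_props(6)[OF K], of x p] y(2) p \<gamma>(1) by (auto simp: dist_norm h_def)
    define i where "i = nat \<lfloor>t / h\<rfloor>"
    have ti: "real i \<le> t / h" "t / h < real i + 1" using y(3) h unfolding i_def by (auto simp: of_nat_nat)
    have it: "real i * h \<le> t" "t \<le> real i * h + h" using ti h by (auto simp: field_simps)
    show "y \<in> (\<Union>i\<in>{..n}. cball (p + (real i * h) *\<^sub>R \<nu>) (2 * h))"
    proof -
      have eq: "y - (p + (real i * h) *\<^sub>R \<nu>) = (x - p) + (t - real i * h) *\<^sub>R \<nu>" by (simp add: y algebra_simps)
      have "norm (y - (p + (real i * h) *\<^sub>R \<nu>)) \<le> norm (x - p) + \<bar>t - real i * h\<bar>"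
        unfolding eq using norm_triangle_ineq[of "x - p" "(t - real i * h) *\<^sub>R \<nu>"] \<nu> by simp
      also have "\<dots> \<le> 2 * h" using xp it by simp
      finally have "y \<in> cball (p + (real i * h) *\<^sub>R \<nu>) (2 * h)" by (simp add: dist_norm norm_minus_commute)
      moreover have "i \<le> n" unfolding i_def n_def using y(4) h by (intro nat_mono floor_mono divide_right_mono) auto
      ultimately show ?thesis by blast
    qed
  qed
  have n1: "real n \<le> 1/h" using h unfolding n_def by simp
  have "measure lebesgue P \<le> measure lebesgue (\<Union>i\<in>{..n}. cball (p + (real i * h) *\<^sub>R \<nu>) (2 * h))"
    using sub Pc by (intro measure_mono_fmeasurable lmeasurable_compact compact_UN fmeasurableD) auto
  also have "\<dots> \<le> (\<Sum>i\<in>{..n}. measure lebesgue (cball (p + (real i * h) *\<^sub>R \<nu>) (2 * h)))"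
    by (rule measure_UNION_le) auto
  also have "\<dots> = (real n + 1) * (\<omega> * (2 * h) ^ DIM('a))"
  proof -
    have "measure lebesgue (cball (p + (real i * h) *\<^sub>R \<nu>) (2 * h)) = \<omega> * (2 * h) ^ DIM('a)" for i
      unfolding \<omega>_def using h by (intro measure_ball_unit_vol) auto
    then show ?thesis by (simp only:) (simp add: add.commute)
  qed
  also have "\<dots> \<le> (1/h + 1) * (\<omega> * (2 * h) ^ DIM('a))"
    using n1 h \<omega> by (intro mult_right_mono) auto
  finally have "h * measure lebesgue P \<le> h * ((1/h + 1) * (\<omega> * (2 * h) ^ DIM('a)))"
    using h by (intro mult_left_mono) auto
  \<comment> \<open>The weight \<open>h\<close> cancels the number of slabs, at most
    \<open>1/h + 1\<close>, up to \<open>1 + h\<close>. This is the origin of the factor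
    \<open>1 + diameter (closure \<Omega>)\<close>.\<close>
  also have "\<dots> = (1 + h) * (\<omega> * (2 * h) ^ DIM('a))" using h by (simp add: field_simps)
  also have "\<dots> \<le> (1 + diameter (closure \<Omega>)) * (\<omega> * (2 * h) ^ DIM('a))"
    using diameter_le[OF K] h \<omega> by (intro mult_right_mono) (auto simp: h_def)
  finally show ?thesis
    by (simp add: side_area_def P_def \<nu>_def h_def \<omega>_def power_mult_distrib mult_ac)
qed

end

section \<open>Efficiency of the residual indicators\<close>

lemma L2_inner_ball_bound:
  fixes F h :: "'a::euclidean_space \<Rightarrow> 'b::euclidean_space"
  assumes F: "F \<in> L2 S" and S: "ball c \<rho> \<subseteq> S" "S \<in> sets lebesgue" "\<rho> \<ge> 0"
    and h: "h \<in> borel_measurable borel" "\<And>x. x \<notin> ball c \<rho> \<Longrightarrow> h x = 0" "\<And>x. norm (h x) \<le> M"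
  shows "(L2_inner S F h)\<^sup>2 \<le> M\<^sup>2 * (unit_vol TYPE('a) * \<rho> ^ DIM('a)) * (L2_norm (ball c \<rho>) F)\<^sup>2"
proof -
  let ?B = "ball c \<rho>"
  have eq: "L2_inner S F h = L2_inner ?B F h" by (rule L2_inner_restrict) (use S h in auto)
  have FB: "F \<in> L2 ?B" by (rule L2_subset[OF F S(1)]) (use S in auto)
  note hB = L2_bounded[OF borel_imp_lebesgue_on[OF h(1)] lmeasurable_ball h(3)]
  have "(L2_inner S F h)\<^sup>2 \<le> (L2_norm ?B F * L2_norm ?B h)\<^sup>2"
    unfolding eq using L2_Cauchy_Schwarz[OF FB hB(1)] by (intro power2_le_iff_abs_le[THEN iffD2]) (auto simp: L2_norm_nonneg)
  also have "\<dots> = (L2_norm ?B h)\<^sup>2 * (L2_norm ?B F)\<^sup>2" by (simp add: power_mult_distrib)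
  also have "\<dots> \<le> (M\<^sup>2 * measure lebesgue ?B) * (L2_norm ?B F)\<^sup>2"
    by (intro mult_right_mono hB(2)) auto
  finally show ?thesis unfolding measure_ball_unit_vol(1)[OF S(3)] .
qed

lemma integral_ge_on_subset:
  fixes f :: "'a::euclidean_space \<Rightarrow> real"
  assumes "integrable (lebesgue_on S) f" "S \<in> lmeasurable" "B \<subseteq> S" "B \<in> sets lebesgue"
    and "\<And>x. x \<in> S \<Longrightarrow> 0 \<le> f x" "\<And>x. x \<in> B \<Longrightarrow> m \<le> f x"
  shows "m * measure lebesgue B \<le> (LINT x|lebesgue_on S. f x)"
proof -
  have Bf: "B \<in> fmeasurable lebesgue" using assms fmeasurableI2 by blast
  have "m * measure lebesgue B = (LINT x|lebesgue. m * indicat_real B x)" using Bf by simp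
  also have "\<dots> \<le> (LINT x|lebesgue. indicat_real S x *\<^sub>R f x)"
  proof (rule integral_mono)
    show "integrable lebesgue (\<lambda>x. m * indicat_real B x)"
      by (intro integrable_mult_right integrable_real_indicator fmeasurableD[OF Bf])
         (use Bf in \<open>simp only: fmeasurable_def mem_Collect_eq infinity_ennreal_def\<close>)
    show "integrable lebesgue (\<lambda>x. indicat_real S x *\<^sub>R f x)"
      using assms(1,2) by (simp add: integrable_restrict_space fmeasurableD)
    show "m * indicat_real B x \<le> indicat_real S x *\<^sub>R f x" for x
      using assms(3,5,6) by (auto simp: indicator_def)
  qed
  also have "\<dots> = (LINT x|lebesgue_on S. f x)" using assms(2) by (simp add: integral_restrict_space fmeasurableD)
  finally show ?thesis .
qed

lemma L2_norm_cover:
  fixes F :: "'a::euclidean_space \<Rightarrow> 'b::euclidean_space"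
  assumes F: "F \<in> L2 S" and S: "S \<in> sets lebesgue" and A: "A1 \<subseteq> S" "A2 \<subseteq> S" "B \<subseteq> S" "A1 \<in> sets lebesgue" "A2 \<in> sets lebesgue" "B \<in> sets lebesgue"
    and N: "B \<subseteq> A1 \<union> A2 \<union> N" "negligible N"
  shows "(L2_norm B F)\<^sup>2 \<le> (L2_norm A1 F)\<^sup>2 + (L2_norm A2 F)\<^sup>2"
proof -
  have int: "integrable lebesgue (\<lambda>x. indicat_real A x *\<^sub>R (norm (F x))\<^sup>2)" if "A \<subseteq> S" "A \<in> sets lebesgue" for A
    using L2_D(2)[OF L2_subset[OF F that S]] that by (simp add: integrable_restrict_space)
  have eq: "(L2_norm A F)\<^sup>2 = (LINT x|lebesgue. indicat_real A x *\<^sub>R (norm (F x))\<^sup>2)" if "A \<in> sets lebesgue" for A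
    using that by (simp add: L2_norm_sq integral_restrict_space)
  have "AE x in lebesgue. x \<notin> N" using N(2) by (intro AE_not_in) (simp add: negligible_iff_null_sets)
  then have AE: "AE x in lebesgue. indicat_real B x *\<^sub>R (norm (F x))\<^sup>2
      \<le> indicat_real A1 x *\<^sub>R (norm (F x))\<^sup>2 + indicat_real A2 x *\<^sub>R (norm (F x))\<^sup>2"
    by eventually_elim (use N(1) in \<open>auto simp: indicator_def\<close>)
  have "(LINT x|lebesgue. indicat_real B x *\<^sub>R (norm (F x))\<^sup>2)
     \<le> (LINT x|lebesgue. indicat_real A1 x *\<^sub>R (norm (F x))\<^sup>2 + indicat_real A2 x *\<^sub>R (norm (F x))\<^sup>2)"
    using AE A int by (intro integral_mono_AE Bochner_Integration.integrable_add) auto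
  also have "\<dots> = (LINT x|lebesgue. indicat_real A1 x *\<^sub>R (norm (F x))\<^sup>2) + (LINT x|lebesgue. indicat_real A2 x *\<^sub>R (norm (F x))\<^sup>2)"
    using A int by (intro Bochner_Integration.integral_add) auto
  finally show ?thesis using eq A by simp
qed

lemma lipb_const: "lipb (\<lambda>x::'a::euclidean_space. c)"
proof -
  have "\<forall>x y::'a. \<bar>c - c\<bar> \<le> 0 * norm (x - y)" by simp
  then show ?thesis unfolding lipb_def by blast
qed

text \<open>The constant function 1 has weak gradient 0. In the bubble estimates this does the work
  of elementwise integration by parts.\<close>

lemma integral_test_grad:
  assumes "open \<Omega>" "bounded \<Omega>" "\<phi> \<in> test_functions \<Omega>"
  shows "L2_inner \<Omega> (\<lambda>x. v) (classical_grad \<phi>) = 0"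
proof -
  have d: "AE x in lebesgue. ((\<lambda>x::'a. 1::real) has_derivative (\<lambda>h. 0 \<bullet> h)) (at x)" by simp
  note * = lipb_has_weak_grad[OF assms(1,2) lipb_const d, where B=0]
  have "has_weak_grad \<Omega> (\<lambda>x. 1) (\<lambda>x. 0)" by (rule *(3)) auto
  then have 0: "(LINT x|lebesgue_on \<Omega>. classical_grad \<phi> x) = 0"
    using assms(3) by (simp add: has_weak_grad_def)
  have "integrable (lebesgue_on \<Omega>) (classical_grad \<phi>)"
    using open_bounded_lmeasurable[OF assms(1,2)] by (intro L2_imp_integrable test_function_L2(2)[OF assms(3)])
  then have "(LINT x|lebesgue_on \<Omega>. v \<bullet> classical_grad \<phi> x) = v \<bullet> (LINT x|lebesgue_on \<Omega>. classical_grad \<phi> x)"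
    by (intro integral_inner_right) auto
  then show ?thesis using 0 by (simp add: L2_inner_def)
qed

lemma sum3_power2_le: "(a + b + c)\<^sup>2 \<le> 3 * (a\<^sup>2 + b\<^sup>2 + (c::real)\<^sup>2)"
proof -
  have "0 \<le> (a - b)\<^sup>2 + (b - c)\<^sup>2 + (a - c)\<^sup>2" by simp
  then show ?thesis by (simp add: power2_eq_square algebra_simps)
qed

text \<open>Coefficient of \<open>M\<^sup>2 * \<rho> ^ DIM('a)\<close> in the lower bound for the
  bump-weighted integral of a squared affine function: on a ball of radius \<open>\<rho> / 4\<close>
  the bump is at least \<open>bump_level\<close> and the function at least \<open>M / 4\<close> in
  modulus.\<close>

definition int_rate :: "'a::euclidean_space itself \<Rightarrow> real" where
  "int_rate T = bump_level * unit_vol T / (16 * 4 ^ DIM('a))"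

text \<open>The leading 2 comes from squaring a sum of two norms,
  \<open>200 * \<sigma>\<^sup>2\<close> is \<open>2 * 25 * (2 * \<sigma>)\<^sup>2\<close> with
  \<open>h \<le> 2 * \<sigma> * \<rho>\<close>, and the power of \<open>2 * \<sigma>\<close> passes
  from the inner ball to the element.\<close>

definition interior_const :: "'a::euclidean_space itself \<Rightarrow> real \<Rightarrow> real" where
  "interior_const T \<sigma> = 2 + 200 * \<sigma>\<^sup>2 * ((2 * \<sigma>) ^ (DIM('a) + 2) * unit_vol T * (3 * unit_vol T / (int_rate T)\<^sup>2))"

text \<open>Here the integrand is the normal derivative of the bump, at least
  \<open>bump_level / (2 * \<rho>)\<close> on a ball of radius \<open>\<rho> / 4\<close> inside one
  half ball.\<close>

definition side_rate :: "'a::euclidean_space itself \<Rightarrow> real" where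
  "side_rate T = bump_level * unit_vol T / (2 * 4 ^ DIM('a))"

text \<open>The factors before 48 bound \<open>h\<close> times the area of a side by a multiple of
  \<open>\<rho> ^ DIM('a)\<close>, using
  \<open>h \<le> 4 * \<sigma> * (1 + \<sigma>) * \<rho>\<close>; \<open>48 = 3 * 16\<close> combines
  the square of a three-term sum with the squared gradient bound \<open>4 / \<rho>\<close> of the
  bump.\<close>

definition side_const :: "'a::euclidean_space itself \<Rightarrow> real \<Rightarrow> real \<Rightarrow> real" where
  "side_const T \<sigma> D = (1 + D) * 2 ^ DIM('a) * unit_vol T * (4 * \<sigma> * (1 + \<sigma>)) ^ DIM('a) * (48 * unit_vol T / (side_rate T)\<^sup>2)"

lemma rates_pos: "int_rate TYPE('a::euclidean_space) > 0" "side_rate TYPE('a) > 0"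
  using bump_level_pos unit_vol_pos[where 'a='a] by (auto simp: int_rate_def side_rate_def)

lemma interior_const_pos: "interior_const TYPE('a::euclidean_space) \<sigma> \<ge> 2" if "\<sigma> \<ge> 1"
  using that unit_vol_pos[where 'a='a] rates_pos(1)[where 'a='a] unfolding interior_const_def by (simp add: less_imp_le)

lemma side_const_nonneg: "side_const TYPE('a::euclidean_space) \<sigma> D \<ge> 0" if "\<sigma> \<ge> 1" "D \<ge> 0"
  using that unit_vol_pos[where 'a='a] unfolding side_const_def
  by (intro mult_nonneg_nonneg zero_le_power divide_nonneg_nonneg zero_le_power2) (auto simp: less_imp_le)

text \<open>The residual equation shared by the state equation (\<open>s\<close> the control error) and the adjoint equation
  (\<open>s\<close> the state error); \<open>G\<close> is the gradient of the error of \<open>z\<close>.\<close>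

locale fe_residual = fe_mesh +
  fixes z s r :: "'a \<Rightarrow> real" and G :: "'a \<Rightarrow> 'a"
  assumes z: "z \<in> fe_space \<Omega> \<T>" and s_L2: "s \<in> L2 \<Omega>" and r_L2: "r \<in> L2 \<Omega>" and G_L2: "G \<in> L2 \<Omega>"
    and residual: "\<And>\<phi>. \<phi> \<in> test_functions \<Omega> \<Longrightarrow>
      L2_inner \<Omega> G (classical_grad \<phi>) = L2_inner \<Omega> (\<lambda>x. s x + r x) \<phi> - L2_inner \<Omega> (pw_grad z) (classical_grad \<phi>)"
begin

lemma \<Omega>_sets: "\<Omega> \<in> sets lebesgue" using \<Omega>_lmeasurable by blast

lemma residual_split:
  assumes "\<phi> \<in> test_functions \<Omega>"
  shows "L2_inner \<Omega> G (classical_grad \<phi>) + L2_inner \<Omega> (pw_grad z) (classical_grad \<phi>) = L2_inner \<Omega> s \<phi> + L2_inner \<Omega> r \<phi>"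
  using residual[OF assms] L2_inner_add_left[OF s_L2 r_L2 test_function_L2(1)[OF assms \<Omega>_lmeasurable]] by simp

lemma pw_grad_pairing_interior:
  assumes K: "K \<in> \<T>" and \<phi>: "\<phi> \<in> test_functions \<Omega>" "\<And>x. x \<notin> interior K \<Longrightarrow> classical_grad \<phi> x = 0"
  shows "L2_inner \<Omega> (pw_grad z) (classical_grad \<phi>) = 0"
proof -
  have "L2_inner \<Omega> (pw_grad z) (classical_grad \<phi>) = L2_inner \<Omega> (\<lambda>x. elem_grad K z) (classical_grad \<phi>)"
    unfolding L2_inner_def
  proof (rule Bochner_Integration.integral_cong)
    fix x
    show "pw_grad z x \<bullet> classical_grad \<phi> x = elem_grad K z \<bullet> classical_grad \<phi> x"
      using pw_grad_interior[OF K, of x z] \<phi>(2)[of x] by (cases "x \<in> interior K") auto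
  qed simp
  also have "\<dots> = 0" by (rule integral_test_grad[OF open_\<Omega> bounded_\<Omega> \<phi>(1)])
  finally show ?thesis .
qed

text \<open>Test the residual equation with the product of a bump in \<open>K\<close> and the affine function itself.\<close>

lemma interior_bubble:
  fixes A :: real and k :: 'a
  assumes K: "K \<in> \<T>" and p: "cball p \<rho> \<subseteq> interior K" "\<rho> > 0"
  defines "M \<equiv> \<bar>A + k \<bullet> p\<bar> + norm k * \<rho>"
  shows "(int_rate TYPE('a))\<^sup>2 * (M\<^sup>2 * \<rho> ^ DIM('a)) \<le> 3 * unit_vol TYPE('a) *
    ((L2_norm (interior K) (\<lambda>x. r x - (A + k \<bullet> x)))\<^sup>2 + (L2_norm (interior K) s)\<^sup>2 + 25 / \<rho>\<^sup>2 * (L2_norm (interior K) G)\<^sup>2)"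
proof -
  define q where "q x = A + k \<bullet> x" for x
  define \<phi> where "\<phi> x = bump p \<rho> x * q x" for x
  let ?B = "ball p \<rho>"
  have M0: "M \<ge> 0" using p(2) by (simp add: M_def)
  have smq: "smooth q"
  proof -
    have "smooth (\<lambda>x. A + x \<bullet> k)" by (intro smooth_intros)
    then show ?thesis by (simp add: q_def[abs_def] inner_commute)
  qed
  have sm: "smooth \<phi>" unfolding \<phi>_def[abs_def] by (intro smooth_intros smooth_bump smq)
  have KO: "interior K \<subseteq> \<Omega>" by (rule interior_element_subset[OF K])
  have BK: "?B \<subseteq> interior K" using p(1) ball_subset_cball by blast
  have B\<Omega>: "?B \<subseteq> \<Omega>" using BK KO by blast
  have out: "\<phi> x = 0" if "x \<notin> ?B" for x using bump_outside[OF p(2) that] by (simp add: \<phi>_def)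
  have test: "\<phi> \<in> test_functions \<Omega>"
  proof (rule test_functionsI[OF sm compact_cball])
    show "cball p \<rho> \<subseteq> \<Omega>" using p(1) KO by blast
    show "\<phi> x = 0" if "x \<notin> cball p \<rho>" for x using that by (intro out) auto
  qed
  have grad: "classical_grad \<phi> x = bump p \<rho> x *\<^sub>R k + q x *\<^sub>R classical_grad (bump p \<rho>) x" for x
    unfolding \<phi>_def[abs_def] using classical_grad_mult[OF smooth_bump smq, of p \<rho> x] classical_grad_affine[of A k]
    by (simp add: q_def[abs_def])
  have gout: "classical_grad \<phi> x = 0" if "x \<notin> ?B" for x
    using bump_grad_outside[OF p(2) that] bump_outside[OF p(2) that] by (simp add: grad)
  have qB: "\<bar>q x\<bar> \<le> M" if "x \<in> ?B" for x
  proof -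
    have "q x = (A + k \<bullet> p) + k \<bullet> (x - p)" by (simp add: q_def inner_diff_right)
    moreover have "\<bar>k \<bullet> (x - p)\<bar> \<le> norm k * \<rho>"
      using that by (intro order_trans[OF Cauchy_Schwarz_ineq2] mult_left_mono) (auto simp: dist_norm norm_minus_commute)
    ultimately show ?thesis by (simp add: M_def)
  qed
  have \<phi>M: "norm (\<phi> x) \<le> M" for x
  proof (cases "x \<in> ?B")
    case True
    have "bump p \<rho> x * \<bar>q x\<bar> \<le> 1 * M" using qB[OF True] bump_range by (intro mult_mono) auto
    then show ?thesis using bump_range(1)[of p \<rho> x] by (simp add: \<phi>_def abs_mult)
  qed (use out M0 in simp)
  \<comment> \<open>By the product rule, \<open>norm k \<le> M / \<rho>\<close> contributes one part
    and the bump gradient, at most \<open>4 / \<rho>\<close>, contributes four. The square of 5 is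
    the 25 in the claim.\<close>
  have gM: "norm (classical_grad \<phi> x) \<le> 5 * M / \<rho>" for x
  proof (cases "x \<in> ?B")
    case True
    have "norm (classical_grad \<phi> x) \<le> bump p \<rho> x * norm k + \<bar>q x\<bar> * norm (classical_grad (bump p \<rho>) x)"
      unfolding grad using bump_range(1)[of p \<rho> x] by (intro order_trans[OF norm_triangle_ineq]) simp
    also have "\<dots> \<le> 1 * norm k + M * (4 / \<rho>)"
      using qB[OF True] bump_range M0 by (intro add_mono mult_mono bump_grad_bound[OF p(2)]) auto
    also have "norm k \<le> M / \<rho>" using p(2) by (simp add: M_def field_simps)
    finally show ?thesis by simp
  qed (use gout M0 p(2) in simp)
  have gb: "classical_grad \<phi> \<in> borel_measurable borel" "\<phi> \<in> borel_measurable borel"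
    by (rule smooth_grad_borel[OF sm] smooth_borel[OF sm])+
  have q2: "q \<in> L2 \<Omega>" unfolding q_def[abs_def] by (rule affine_L2[OF bounded_\<Omega> \<Omega>_lmeasurable])
  note \<phi>2 = test_function_L2[OF test \<Omega>_lmeasurable]
  define X where "X = L2_inner \<Omega> q \<phi>"
  have low: "int_rate TYPE('a) * (M\<^sup>2 * \<rho> ^ DIM('a)) \<le> X"
  proof -
    obtain p' where p': "ball p' (\<rho>/4) \<subseteq> cball p (3/4 * \<rho>)"
      "\<And>x. x \<in> ball p' (\<rho>/4) \<Longrightarrow> (\<bar>A + k \<bullet> p\<bar> + norm k * \<rho>) / 4 \<le> \<bar>A + k \<bullet> x\<bar>"
      using affine_ball_bounds[OF p(2), of p A k] by blast
    have "bump_level * (M/4)\<^sup>2 * measure lebesgue (ball p' (\<rho>/4)) \<le> (LINT x|lebesgue_on \<Omega>. q x \<bullet> \<phi> x)"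
    proof (rule integral_ge_on_subset[OF L2_inner_integrable(2)[OF q2 \<phi>2(1)] \<Omega>_lmeasurable])
      have "cball p (3/4 * \<rho>) \<subseteq> ?B" using p(2) by auto
      then show "ball p' (\<rho>/4) \<subseteq> \<Omega>" using p'(1) B\<Omega> by blast
      show "0 \<le> q x \<bullet> \<phi> x" for x
        using mult_nonneg_nonneg[OF bump_range(1)[of p \<rho> x] zero_le_square[of "q x"]] by (simp add: \<phi>_def mult.left_commute)
      show "bump_level * (M/4)\<^sup>2 \<le> q x \<bullet> \<phi> x" if x: "x \<in> ball p' (\<rho>/4)" for x
      proof -
        have "bump_level \<le> bump p \<rho> x" using p'(1) x by (intro bump_ge_bump_level[OF p(2)]) (auto simp: dist_commute)
        moreover have "(M/4)\<^sup>2 \<le> \<bar>q x\<bar>\<^sup>2" using p'(2)[OF x] M0 by (intro power_mono) (auto simp: M_def q_def)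
        ultimately have "bump_level * (M/4)\<^sup>2 \<le> bump p \<rho> x * \<bar>q x\<bar>\<^sup>2" using bump_range by (intro mult_mono) auto
        then show ?thesis by (simp add: \<phi>_def power2_eq_square mult_ac)
      qed
    qed simp
    moreover have "measure lebesgue (ball p' (\<rho>/4)) = unit_vol TYPE('a) * (\<rho>/4) ^ DIM('a)"
      using p(2) by (intro measure_ball_unit_vol) simp
    ultimately have "bump_level * (M/4)\<^sup>2 * (unit_vol TYPE('a) * (\<rho>/4) ^ DIM('a)) \<le> X"
      by (simp only: X_def L2_inner_def)
    then show ?thesis by (simp add: int_rate_def power_divide power2_eq_square mult_ac)
  qed
  have pw0: "L2_inner \<Omega> (pw_grad z) (classical_grad \<phi>) = 0"
    using BK gout by (intro pw_grad_pairing_interior[OF K test]) blast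
  have ro: "(\<lambda>x. r x - q x) \<in> L2 \<Omega>" by (rule L2_diff[OF r_L2 q2])
  have "L2_inner \<Omega> (\<lambda>x. r x - q x) \<phi> = L2_inner \<Omega> r \<phi> - X"
    unfolding X_def by (rule L2_inner_diff_left[OF r_L2 q2 \<phi>2(1)])
  then have Xeq: "X = (- L2_inner \<Omega> (\<lambda>x. r x - q x) \<phi>) + (- L2_inner \<Omega> s \<phi>) + L2_inner \<Omega> G (classical_grad \<phi>)"
    using residual_split[OF test] pw0 by simp
  have mono: "(L2_norm ?B F)\<^sup>2 \<le> (L2_norm (interior K) F)\<^sup>2" if "F \<in> L2 \<Omega>" for F :: "'a \<Rightarrow> 'b::euclidean_space"
    using element_L2(1)[OF that K] BK by (intro power_mono L2_norm_mono_set L2_norm_nonneg) auto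
  define V where "V = unit_vol TYPE('a) * \<rho> ^ DIM('a)"
  have V0: "V \<ge> 0" using unit_vol_pos[where 'a='a] p(2) by (simp add: V_def)
  note bnd = L2_inner_ball_bound[OF _ B\<Omega> \<Omega>_sets less_imp_le[OF p(2)], folded V_def]
  have b: "(L2_inner \<Omega> F \<phi>)\<^sup>2 \<le> M\<^sup>2 * V * (L2_norm (interior K) F)\<^sup>2" if "F \<in> L2 \<Omega>" for F
    using bnd[OF that gb(2) out \<phi>M] mult_left_mono[OF mono[OF that], of "M\<^sup>2 * V"] V0 by simp
  have bG: "(L2_inner \<Omega> G (classical_grad \<phi>))\<^sup>2 \<le> (5 * M / \<rho>)\<^sup>2 * V * (L2_norm (interior K) G)\<^sup>2"
    using bnd[OF G_L2 gb(1) gout gM] mult_left_mono[OF mono[OF G_L2], of "(5 * M / \<rho>)\<^sup>2 * V"] V0 by simp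
  define W where "W = (L2_norm (interior K) (\<lambda>x. r x - q x))\<^sup>2 + (L2_norm (interior K) s)\<^sup>2 + 25 / \<rho>\<^sup>2 * (L2_norm (interior K) G)\<^sup>2"
  have "X\<^sup>2 \<le> 3 * ((L2_inner \<Omega> (\<lambda>x. r x - q x) \<phi>)\<^sup>2 + (L2_inner \<Omega> s \<phi>)\<^sup>2 + (L2_inner \<Omega> G (classical_grad \<phi>))\<^sup>2)"
    unfolding Xeq by (rule order_trans[OF sum3_power2_le]) simp
  also have "\<dots> \<le> 3 * (M\<^sup>2 * V * (L2_norm (interior K) (\<lambda>x. r x - q x))\<^sup>2 + M\<^sup>2 * V * (L2_norm (interior K) s)\<^sup>2
      + (5 * M / \<rho>)\<^sup>2 * V * (L2_norm (interior K) G)\<^sup>2)"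
    by (intro mult_left_mono add_mono b bG ro s_L2) auto
  also have "\<dots> = 3 * (M\<^sup>2 * V) * W" by (simp add: W_def power2_eq_square algebra_simps)
  finally have X2: "X\<^sup>2 \<le> 3 * (M\<^sup>2 * V) * W" .
  have W0: "W \<ge> 0" by (simp add: W_def)
  \<comment> \<open>\<open>X\<close> is at least \<open>int_rate\<close> times \<open>Y\<close>,
    while the upper bound for its square carries only one factor \<open>Y\<close>. Cancelling that
    factor leaves the claim, which is trivial for \<open>Y = 0\<close>.\<close>
  define Y where "Y = M\<^sup>2 * \<rho> ^ DIM('a)"
  have Y0: "Y \<ge> 0" using p(2) by (simp add: Y_def)
  have "(int_rate TYPE('a) * Y)\<^sup>2 \<le> X\<^sup>2"
    using low rates_pos(1)[where 'a='a] Y0 by (intro power_mono) (auto simp: Y_def)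
  also have "\<dots> \<le> Y * (3 * unit_vol TYPE('a) * W)" using X2 by (simp add: V_def Y_def mult_ac)
  finally have "Y * ((int_rate TYPE('a))\<^sup>2 * Y) \<le> Y * (3 * unit_vol TYPE('a) * W)"
    by (simp add: power2_eq_square mult_ac)
  then have "(int_rate TYPE('a))\<^sup>2 * Y \<le> 3 * unit_vol TYPE('a) * W"
    using Y0 W0 unit_vol_pos[where 'a='a] by (cases "Y = 0") (auto simp: mult_le_cancel_left)
  then show ?thesis by (simp only: Y_def W_def q_def)
qed

text \<open>The local right-hand side, scaled like a squared gradient norm. The slot
  \<open>w\<close> receives the residual minus an affine function in the interior estimate and the
  residual itself in the side estimate.\<close>

definition local_data :: "('a \<Rightarrow> real) \<Rightarrow> 'a set \<Rightarrow> real" where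
  "local_data w K = (diameter K)\<^sup>2 * (L2_norm (interior K) w)\<^sup>2 + (diameter K)\<^sup>2 * (L2_norm (interior K) s)\<^sup>2
     + (L2_norm (interior K) G)\<^sup>2"

lemma local_data_nonneg: "local_data w K \<ge> 0"
  by (simp add: local_data_def)

text \<open>The affine part of the residual is bounded by the bubble argument on an inner ball and
  transported to all of \<open>K\<close> by shape regularity; the remainder goes directly into the
  data term. The affine function is arbitrary, so a projection can be inserted later.\<close>

lemma interior_estimate:
  assumes K: "K \<in> \<T>"
  shows "(diameter K)\<^sup>2 * (L2_norm (interior K) r)\<^sup>2 \<le> interior_const TYPE('a) \<sigma> * local_data (\<lambda>x. r x - (A + k \<bullet> x)) K"
proof -
  obtain p r0 where p: "r0 > 0" "cball p r0 \<subseteq> K" "diameter K \<le> \<sigma> * r0" using shape[OF K] by blast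
  define \<rho> where "\<rho> = r0 / 2"
  define h where "h = diameter K"
  define \<omega> where "\<omega> = unit_vol TYPE('a)"
  define \<kappa> where "\<kappa> = int_rate TYPE('a)"
  have \<rho>: "\<rho> > 0" using p(1) by (simp add: \<rho>_def)
  have h: "h > 0" "h \<le> 2 * \<sigma> * \<rho>" using diameter_pos[OF K] p(3) by (auto simp: h_def \<rho>_def)
  have pos: "\<omega> > 0" "\<kappa> > 0" using unit_vol_pos[where 'a='a] rates_pos(1)[where 'a='a] by (auto simp: \<omega>_def \<kappa>_def)
  have sub: "cball p \<rho> \<subseteq> interior K"
  proof -
    have "cball p \<rho> \<subseteq> ball p r0" using p(1) by (auto simp: \<rho>_def)
    also have "ball p r0 \<subseteq> interior K" using p(2) by (intro interior_maximal) auto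
    finally show ?thesis .
  qed
  define M where "M = \<bar>A + k \<bullet> p\<bar> + norm k * \<rho>"
  define ov where "ov = (L2_norm (interior K) (\<lambda>x. r x - (A + k \<bullet> x)))\<^sup>2"
  define ss where "ss = (L2_norm (interior K) s)\<^sup>2"
  define gg where "gg = (L2_norm (interior K) G)\<^sup>2"
  have nn: "ov \<ge> 0" "ss \<ge> 0" "gg \<ge> 0" by (auto simp: ov_def ss_def gg_def)
  define W where "W = ov + ss + 25 / \<rho>\<^sup>2 * gg"
  have W0: "W \<ge> 0" using nn by (simp add: W_def)
  have M0: "M \<ge> 0" using \<rho> by (simp add: M_def)
  have bub: "\<kappa>\<^sup>2 * (M\<^sup>2 * \<rho> ^ DIM('a)) \<le> 3 * \<omega> * W"
    using interior_bubble[OF K sub \<rho>, of A k] by (simp only: \<kappa>_def \<omega>_def W_def ov_def ss_def gg_def M_def)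
  \<comment> \<open>\<open>K\<close> lies within \<open>2 * \<sigma> * \<rho>\<close> of
    \<open>p\<close>, so across \<open>K\<close> the affine function exceeds its size
    \<open>M\<close> on the inner ball by at most the factor \<open>2 * \<sigma>\<close>.\<close>
  have qb: "norm (A + k \<bullet> x) \<le> 2 * \<sigma> * M" if x: "x \<in> interior K" for x
  proof -
    have xK: "x \<in> K" "p \<in> K" using x interior_subset p(1,2) by auto
    have "norm (x - p) \<le> h"
      using diameter_bounded_bound[OF element_props(6)[OF K] xK] by (simp add: dist_norm h_def)
    then have "\<bar>k \<bullet> (x - p)\<bar> \<le> norm k * (2 * \<sigma> * \<rho>)"
      using h(2) by (intro order_trans[OF Cauchy_Schwarz_ineq2] mult_left_mono) auto
    moreover have "\<bar>A + k \<bullet> x\<bar> \<le> \<bar>A + k \<bullet> p\<bar> + \<bar>k \<bullet> (x - p)\<bar>"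
      by (simp add: inner_diff_right)
    ultimately have "\<bar>A + k \<bullet> x\<bar> \<le> 1 * \<bar>A + k \<bullet> p\<bar> + norm k * (2 * \<sigma> * \<rho>)" by simp
    also have "\<dots> \<le> (2 * \<sigma>) * \<bar>A + k \<bullet> p\<bar> + norm k * (2 * \<sigma> * \<rho>)"
      using \<sigma>1 by (intro add_mono mult_right_mono order_refl) auto
    finally show ?thesis by (simp add: M_def algebra_simps)
  qed
  have qm: "(\<lambda>x. A + k \<bullet> x) \<in> borel_measurable (lebesgue_on (interior K))"
    by (intro borel_imp_lebesgue_on borel_measurable_continuous_onI continuous_intros)
  have iK: "interior K \<in> lmeasurable"
    using element_props(6)[OF K] by (intro open_bounded_lmeasurable bounded_interior) auto
  note qL = L2_bounded(1)[OF qm iK qb] and qn = L2_bounded(2)[OF qm iK qb]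
  have "measure lebesgue (interior K) \<le> measure lebesgue (cball p h)"
  proof (rule measure_mono_fmeasurable)
    show "interior K \<subseteq> cball p h"
    proof
      fix x assume "x \<in> interior K"
      then have "x \<in> K" "p \<in> K" using interior_subset p(1,2) by auto
      then show "x \<in> cball p h"
        using diameter_bounded_bound[OF element_props(6)[OF K]] by (simp add: h_def)
    qed
  qed auto
  also have "\<dots> = \<omega> * h ^ DIM('a)" unfolding \<omega>_def using h by (intro measure_ball_unit_vol) auto
  also have "\<dots> \<le> \<omega> * (2 * \<sigma> * \<rho>) ^ DIM('a)" using h pos by (intro mult_left_mono power_mono) auto
  finally have meas: "measure lebesgue (interior K) \<le> \<omega> * (2 * \<sigma> * \<rho>) ^ DIM('a)" .
  define c where "c = (2 * \<sigma>) ^ (DIM('a) + 2) * \<omega> * (3 * \<omega> / \<kappa>\<^sup>2)"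
  have c_nonneg: "c \<ge> 0" using \<sigma>1 pos by (simp add: c_def)
  have "(L2_norm (interior K) (\<lambda>x. A + k \<bullet> x))\<^sup>2 \<le> (2 * \<sigma> * M)\<^sup>2 * (\<omega> * (2 * \<sigma> * \<rho>) ^ DIM('a))"
    using meas by (intro order_trans[OF qn] mult_left_mono) auto
  also have "\<dots> = (2 * \<sigma>) ^ (DIM('a) + 2) * \<omega> * (M\<^sup>2 * \<rho> ^ DIM('a))"
    by (simp add: power_mult_distrib power_add power2_eq_square mult_ac)
  also have "\<dots> \<le> (2 * \<sigma>) ^ (DIM('a) + 2) * \<omega> * (3 * \<omega> / \<kappa>\<^sup>2 * W)"
    using bub pos \<sigma>1 by (intro mult_left_mono) (auto simp: field_simps)
  finally have qW: "(L2_norm (interior K) (\<lambda>x. A + k \<bullet> x))\<^sup>2 \<le> c * W" by (simp add: c_def mult_ac)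
  have rL: "r \<in> L2 (interior K)" by (rule element_L2(1)[OF r_L2 K])
  have "L2_norm (interior K) r = L2_norm (interior K) (\<lambda>x. (r x - (A + k \<bullet> x)) + (A + k \<bullet> x))" by simp
  also have "\<dots> \<le> L2_norm (interior K) (\<lambda>x. r x - (A + k \<bullet> x)) + L2_norm (interior K) (\<lambda>x. A + k \<bullet> x)"
    by (intro L2_triangle L2_diff rL qL)
  finally have "(L2_norm (interior K) r)\<^sup>2 \<le> (L2_norm (interior K) (\<lambda>x. r x - (A + k \<bullet> x)) + L2_norm (interior K) (\<lambda>x. A + k \<bullet> x))\<^sup>2"
    by (intro power_mono L2_norm_nonneg)
  also have "\<dots> \<le> 2 * ov + 2 * (L2_norm (interior K) (\<lambda>x. A + k \<bullet> x))\<^sup>2"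
    using sum_squares_bound[of "L2_norm (interior K) (\<lambda>x. r x - (A + k \<bullet> x))" "L2_norm (interior K) (\<lambda>x. A + k \<bullet> x)"]
    by (simp add: power2_sum ov_def)
  also have "\<dots> \<le> 2 * ov + 2 * (c * W)" using qW by simp
  finally have rb: "h\<^sup>2 * (L2_norm (interior K) r)\<^sup>2 \<le> h\<^sup>2 * (2 * ov + 2 * (c * W))"
    by (intro mult_left_mono) auto
  define P where "P = h\<^sup>2 * ov + h\<^sup>2 * ss + gg"
  have "h\<^sup>2 / \<rho>\<^sup>2 \<le> (2 * \<sigma>)\<^sup>2"
    using h \<rho> power_mono[of h "2 * \<sigma> * \<rho>" 2] by (simp add: field_simps power_mult_distrib)
  then have "25 * (h\<^sup>2 / \<rho>\<^sup>2) * gg \<le> 25 * (2 * \<sigma>)\<^sup>2 * gg" using nn by (intro mult_right_mono mult_left_mono) auto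
  then have 1: "h\<^sup>2 * W \<le> h\<^sup>2 * ov + h\<^sup>2 * ss + 100 * \<sigma>\<^sup>2 * gg" by (simp add: W_def algebra_simps power_mult_distrib)
  have \<sigma>2: "100 * \<sigma>\<^sup>2 \<ge> 1" using one_le_power[OF \<sigma>1, of 2] by linarith
  have "h\<^sup>2 * ov + h\<^sup>2 * ss + 100 * \<sigma>\<^sup>2 * gg \<le> 100 * \<sigma>\<^sup>2 * P"
  proof -
    have "1 * (h\<^sup>2 * ov + h\<^sup>2 * ss) \<le> 100 * \<sigma>\<^sup>2 * (h\<^sup>2 * ov + h\<^sup>2 * ss)"
      using nn by (intro mult_right_mono \<sigma>2) auto
    then show ?thesis by (simp add: P_def algebra_simps)
  qed
  with 1 have hW: "h\<^sup>2 * W \<le> 100 * \<sigma>\<^sup>2 * P" by linarith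
  have oP: "h\<^sup>2 * ov \<le> P" using nn by (simp add: P_def)
  have "h\<^sup>2 * (2 * ov + 2 * (c * W)) = 2 * (h\<^sup>2 * ov) + 2 * c * (h\<^sup>2 * W)" by (simp add: algebra_simps)
  also have "\<dots> \<le> 2 * P + 2 * c * (100 * \<sigma>\<^sup>2 * P)"
    using hW oP c_nonneg by (intro add_mono mult_left_mono) auto
  also have "\<dots> = interior_const TYPE('a) \<sigma> * P"
    by (simp add: interior_const_def c_def \<omega>_def \<kappa>_def algebra_simps)
  finally show ?thesis using rb by (simp add: P_def local_data_def h_def ov_def ss_def gg_def)
qed

text \<open>The two affine pieces agree on a disc of the common hyperplane, since \<open>z\<close>
  has one value there. Hence their gradients have the same tangential part.\<close>

lemma grad_jump:
  assumes K: "K \<in> \<T>" "K' \<in> \<T>" and \<nu>: "norm \<nu> = 1" "\<nu> \<bullet> c = \<beta>" "\<rho> > 0"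
    and sub: "cball c \<rho> \<inter> {x. \<nu> \<bullet> x \<le> \<beta>} \<subseteq> K" "cball c \<rho> \<inter> {x. \<nu> \<bullet> x \<ge> \<beta>} \<subseteq> K'"
  shows "elem_grad K z - elem_grad K' z = (\<nu> \<bullet> (elem_grad K z - elem_grad K' z)) *\<^sub>R \<nu>"
proof -
  define D where "D = elem_grad K z - elem_grad K' z"
  define w where "w = D - (\<nu> \<bullet> D) *\<^sub>R \<nu>"
  have nn: "\<nu> \<bullet> \<nu> = 1" using \<nu>(1) by (simp add: norm_eq_1)
  have w\<nu>: "\<nu> \<bullet> w = 0" using nn by (simp add: w_def inner_diff_right)
  obtain a where a: "\<And>x. x \<in> K \<Longrightarrow> z x = a + elem_grad K z \<bullet> x" using fe_affine[OF z K(1)] by blast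
  obtain a' where a': "\<And>x. x \<in> K' \<Longrightarrow> z x = a' + elem_grad K' z \<bullet> x" using fe_affine[OF z K(2)] by blast
  have D: "D \<bullet> x = a' - a" if "x \<in> cball c \<rho>" "\<nu> \<bullet> x = \<beta>" for x
  proof -
    have "x \<in> K" "x \<in> K'" using sub that by fastforce+
    then show ?thesis using a[of x] a'[of x] by (simp add: D_def inner_diff_left)
  qed
  have "w = 0"
  proof (rule ccontr)
    assume w0: "w \<noteq> 0"
    define x where "x = c + (\<rho> / norm w) *\<^sub>R w"
    have "x \<in> cball c \<rho>" using \<nu>(3) w0 by (simp add: x_def dist_norm)
    moreover have "\<nu> \<bullet> x = \<beta>" using \<nu>(2) w\<nu> by (simp add: x_def inner_add_right)
    ultimately have "D \<bullet> x = a' - a" by (rule D)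
    moreover have "D \<bullet> c = a' - a" using D[of c] \<nu>(2,3) by simp
    ultimately have "D \<bullet> w = 0" using \<nu>(3) w0 by (simp add: x_def inner_add_right)
    moreover have "w \<bullet> w = D \<bullet> w - (\<nu> \<bullet> D) * (\<nu> \<bullet> w)"
      by (subst (1) w_def) (simp add: inner_diff_left)
    ultimately show False using w0 w\<nu> by simp
  qed
  then show ?thesis by (simp add: w_def D_def)
qed

text \<open>Test the residual equation with a bump centred on the side. The gradient jump is \<open>j \<nu>\<close>, so the pairing
  with \<^term>\<open>pw_grad z\<close> is \<open>j\<close> times an integral over a half ball whose integrand is nonnegative.\<close>

lemma side_bubble:
  assumes K: "K \<in> \<T>" "K' \<in> \<T>" and \<nu>: "norm \<nu> = 1" "\<nu> \<bullet> c = \<beta>" "\<rho>0 > 0"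
    and sub: "cball c \<rho>0 \<inter> {x. \<nu> \<bullet> x \<le> \<beta>} \<subseteq> K" "cball c \<rho>0 \<inter> {x. \<nu> \<bullet> x \<ge> \<beta>} \<subseteq> K'"
  defines "\<rho> \<equiv> \<rho>0 / 2" and "j \<equiv> \<nu> \<bullet> (elem_grad K z - elem_grad K' z)"
  shows "(side_rate TYPE('a))\<^sup>2 * (j\<^sup>2 * \<rho> ^ DIM('a)) \<le> 48 * unit_vol TYPE('a) *
     (\<rho>\<^sup>2 * (L2_norm (ball c \<rho>) s)\<^sup>2 + \<rho>\<^sup>2 * (L2_norm (ball c \<rho>) r)\<^sup>2 + (L2_norm (ball c \<rho>) G)\<^sup>2)"
proof -
  let ?B = "ball c \<rho>"
  define \<phi> where "\<phi> = bump c \<rho>"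
  have \<rho>: "\<rho> > 0" using \<nu>(3) by (simp add: \<rho>_def)
  have sm: "smooth \<phi>" by (simp add: \<phi>_def smooth_bump)
  have "ball c \<rho>0 \<subseteq> K \<union> K'"
  proof
    fix x assume "x \<in> ball c \<rho>0"
    then have "x \<in> cball c \<rho>0" by simp
    then show "x \<in> K \<union> K'" using sub by (cases "\<nu> \<bullet> x \<le> \<beta>") fastforce+
  qed
  then have "ball c \<rho>0 \<subseteq> closure \<Omega>" using element_props(3)[OF K(1)] element_props(3)[OF K(2)] by blast
  then have B0: "ball c \<rho>0 \<subseteq> \<Omega>" using int_cl_\<Omega> interior_maximal[of "ball c \<rho>0" "closure \<Omega>"] by simp
  have cB: "cball c \<rho> \<subseteq> ball c \<rho>0" using \<nu>(3) by (auto simp: \<rho>_def)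
  have B\<Omega>: "?B \<subseteq> \<Omega>" using B0 cB ball_subset_cball by blast
  have out: "\<phi> x = 0" if "x \<notin> ?B" for x using bump_outside[OF \<rho> that] by (simp add: \<phi>_def)
  have test: "\<phi> \<in> test_functions \<Omega>"
  proof (rule test_functionsI[OF sm compact_cball])
    show "cball c \<rho> \<subseteq> \<Omega>" using cB B0 by blast
    show "\<phi> x = 0" if "x \<notin> cball c \<rho>" for x using that by (intro out) auto
  qed
  have gout: "classical_grad \<phi> x = 0" if "x \<notin> ?B" for x
    unfolding \<phi>_def by (rule bump_grad_outside[OF \<rho> that])
  have \<phi>M: "norm (\<phi> x) \<le> 1" for x using bump_range[of c \<rho> x] by (simp add: \<phi>_def)
  have gM: "norm (classical_grad \<phi> x) \<le> 4 / \<rho>" for x unfolding \<phi>_def by (rule bump_grad_bound[OF \<rho>])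
  have gb: "classical_grad \<phi> \<in> borel_measurable borel" "\<phi> \<in> borel_measurable borel"
    by (rule smooth_grad_borel[OF sm] smooth_borel[OF sm])+
  note \<phi>2 = test_function_L2[OF test \<Omega>_lmeasurable]
  define H where "H = {x. \<nu> \<bullet> x < \<beta>}"
  have opH: "open H" unfolding H_def by (rule open_halfspace_lt)
  \<comment> \<open>Subtracting the constant vector \<open>elem_grad K' z\<close> turns the
    piecewise gradient near the side into \<open>j\<close> times this field, up to the null
    hyperplane.\<close>
  define E where "E x = indicat_real H x *\<^sub>R \<nu>" for x
  have Eb: "E \<in> borel_measurable borel"
    unfolding E_def[abs_def] using opH by (intro borel_measurable_scaleR) auto
  have E2: "E \<in> L2 \<Omega>"
    by (rule L2_bounded(1)[OF borel_imp_lebesgue_on[OF Eb] \<Omega>_lmeasurable, of 1]) (auto simp: E_def indicator_def \<nu>(1))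
  have nn: "\<nu> \<bullet> \<nu> = 1" using \<nu>(1) by (simp add: norm_eq_1)
  \<comment> \<open>The gradient of the radial bump is \<open>- F x *\<^sub>R (x - c)\<close>. Its
    normal component \<open>F x * (\<beta> - \<nu> \<bullet> x)\<close> is nonnegative on the side
    of \<open>K\<close>, so no cancellation can occur.\<close>
  define F where "F x = 2 / \<rho>\<^sup>2 * flat 2 (1 - (norm (x - c))\<^sup>2 / \<rho>\<^sup>2)" for x
  have F0: "F x \<ge> 0" for x by (simp add: F_def flat_nonneg)
  have EF: "E x \<bullet> classical_grad \<phi> x = indicat_real H x * (F x * (\<beta> - \<nu> \<bullet> x))" for x
  proof -
    have "classical_grad \<phi> x = - F x *\<^sub>R (x - c)" unfolding \<phi>_def bump_grad F_def ..
    then show ?thesis by (simp only:) (simp add: E_def inner_diff_right \<nu>(2) algebra_simps)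
  qed
  have lowpt: "0 \<le> E x \<bullet> classical_grad \<phi> x" for x
    unfolding EF using F0 by (auto simp: H_def indicator_def)
  define Y where "Y = L2_inner \<Omega> E (classical_grad \<phi>)"
  \<comment> \<open>Half a radius below the side: the ball of radius \<open>\<rho>/4\<close> around
    \<open>p\<close> stays \<open>\<rho>/4\<close> away from the hyperplane and within
    \<open>3/4 * \<rho>\<close> of \<open>c\<close>, so both factors of the integrand are bounded
    below.\<close>
  define p where "p = c - (\<rho>/2) *\<^sub>R \<nu>"
  have Ylow: "side_rate TYPE('a) * \<rho> ^ DIM('a) / \<rho> \<le> Y"
  proof -
    have dpc: "norm (p - c) = \<rho>/2" using \<rho> \<nu>(1) by (simp add: p_def)
    have pB: "dist x c \<le> 3/4 * \<rho>" if "x \<in> ball p (\<rho>/4)" for x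
      using that dpc dist_triangle[of x c p] by (simp add: dist_norm norm_minus_commute)
    have "bump_level / (2 * \<rho>) * measure lebesgue (ball p (\<rho>/4)) \<le> (LINT x|lebesgue_on \<Omega>. E x \<bullet> classical_grad \<phi> x)"
    proof (rule integral_ge_on_subset[OF L2_inner_integrable(2)[OF E2 \<phi>2(2)] \<Omega>_lmeasurable _ _ lowpt])
      show "ball p (\<rho>/4) \<subseteq> \<Omega>"
      proof
        fix x assume "x \<in> ball p (\<rho>/4)"
        then have "x \<in> ?B" using pB[of x] \<rho> by (simp add: dist_commute)
        then show "x \<in> \<Omega>" using B\<Omega> by blast
      qed
      fix x assume x: "x \<in> ball p (\<rho>/4)"
      have "\<bar>\<nu> \<bullet> (x - p)\<bar> \<le> norm \<nu> * norm (x - p)" by (rule Cauchy_Schwarz_ineq2)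
      also have "\<dots> \<le> \<rho>/4" using x \<nu>(1) by (simp add: dist_norm norm_minus_commute)
      finally have "\<nu> \<bullet> (x - p) \<le> \<rho>/4" by (rule abs_le_D1)
      then have bx: "\<rho>/4 \<le> \<beta> - \<nu> \<bullet> x" using nn \<nu>(2) by (simp add: p_def inner_diff_right inner_add_right)
      then have xH: "x \<in> H" using \<rho> by (simp add: H_def)
      have "bump_level \<le> flat 2 (1 - (norm (x - c))\<^sup>2 / \<rho>\<^sup>2)"
        by (intro flat_ge_bump_level bump_arg_bounds \<rho> pB x)
      then have "(2 / \<rho>\<^sup>2 * bump_level) * (\<rho>/4) \<le> F x * (\<beta> - \<nu> \<bullet> x)"
        unfolding F_def using bx \<rho> bump_level_pos by (intro mult_mono mult_left_mono) (auto simp: flat_nonneg)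
      also have "\<dots> = E x \<bullet> classical_grad \<phi> x"
        using xH by (simp add: EF)
      finally show "bump_level / (2 * \<rho>) \<le> E x \<bullet> classical_grad \<phi> x"
        using \<rho> by (simp add: power2_eq_square)
    qed simp
    moreover have "measure lebesgue (ball p (\<rho>/4)) = unit_vol TYPE('a) * (\<rho>/4) ^ DIM('a)"
      using \<rho> by (intro measure_ball_unit_vol) simp
    ultimately have "bump_level / (2 * \<rho>) * (unit_vol TYPE('a) * (\<rho>/4) ^ DIM('a)) \<le> Y"
      by (simp only: Y_def L2_inner_def)
    then show ?thesis by (simp add: side_rate_def power_divide mult_ac)
  qed
  define X where "X = L2_inner \<Omega> (pw_grad z) (classical_grad \<phi>)"
  have pw2: "pw_grad z \<in> L2 \<Omega>" by (rule fe_weak_grad(2)[OF z])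
  have c2: "(\<lambda>x. v) \<in> L2 \<Omega>" for v :: 'a
    by (rule L2_bounded(1)[OF _ \<Omega>_lmeasurable, of _ "norm v"]) auto
  have jump: "elem_grad K z - elem_grad K' z = j *\<^sub>R \<nu>"
    unfolding j_def by (rule grad_jump[OF K \<nu> sub])
  have XY: "X = j * Y"
  proof -
    have "L2_inner \<Omega> (\<lambda>x. pw_grad z x - elem_grad K' z) (classical_grad \<phi>)
        = X - L2_inner \<Omega> (\<lambda>x. elem_grad K' z) (classical_grad \<phi>)"
      unfolding X_def by (rule L2_inner_diff_left[OF pw2 c2 \<phi>2(2)])
    also have "L2_inner \<Omega> (\<lambda>x. elem_grad K' z) (classical_grad \<phi>) = 0"
      by (rule integral_test_grad[OF open_\<Omega> bounded_\<Omega> test])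
    finally have "X = (LINT x|lebesgue_on \<Omega>. (pw_grad z x - elem_grad K' z) \<bullet> classical_grad \<phi> x)"
      by (simp add: L2_inner_def)
    also have "\<dots> = (LINT x|lebesgue_on \<Omega>. j * (E x \<bullet> classical_grad \<phi> x))"
    proof (rule integral_cong_AE)
      have hp: "negligible {x. \<nu> \<bullet> x = \<beta>}" using \<nu>(1) by (intro negligible_hyperplane) auto
      have "AE x in lebesgue_on \<Omega>. \<nu> \<bullet> x \<noteq> \<beta>"
      proof (rule AE_lebesgue_on[OF _ \<Omega>_sets])
        show "AE x in lebesgue. \<nu> \<bullet> x \<noteq> \<beta>"
          using AE_not_in[of "{x. \<nu> \<bullet> x = \<beta>}" lebesgue] hp by (simp add: negligible_iff_null_sets)
      qed
      then show "AE x in lebesgue_on \<Omega>. (pw_grad z x - elem_grad K' z) \<bullet> classical_grad \<phi> x = j * (E x \<bullet> classical_grad \<phi> x)"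
      proof eventually_elim
        case (elim x)
        show ?case
        proof (cases "x \<in> ?B")
          case False
          then show ?thesis using gout by simp
        next
          case True
          then have xb: "x \<in> ball c \<rho>0" using cB ball_subset_cball by blast
          show ?thesis
          proof (cases "\<nu> \<bullet> x < \<beta>")
            case True
            have "ball c \<rho>0 \<inter> H \<subseteq> interior K"
              using sub(1) opH by (intro interior_maximal) (auto simp: H_def)
            then have "x \<in> interior K" using xb True by (auto simp: H_def)
            then have "pw_grad z x - elem_grad K' z = j *\<^sub>R \<nu>" using pw_grad_interior[OF K(1)] jump by simp
            then show ?thesis using True by (simp add: E_def H_def)
          next
            case False
            have "ball c \<rho>0 \<inter> {x. \<nu> \<bullet> x > \<beta>} \<subseteq> interior K'"
              using sub(2) open_halfspace_gt[of \<beta> \<nu>] by (intro interior_maximal) auto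
            then have "x \<in> interior K'" using xb False elim by auto
            then have "pw_grad z x - elem_grad K' z = 0" using pw_grad_interior[OF K(2)] by simp
            then show ?thesis using False by (simp add: E_def H_def)
          qed
        qed
      qed
      have m: "pw_grad z \<in> borel_measurable (lebesgue_on \<Omega>)" "classical_grad \<phi> \<in> borel_measurable (lebesgue_on \<Omega>)" "E \<in> borel_measurable (lebesgue_on \<Omega>)"
        by (intro borel_imp_lebesgue_on pw_grad_borel gb Eb)+
      show "(\<lambda>x. (pw_grad z x - elem_grad K' z) \<bullet> classical_grad \<phi> x) \<in> borel_measurable (lebesgue_on \<Omega>)"
        by (intro borel_measurable_inner borel_measurable_diff m borel_measurable_const)
      show "(\<lambda>x. j * (E x \<bullet> classical_grad \<phi> x)) \<in> borel_measurable (lebesgue_on \<Omega>)"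
        by (intro borel_measurable_inner borel_measurable_times m borel_measurable_const)
    qed
    also have "\<dots> = j * Y" by (simp add: Y_def L2_inner_def)
    finally show ?thesis .
  qed
  define V where "V = unit_vol TYPE('a) * \<rho> ^ DIM('a)"
  note bnd = L2_inner_ball_bound[OF _ B\<Omega> \<Omega>_sets less_imp_le[OF \<rho>], folded V_def]
  have Xeq: "X = L2_inner \<Omega> s \<phi> + L2_inner \<Omega> r \<phi> + (- L2_inner \<Omega> G (classical_grad \<phi>))"
    using residual_split[OF test] by (simp add: X_def)
  define S2 where "S2 = (L2_norm ?B s)\<^sup>2"
  define R2 where "R2 = (L2_norm ?B r)\<^sup>2"
  define G2 where "G2 = (L2_norm ?B G)\<^sup>2"
  have nn2: "S2 \<ge> 0" "R2 \<ge> 0" "G2 \<ge> 0" by (auto simp: S2_def R2_def G2_def)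
  have "X\<^sup>2 \<le> 3 * ((L2_inner \<Omega> s \<phi>)\<^sup>2 + (L2_inner \<Omega> r \<phi>)\<^sup>2 + (L2_inner \<Omega> G (classical_grad \<phi>))\<^sup>2)"
    unfolding Xeq by (rule order_trans[OF sum3_power2_le]) simp
  also have "\<dots> \<le> 3 * (1\<^sup>2 * V * S2 + 1\<^sup>2 * V * R2 + (4 / \<rho>)\<^sup>2 * V * G2)"
    unfolding S2_def R2_def G2_def
    by (intro mult_left_mono add_mono bnd[OF s_L2 gb(2) out \<phi>M] bnd[OF r_L2 gb(2) out \<phi>M] bnd[OF G_L2 gb(1) gout gM]) auto
  finally have X2: "X\<^sup>2 \<le> 3 * V * (S2 + R2 + 16 / \<rho>\<^sup>2 * G2)"
    by (simp add: power_divide algebra_simps)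
  define \<kappa> where "\<kappa> = side_rate TYPE('a)"
  define \<omega> where "\<omega> = unit_vol TYPE('a)"
  have pos: "\<kappa> > 0" "\<omega> > 0" using rates_pos(2)[where 'a='a] unit_vol_pos[where 'a='a] by (auto simp: \<kappa>_def \<omega>_def)
  define Q where "Q = \<rho> ^ DIM('a)"
  have Q: "Q > 0" using \<rho> by (simp add: Q_def)
  have "(\<kappa> * Q / \<rho>)\<^sup>2 \<le> Y\<^sup>2"
    using Ylow pos Q \<rho> by (intro power_mono) (auto simp: \<kappa>_def Q_def)
  then have "j\<^sup>2 * (\<kappa> * Q / \<rho>)\<^sup>2 \<le> j\<^sup>2 * Y\<^sup>2" by (intro mult_left_mono) auto
  also have "\<dots> = X\<^sup>2" by (simp add: XY power_mult_distrib)
  also note X2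
  finally have 1: "j\<^sup>2 * (\<kappa> * Q / \<rho>)\<^sup>2 \<le> 3 * (\<omega> * Q) * (S2 + R2 + 16 / \<rho>\<^sup>2 * G2)"
    by (simp add: V_def \<omega>_def Q_def)
  have "Q * (\<kappa>\<^sup>2 * (j\<^sup>2 * Q)) = \<rho>\<^sup>2 * (j\<^sup>2 * (\<kappa> * Q / \<rho>)\<^sup>2)"
    using \<rho> by (simp add: power2_eq_square)
  also have "\<dots> \<le> \<rho>\<^sup>2 * (3 * (\<omega> * Q) * (S2 + R2 + 16 / \<rho>\<^sup>2 * G2))"
    using 1 by (intro mult_left_mono) auto
  also have "\<dots> = Q * (3 * \<omega> * (\<rho>\<^sup>2 * S2 + \<rho>\<^sup>2 * R2 + 16 * G2))"
    using \<rho> by (simp add: field_simps)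
  finally have "\<kappa>\<^sup>2 * (j\<^sup>2 * Q) \<le> 3 * \<omega> * (\<rho>\<^sup>2 * S2 + \<rho>\<^sup>2 * R2 + 16 * G2)"
    using Q by (simp add: mult_le_cancel_left)
  also have "\<dots> \<le> 3 * \<omega> * (16 * (\<rho>\<^sup>2 * S2 + \<rho>\<^sup>2 * R2 + G2))"
    using pos nn2 by (intro mult_left_mono) auto
  also have "\<dots> = 48 * \<omega> * (\<rho>\<^sup>2 * S2 + \<rho>\<^sup>2 * R2 + G2)" by simp
  finally show ?thesis by (simp only: \<kappa>_def \<omega>_def Q_def S2_def R2_def G2_def)
qed

text \<open>\<open>side_area_bound\<close> reduces the weighted area to
  \<open>\<rho> ^ DIM('a)\<close>, which the side bubble controls by norms over a ball. The two
  elements cover this ball, and their interiors receive all of the norms because the skeleton is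
  null.\<close>

lemma side_estimate:
  assumes K: "K \<in> \<T>" "K' \<in> \<T>" "\<gamma> facet_of K" "\<gamma> facet_of K'" "K \<noteq> K'"
  shows "diameter K * ((normal_jump \<T> z \<gamma>)\<^sup>2 * side_area K \<gamma>)
     \<le> side_const TYPE('a) \<sigma> (diameter (closure \<Omega>)) * (local_data r K + local_data r K')"
proof -
  obtain \<nu> \<beta> c \<rho>0 where n: "norm \<nu> = 1" "\<nu> \<bullet> c = \<beta>" "\<rho>0 > 0" "c \<in> \<gamma>"
    "outward_normal K \<gamma> = \<nu>" "outward_normal K' \<gamma> = - \<nu>"
    "cball c \<rho>0 \<inter> {x. \<nu> \<bullet> x \<le> \<beta>} \<subseteq> K" "cball c \<rho>0 \<inter> {x. \<nu> \<bullet> x \<ge> \<beta>} \<subseteq> K'"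
    "diameter K \<le> 2 * \<sigma> * (1 + \<sigma>) * \<rho>0" "\<rho>0 \<le> diameter K"
    by (rule internal_side[OF K(1,2,5,3,4)]) (rule that; assumption)
  define \<rho> where "\<rho> = \<rho>0 / 2"
  define h where "h = diameter K"
  define h' where "h' = diameter K'"
  define j where "j = normal_jump \<T> z \<gamma>"
  define D where "D = diameter (closure \<Omega>)"
  define \<omega> where "\<omega> = unit_vol TYPE('a)"
  define \<kappa> where "\<kappa> = side_rate TYPE('a)"
  have pos: "\<kappa> > 0" "\<omega> > 0" using rates_pos(2)[where 'a='a] unit_vol_pos[where 'a='a] by (auto simp: \<kappa>_def \<omega>_def)
  have D0: "D \<ge> 0" unfolding D_def by (rule diameter_ge_0[OF bounded_closure[OF bounded_\<Omega>]])
  have \<rho>: "\<rho> > 0" "\<rho> \<le> h" using n(3,10) by (auto simp: \<rho>_def h_def)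
  \<comment> \<open>Both diameters must dominate \<open>\<rho>\<close>, since the weight
    \<open>\<rho>\<^sup>2\<close> is replaced by the squared diameter of either element.\<close>
  have \<rho>h': "\<rho> \<le> h'"
  proof -
    have "c + \<rho>0 *\<^sub>R \<nu> \<in> cball c \<rho>0" "c \<in> cball c \<rho>0" using n(1,3) by (auto simp: dist_norm)
    moreover have "\<nu> \<bullet> (c + \<rho>0 *\<^sub>R \<nu>) \<ge> \<beta>" using n(1,2,3) by (simp add: inner_add_right norm_eq_1)
    ultimately have "c + \<rho>0 *\<^sub>R \<nu> \<in> K'" "c \<in> K'" using n(2,8) by auto
    from diameter_bounded_bound[OF element_props(6)[OF K(2)] this] show ?thesis
      using n(1,3) by (simp add: dist_norm h'_def \<rho>_def)
  qed
  have j: "j = \<nu> \<bullet> (elem_grad K z - elem_grad K' z)"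
    unfolding j_def normal_jump_eq[OF K] n(5) ..
  let ?B = "ball c \<rho>"
  have bub: "\<kappa>\<^sup>2 * (j\<^sup>2 * \<rho> ^ DIM('a)) \<le> 48 * \<omega> *
     (\<rho>\<^sup>2 * (L2_norm ?B s)\<^sup>2 + \<rho>\<^sup>2 * (L2_norm ?B r)\<^sup>2 + (L2_norm ?B G)\<^sup>2)"
    using side_bubble[OF K(1,2) n(1,2,3,7,8)] by (simp only: j \<rho>_def \<kappa>_def \<omega>_def)
  have BK: "?B \<subseteq> K \<union> K'"
  proof
    fix x assume "x \<in> ?B"
    then have "x \<in> cball c \<rho>0" using n(3) by (simp add: \<rho>_def)
    then show "x \<in> K \<union> K'" using n(7,8) by (cases "\<nu> \<bullet> x \<le> \<beta>") fastforce+
  qed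
  then have "?B \<subseteq> closure \<Omega>" using element_props(3)[OF K(1)] element_props(3)[OF K(2)] by blast
  then have B\<Omega>: "?B \<subseteq> \<Omega>" using int_cl_\<Omega> interior_maximal[of ?B "closure \<Omega>"] by simp
  have cover: "(L2_norm ?B F)\<^sup>2 \<le> (L2_norm (interior K) F)\<^sup>2 + (L2_norm (interior K') F)\<^sup>2"
    if "F \<in> L2 \<Omega>" for F :: "'a \<Rightarrow> 'b::euclidean_space"
  proof (rule L2_norm_cover[OF that \<Omega>_sets interior_element_subset[OF K(1)] interior_element_subset[OF K(2)] B\<Omega> _ _ _ _ skeleton_negligible])
    show "?B \<subseteq> interior K \<union> interior K' \<union> skeleton"
    proof
      have *: "x \<in> interior L \<or> x \<in> skeleton" if "L \<in> \<T>" "x \<in> L" for x L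
      proof -
        have "x \<in> interior L \<or> x \<in> frontier L" using that(2) closure_subset[of L] by (auto simp: frontier_def)
        then show ?thesis using that(1) unfolding skeleton_def by blast
      qed
      fix x assume "x \<in> ?B"
      then show "x \<in> interior K \<union> interior K' \<union> skeleton" using BK *[OF K(1), of x] *[OF K(2), of x] by blast
    qed
  qed auto
  have "\<rho>\<^sup>2 * (L2_norm ?B F)\<^sup>2 \<le> h\<^sup>2 * (L2_norm (interior K) F)\<^sup>2 + h'\<^sup>2 * (L2_norm (interior K') F)\<^sup>2"
    if "F \<in> L2 \<Omega>" for F :: "'a \<Rightarrow> real"
  proof -
    have "\<rho>\<^sup>2 * (L2_norm ?B F)\<^sup>2 \<le> \<rho>\<^sup>2 * (L2_norm (interior K) F)\<^sup>2 + \<rho>\<^sup>2 * (L2_norm (interior K') F)\<^sup>2"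
      using mult_left_mono[OF cover[OF that], of "\<rho>\<^sup>2"] by (simp add: distrib_left)
    also have "\<dots> \<le> h\<^sup>2 * (L2_norm (interior K) F)\<^sup>2 + h'\<^sup>2 * (L2_norm (interior K') F)\<^sup>2"
      using \<rho> \<rho>h' by (intro add_mono mult_right_mono power_mono) auto
    finally show ?thesis .
  qed
  from this[OF s_L2] this[OF r_L2] cover[OF G_L2]
  have "\<rho>\<^sup>2 * (L2_norm ?B s)\<^sup>2 + \<rho>\<^sup>2 * (L2_norm ?B r)\<^sup>2 + (L2_norm ?B G)\<^sup>2 \<le> local_data r K + local_data r K'"
    unfolding local_data_def h_def h'_def by linarith
  then have "48 * \<omega> * (\<rho>\<^sup>2 * (L2_norm ?B s)\<^sup>2 + \<rho>\<^sup>2 * (L2_norm ?B r)\<^sup>2 + (L2_norm ?B G)\<^sup>2)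
     \<le> 48 * \<omega> * (local_data r K + local_data r K')"
    using pos by (intro mult_left_mono) auto
  with bub have "\<kappa>\<^sup>2 * (j\<^sup>2 * \<rho> ^ DIM('a)) \<le> 48 * \<omega> * (local_data r K + local_data r K')" by linarith
  then have j\<rho>: "j\<^sup>2 * \<rho> ^ DIM('a) \<le> 48 * \<omega> / \<kappa>\<^sup>2 * (local_data r K + local_data r K')"
    using pos by (simp add: field_simps)
  have "diameter K * side_area K \<gamma> \<le> (1 + D) * 2 ^ DIM('a) * \<omega> * h ^ DIM('a)"
    unfolding D_def \<omega>_def h_def
  proof (rule side_area_bound[OF K(1)])
    show "\<gamma> \<subseteq> K" by (rule facet_of_imp_subset[OF K(3)])
    show "closed \<gamma>"
      using K(3) by (intro face_of_imp_closed[OF element_props(2)[OF K(1)] element_props(5)[OF K(1)]]) (simp add: facet_of_def)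
  qed (simp add: n)
  also have "\<dots> \<le> (1 + D) * 2 ^ DIM('a) * \<omega> * (4 * \<sigma> * (1 + \<sigma>) * \<rho>) ^ DIM('a)"
  proof (intro mult_left_mono power_mono)
    have "4 * \<sigma> * (1 + \<sigma>) * \<rho> = 2 * \<sigma> * (1 + \<sigma>) * \<rho>0" by (simp add: \<rho>_def)
    then show "h \<le> 4 * \<sigma> * (1 + \<sigma>) * \<rho>" using n(9) by (simp only: h_def)
  qed (use D0 pos diameter_pos[OF K(1)] in \<open>auto simp: h_def\<close>)
  finally have area: "diameter K * side_area K \<gamma> \<le> (1 + D) * 2 ^ DIM('a) * \<omega> * (4 * \<sigma> * (1 + \<sigma>)) ^ DIM('a) * \<rho> ^ DIM('a)"
    by (simp only: power_mult_distrib mult.assoc)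
  define C where "C = (1 + D) * 2 ^ DIM('a) * \<omega> * (4 * \<sigma> * (1 + \<sigma>)) ^ DIM('a)"
  have C0: "C \<ge> 0" using D0 pos \<sigma>1 by (simp add: C_def)
  have "diameter K * (j\<^sup>2 * side_area K \<gamma>) = j\<^sup>2 * (diameter K * side_area K \<gamma>)" by simp
  also have "\<dots> \<le> j\<^sup>2 * (C * \<rho> ^ DIM('a))" using area by (intro mult_left_mono) (auto simp: C_def)
  also have "\<dots> = C * (j\<^sup>2 * \<rho> ^ DIM('a))" by simp
  also have "\<dots> \<le> C * (48 * \<omega> / \<kappa>\<^sup>2 * (local_data r K + local_data r K'))" by (rule mult_left_mono[OF j\<rho> C0])
  also have "\<dots> = side_const TYPE('a) \<sigma> D * (local_data r K + local_data r K')"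
    by (simp add: C_def side_const_def \<omega>_def \<kappa>_def)
  finally show ?thesis by (simp only: j_def D_def)
qed

text \<open>Double counting: a side belongs to at most two elements and an element has at most
  \<open>DIM('a) + 1\<close> facets, so each \<open>Q K'\<close> occurs at most
  \<open>2 * (DIM('a) + 1)\<close> times.\<close>

lemma sum_sides_le:
  fixes Q :: "'a set \<Rightarrow> real"
  assumes Q: "\<And>K. K \<in> \<T> \<Longrightarrow> Q K \<ge> 0"
  shows "(\<Sum>K\<in>\<T>. \<Sum>\<gamma>\<in>{\<gamma>. \<gamma> facet_of K}. \<Sum>K'\<in>{K'\<in>\<T>. \<gamma> facet_of K'}. Q K') \<le> 2 * real (Suc DIM('a)) * (\<Sum>K\<in>\<T>. Q K)"
proof -
  define \<Gamma> where "\<Gamma> = (\<Union>K\<in>\<T>. {\<gamma>. \<gamma> facet_of K})"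
  have fin: "finite \<Gamma>" unfolding \<Gamma>_def using finite_\<T> facets_finite(1) by blast
  have sub: "{\<gamma>. \<gamma> facet_of K} = {\<gamma>\<in>\<Gamma>. \<gamma> facet_of K}" if "K \<in> \<T>" for K using that by (auto simp: \<Gamma>_def)
  define S where "S \<gamma> = (\<Sum>K'\<in>{K'\<in>\<T>. \<gamma> facet_of K'}. Q K')" for \<gamma>
  have S0: "S \<gamma> \<ge> 0" for \<gamma> unfolding S_def using Q by (intro sum_nonneg) auto
  have "(\<Sum>K\<in>\<T>. \<Sum>\<gamma>\<in>{\<gamma>. \<gamma> facet_of K}. S \<gamma>) = (\<Sum>K\<in>\<T>. \<Sum>\<gamma>\<in>{\<gamma>\<in>\<Gamma>. \<gamma> facet_of K}. S \<gamma>)"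
    using sub by (intro sum.cong) auto
  also have "\<dots> = (\<Sum>\<gamma>\<in>\<Gamma>. \<Sum>K\<in>{K\<in>\<T>. \<gamma> facet_of K}. S \<gamma>)" by (rule sum.swap_restrict[OF finite_\<T> fin])
  also have "\<dots> \<le> (\<Sum>\<gamma>\<in>\<Gamma>. 2 * S \<gamma>)"
    using card_elements_at_side S0 by (intro sum_mono) (auto intro!: mult_right_mono simp: numeral_le_real_of_nat_iff)
  also have "\<dots> = 2 * (\<Sum>\<gamma>\<in>\<Gamma>. S \<gamma>)" by (simp add: sum_distrib_left)
  also have "(\<Sum>\<gamma>\<in>\<Gamma>. S \<gamma>) = (\<Sum>K'\<in>\<T>. \<Sum>\<gamma>\<in>{\<gamma>\<in>\<Gamma>. \<gamma> facet_of K'}. Q K')"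
    unfolding S_def by (rule sum.swap_restrict[OF fin finite_\<T>])
  also have "\<dots> = (\<Sum>K'\<in>\<T>. real (card {\<gamma>. \<gamma> facet_of K'}) * Q K')"
    using sub by (intro sum.cong) auto
  also have "\<dots> \<le> (\<Sum>K'\<in>\<T>. real (Suc DIM('a)) * Q K')"
    using facets_finite(2) Q by (intro sum_mono mult_right_mono) (auto simp only: of_nat_le_iff)
  also have "\<dots> = real (Suc DIM('a)) * (\<Sum>K\<in>\<T>. Q K)" by (simp add: sum_distrib_left)
  finally show ?thesis by (simp only: S_def mult.assoc)
qed

text \<open>The side estimate leaves the full residual of both neighbours on the right, and the
  interior estimate bounds it once more; this is the factor \<open>C1 + 1\<close> inside the
  constant. The bound \<open>w\<close> is kept abstract so that one proof serves both
  equations.\<close>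

lemma residual_estimate:
  assumes osc: "\<And>K. K \<in> \<T> \<Longrightarrow> \<exists>A k. L2_norm (interior K) (\<lambda>x. r x - (A + k \<bullet> x)) \<le> w K"
  defines "C1 \<equiv> interior_const TYPE('a) \<sigma>" and "C2 \<equiv> side_const TYPE('a) \<sigma> (diameter (closure \<Omega>))"
  shows "(\<Sum>K\<in>\<T>. residual_indicator_sq \<T> r z K) \<le> (C1 + C2 * (2 * real (Suc DIM('a)) * (C1 + 1))) *
     ((\<Sum>K\<in>\<T>. (diameter K)\<^sup>2 * (w K)\<^sup>2) + (diameter (closure \<Omega>))\<^sup>2 * (L2_norm \<Omega> s)\<^sup>2 + (L2_norm \<Omega> G)\<^sup>2)"
proof -
  define D where "D = diameter (closure \<Omega>)"
  have D0: "D \<ge> 0" unfolding D_def by (rule diameter_ge_0[OF bounded_closure[OF bounded_\<Omega>]])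
  have C1: "C1 \<ge> 2" unfolding C1_def by (rule interior_const_pos[OF \<sigma>1])
  have C2: "C2 \<ge> 0" unfolding C2_def by (rule side_const_nonneg[OF \<sigma>1]) (use D0 D_def in simp)
  define P where "P K = (diameter K)\<^sup>2 * (w K)\<^sup>2 + (diameter K)\<^sup>2 * (L2_norm (interior K) s)\<^sup>2 + (L2_norm (interior K) G)\<^sup>2" for K
  have P0: "P K \<ge> 0" for K by (simp add: P_def)
  have rP: "(diameter K)\<^sup>2 * (L2_norm (interior K) r)\<^sup>2 \<le> C1 * P K" if K: "K \<in> \<T>" for K
  proof -
    obtain A k where Ak: "L2_norm (interior K) (\<lambda>x. r x - (A + k \<bullet> x)) \<le> w K" using osc[OF K] by blast
    have "local_data (\<lambda>x. r x - (A + k \<bullet> x)) K \<le> P K"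
      unfolding local_data_def P_def using Ak by (intro add_mono mult_left_mono power_mono L2_norm_nonneg) auto
    then have "C1 * local_data (\<lambda>x. r x - (A + k \<bullet> x)) K \<le> C1 * P K" using C1 by (intro mult_left_mono) auto
    with interior_estimate[OF K, of A k] show ?thesis by (simp add: C1_def)
  qed
  have Q: "local_data r K \<le> (C1 + 1) * P K" if K: "K \<in> \<T>" for K
  proof -
    have "(diameter K)\<^sup>2 * (L2_norm (interior K) s)\<^sup>2 + (L2_norm (interior K) G)\<^sup>2 \<le> P K" by (simp add: P_def)
    then show ?thesis using rP[OF K] by (simp add: local_data_def distrib_right)
  qed
  have jump: "diameter K * jump_norm_sq \<T> z K \<le> C2 * (\<Sum>\<gamma>\<in>{\<gamma>. \<gamma> facet_of K}. \<Sum>K'\<in>{K'\<in>\<T>. \<gamma> facet_of K'}. local_data r K')"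
    if K: "K \<in> \<T>" for K
  proof -
    have "diameter K * jump_norm_sq \<T> z K = (\<Sum>\<gamma>\<in>internal_sides \<T> K. diameter K * ((normal_jump \<T> z \<gamma>)\<^sup>2 * side_area K \<gamma>))"
      by (simp add: jump_norm_sq_def sum_distrib_left)
    also have "\<dots> \<le> (\<Sum>\<gamma>\<in>internal_sides \<T> K. C2 * (\<Sum>K'\<in>{K'\<in>\<T>. \<gamma> facet_of K'}. local_data r K'))"
    proof (rule sum_mono)
      fix \<gamma> assume "\<gamma> \<in> internal_sides \<T> K"
      then obtain K' where K': "\<gamma> facet_of K" "K' \<in> \<T>" "K' \<noteq> K" "\<gamma> facet_of K'" by (auto simp: internal_sides_def)
      have "{K'\<in>\<T>. \<gamma> facet_of K'} = {K, K'}" using elements_at_side[OF K K'(2,1,4)] K'(3) by auto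
      then have "(\<Sum>K'\<in>{K'\<in>\<T>. \<gamma> facet_of K'}. local_data r K') = local_data r K + local_data r K'" using K'(3) by simp
      then show "diameter K * ((normal_jump \<T> z \<gamma>)\<^sup>2 * side_area K \<gamma>) \<le> C2 * (\<Sum>K'\<in>{K'\<in>\<T>. \<gamma> facet_of K'}. local_data r K')"
        using side_estimate[OF K K'(2,1,4)] K'(3) by (simp add: C2_def)
    qed
    also have "\<dots> \<le> (\<Sum>\<gamma>\<in>{\<gamma>. \<gamma> facet_of K}. C2 * (\<Sum>K'\<in>{K'\<in>\<T>. \<gamma> facet_of K'}. local_data r K'))"
      using facets_finite(1)[OF K] C2 local_data_nonneg
      by (intro sum_mono2) (auto simp: internal_sides_def intro!: mult_nonneg_nonneg sum_nonneg)
    finally show ?thesis by (simp add: sum_distrib_left)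
  qed
  have ri: "residual_indicator_sq \<T> r z K \<le> C1 * P K + C2 * (\<Sum>\<gamma>\<in>{\<gamma>. \<gamma> facet_of K}. \<Sum>K'\<in>{K'\<in>\<T>. \<gamma> facet_of K'}. local_data r K')"
    if K: "K \<in> \<T>" for K
    unfolding residual_indicator_sq_def element_L2(3)[OF r_L2 K] by (intro add_mono rP jump K)
  have "(\<Sum>K\<in>\<T>. residual_indicator_sq \<T> r z K)
     \<le> (\<Sum>K\<in>\<T>. C1 * P K + C2 * (\<Sum>\<gamma>\<in>{\<gamma>. \<gamma> facet_of K}. \<Sum>K'\<in>{K'\<in>\<T>. \<gamma> facet_of K'}. local_data r K'))"
    by (intro sum_mono ri)
  also have "\<dots> = C1 * (\<Sum>K\<in>\<T>. P K) + C2 * (\<Sum>K\<in>\<T>. \<Sum>\<gamma>\<in>{\<gamma>. \<gamma> facet_of K}. \<Sum>K'\<in>{K'\<in>\<T>. \<gamma> facet_of K'}. local_data r K')"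
    by (simp add: sum.distrib sum_distrib_left)
  also have "\<dots> \<le> C1 * (\<Sum>K\<in>\<T>. P K) + C2 * (2 * real (Suc DIM('a)) * (\<Sum>K\<in>\<T>. local_data r K))"
    by (intro add_left_mono mult_left_mono sum_sides_le local_data_nonneg C2)
  also have "\<dots> \<le> C1 * (\<Sum>K\<in>\<T>. P K) + C2 * (2 * real (Suc DIM('a)) * (\<Sum>K\<in>\<T>. (C1 + 1) * P K))"
    using C2 by (intro add_left_mono mult_left_mono sum_mono Q) auto
  also have "\<dots> = (C1 + C2 * (2 * real (Suc DIM('a)) * (C1 + 1))) * (\<Sum>K\<in>\<T>. P K)"
    by (simp only: sum_distrib_left[symmetric]) (simp add: algebra_simps)
  also have "\<dots> \<le> (C1 + C2 * (2 * real (Suc DIM('a)) * (C1 + 1))) *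
      ((\<Sum>K\<in>\<T>. (diameter K)\<^sup>2 * (w K)\<^sup>2) + D\<^sup>2 * (L2_norm \<Omega> s)\<^sup>2 + (L2_norm \<Omega> G)\<^sup>2)"
  proof (rule mult_left_mono)
    have "(\<Sum>K\<in>\<T>. (diameter K)\<^sup>2 * (L2_norm (interior K) s)\<^sup>2) \<le> (\<Sum>K\<in>\<T>. D\<^sup>2 * (L2_norm (interior K) s)\<^sup>2)"
      using diameter_le diameter_pos by (intro sum_mono mult_right_mono power_mono) (auto simp: D_def less_imp_le)
    also have "\<dots> \<le> D\<^sup>2 * (L2_norm \<Omega> s)\<^sup>2"
      unfolding sum_distrib_left[symmetric] by (intro mult_left_mono sum_elements_le s_L2) auto
    finally show "(\<Sum>K\<in>\<T>. P K) \<le> (\<Sum>K\<in>\<T>. (diameter K)\<^sup>2 * (w K)\<^sup>2) + D\<^sup>2 * (L2_norm \<Omega> s)\<^sup>2 + (L2_norm \<Omega> G)\<^sup>2"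
      unfolding P_def sum.distrib using sum_elements_le[OF G_L2] by linarith
    show "0 \<le> C1 + C2 * (2 * real (Suc DIM('a)) * (C1 + 1))"
      using C1 C2 by (intro add_nonneg_nonneg mult_nonneg_nonneg) auto
  qed
  finally show ?thesis by (simp add: D_def)
qed

end

section \<open>The optimality system\<close>

text \<open>Two competitors suffice. Adding the sign of \<open>lam\<close> where its modulus exceeds
  1 violates the subgradient inequality unless that set is null; the competitor 0 bounds the
  integral of \<open>\<bar>u x\<bar>\<close> by that of \<open>lam x * u x\<close>, while the
  reverse inequality holds pointwise.\<close>

lemma subgradient_L1_pointwise:
  fixes u lam :: "'a::euclidean_space \<Rightarrow> real"
  assumes S: "S \<in> lmeasurable" and u: "u \<in> L2 S" and lam: "lam \<in> subdifferential S (L2 S) (L1_norm S) u"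
  shows "AE x in lebesgue_on S. \<bar>lam x\<bar> \<le> 1 \<and> lam x * u x = \<bar>u x\<bar>"
proof -
  have lam2: "lam \<in> L2 S" and sub: "\<And>v. v \<in> L2 S \<Longrightarrow> L1_norm S u + L2_inner S lam (\<lambda>x. v x - u x) \<le> L1_norm S v"
    using lam by (auto simp: subdifferential_def)
  have abs_int: "integrable (lebesgue_on S) (\<lambda>x. \<bar>v x\<bar>)" if "v \<in> L2 S" for v :: "'a \<Rightarrow> real"
    using L2_imp_integrable[OF that S] by (rule integrable_abs)
  note [measurable] = L2_D(1)[OF lam2] L2_D(1)[OF u]
  define w where "w x = (if \<bar>lam x\<bar> > 1 then sgn (lam x) else 0)" for x
  have wm: "w \<in> borel_measurable (lebesgue_on S)" unfolding w_def[abs_def] by measurable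
  have w2: "w \<in> L2 S" by (rule L2_bounded(1)[OF wm S, of 1]) (auto simp: w_def abs_sgn_eq)
  have lw: "integrable (lebesgue_on S) (\<lambda>x. lam x * w x)" using L2_inner_integrable(2)[OF lam2 w2] by simp
  have "L1_norm S u + L2_inner S lam (\<lambda>x. (u x + w x) - u x) \<le> L1_norm S (\<lambda>x. u x + w x)"
    by (intro sub L2_add u w2)
  also have "\<dots> \<le> L1_norm S u + L1_norm S w"
  proof -
    have "(LINT x|lebesgue_on S. \<bar>u x + w x\<bar>) \<le> (LINT x|lebesgue_on S. \<bar>u x\<bar> + \<bar>w x\<bar>)"
      by (intro integral_mono abs_int L2_add u w2 Bochner_Integration.integrable_add) auto
    also have "\<dots> = L1_norm S u + L1_norm S w"
      unfolding L1_norm_def by (intro Bochner_Integration.integral_add abs_int u w2)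
    finally show ?thesis by (simp add: L1_norm_def)
  qed
  finally have "(LINT x|lebesgue_on S. lam x * w x - \<bar>w x\<bar>) \<le> 0"
    using lw abs_int[OF w2] by (simp add: L2_inner_def L1_norm_def)
  moreover have nn: "0 \<le> lam x * w x - \<bar>w x\<bar>" for x
    by (auto simp: w_def abs_sgn_eq sgn_if)
  then have "0 \<le> (LINT x|lebesgue_on S. lam x * w x - \<bar>w x\<bar>)" by (intro Bochner_Integration.integral_nonneg)
  ultimately have "(LINT x|lebesgue_on S. lam x * w x - \<bar>w x\<bar>) = 0" by simp
  then have "AE x in lebesgue_on S. lam x * w x - \<bar>w x\<bar> = 0"
    using lw abs_int[OF w2] nn by (subst (asm) integral_nonneg_eq_0_iff_AE) auto
  then have l1: "AE x in lebesgue_on S. \<bar>lam x\<bar> \<le> 1"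
    by eventually_elim (auto simp: w_def sgn_if abs_if split: if_splits)
  have lu: "integrable (lebesgue_on S) (\<lambda>x. lam x * u x)" using L2_inner_integrable(2)[OF lam2 u] by simp
  have "(\<lambda>x. 0) \<in> L2 S" by (simp add: L2_def)
  from sub[OF this] have "(LINT x|lebesgue_on S. \<bar>u x\<bar> - lam x * u x) \<le> 0"
    using lu abs_int[OF u] by (simp add: L2_inner_def L1_norm_def)
  moreover have nn2: "AE x in lebesgue_on S. 0 \<le> \<bar>u x\<bar> - lam x * u x"
    using l1
  proof eventually_elim
    case (elim x)
    have "\<bar>lam x * u x\<bar> \<le> 1 * \<bar>u x\<bar>" unfolding abs_mult using elim by (intro mult_right_mono) auto
    then show ?case by linarith
  qed
  then have "0 \<le> (LINT x|lebesgue_on S. \<bar>u x\<bar> - lam x * u x)" by (rule integral_nonneg_AE)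
  ultimately have "(LINT x|lebesgue_on S. \<bar>u x\<bar> - lam x * u x) = 0" by simp
  then have "AE x in lebesgue_on S. \<bar>u x\<bar> - lam x * u x = 0"
    using lu abs_int[OF u] nn2 by (subst (asm) integral_nonneg_eq_0_iff_AE) auto
  with l1 show ?thesis by eventually_elim auto
qed

text \<open>Test with the pointwise projection of \<open>u - F\<close> onto \<open>[a, b]\<close>.\<close>

lemma variational_inequality_pointwise:
  fixes u F :: "'a::euclidean_space \<Rightarrow> real"
  assumes S: "S \<in> lmeasurable" and ab: "a \<le> b" and u: "u \<in> U_ad S a b" and F: "F \<in> L2 S"
    and vi: "\<And>v. v \<in> U_ad S a b \<Longrightarrow> 0 \<le> L2_inner S F (\<lambda>x. v x - u x)"
  shows "AE x in lebesgue_on S. u x = min b (max a (u x - F x))"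
proof -
  have u2: "u \<in> L2 S" and ub: "AE x in lebesgue_on S. a \<le> u x \<and> u x \<le> b" using u by (auto simp: U_ad_def)
  note [measurable] = L2_D(1)[OF u2] L2_D(1)[OF F]
  define v where "v x = min b (max a (u x - F x))" for x
  have vm: "v \<in> borel_measurable (lebesgue_on S)" unfolding v_def[abs_def] by measurable
  have v2: "v \<in> L2 S" by (rule L2_bounded(1)[OF vm S, of "\<bar>a\<bar> + \<bar>b\<bar>"]) (use ab in \<open>auto simp: v_def\<close>)
  have vU: "v \<in> U_ad S a b" using v2 ab by (auto simp: U_ad_def v_def)
  have vu2: "(\<lambda>x. v x - u x) \<in> L2 S" by (rule L2_diff[OF v2 u2])
  have i1: "integrable (lebesgue_on S) (\<lambda>x. F x * (v x - u x))" using L2_inner_integrable(2)[OF F vu2] by simp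
  have i2: "integrable (lebesgue_on S) (\<lambda>x. (v x - u x)\<^sup>2)" using L2_D(2)[OF vu2] by simp
  have "AE x in lebesgue_on S. F x * (v x - u x) \<le> - ((v x - u x)\<^sup>2)"
    using ub
  proof eventually_elim
    case (elim x)
    \<comment> \<open>The obtuse angle property of the projection onto \<open>[a, b]\<close>,
      applied to the feasible value \<open>u x\<close>; expanding it gives the claimed bound with
      \<open>- ((v x - u x)\<^sup>2)\<close>.\<close>
    have "(v x - (u x - F x)) * (u x - v x) \<ge> 0"
    proof -
      consider "u x - F x < a" "v x = a" | "u x - F x > b" "v x = b" | "v x = u x - F x"
        using ab by (cases "u x - F x < a"; cases "u x - F x > b") (auto simp: v_def min_def max_def)
      then show ?thesis using elim by cases (auto simp: mult_nonneg_nonneg mult_nonpos_nonpos)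
    qed
    then show ?case by (simp add: power2_eq_square algebra_simps)
  qed
  then have "(LINT x|lebesgue_on S. F x * (v x - u x)) \<le> (LINT x|lebesgue_on S. - ((v x - u x)\<^sup>2))"
    using i1 i2 by (intro integral_mono_AE) auto
  then have "(LINT x|lebesgue_on S. (v x - u x)\<^sup>2) \<le> 0"
    using vi[OF vU] by (simp add: L2_inner_def)
  moreover have "0 \<le> (LINT x|lebesgue_on S. (v x - u x)\<^sup>2)" by simp
  ultimately have "(LINT x|lebesgue_on S. (v x - u x)\<^sup>2) = 0" by linarith
  then have "AE x in lebesgue_on S. (v x - u x)\<^sup>2 = 0"
    using i2 by (subst (asm) integral_nonneg_eq_0_iff_AE) auto
  then show ?thesis by eventually_elim (simp add: v_def)
qed

text \<open>The fixed point equation says that \<open>G\<close> vanishes unless a bound is active,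
  and then \<open>G\<close> has the matching sign. Because \<open>a < 0 < b\<close>, an active bound
  determines the sign of \<open>u\<close> and hence \<open>l\<close>; at \<open>u = 0\<close>
  neither bound is active, so \<open>G = 0\<close> yields \<open>l\<close> from
  \<open>p\<close>.\<close>

lemma projection_formulas:
  fixes u l p \<alpha> \<beta> a b :: real
  assumes "\<alpha> > 0" "\<beta> > 0" "a < 0" "0 < b" "a \<le> u" "u \<le> b" "\<bar>l\<bar> \<le> 1" "l * u = \<bar>u\<bar>"
    and fix_eq: "u = min b (max a (u - (p + \<alpha> * u + \<beta> * l)))"
  shows "l = min 1 (max (-1) (- (1/\<beta>) * p))" "u = min b (max a (- (1/\<alpha>) * (p + \<beta> * l)))"
proof -
  define G where "G = p + \<alpha> * u + \<beta> * l"
  have cases: "G = 0 \<or> (u = a \<and> G \<ge> 0) \<or> (u = b \<and> G \<le> 0)"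
    using fix_eq assms(3,4) unfolding G_def[symmetric] by (auto simp: min_def max_def split: if_splits)
  have "- (1/\<alpha>) * (p + \<beta> * l) = u - G / \<alpha>" using assms(1) by (simp add: G_def field_simps)
  moreover have "u = min b (max a (u - G / \<alpha>))"
  proof -
    have "G / \<alpha> = 0 \<or> (u = a \<and> G / \<alpha> \<ge> 0) \<or> (u = b \<and> G / \<alpha> \<le> 0)"
      using cases assms(1) by (auto simp: divide_nonpos_pos)
    then show ?thesis using assms(3-6) by (auto simp: min_def max_def)
  qed
  ultimately show "u = min b (max a (- (1/\<alpha>) * (p + \<beta> * l)))" by simp
  consider "u > 0" | "u < 0" | "u = 0" by linarith
  then show "l = min 1 (max (-1) (- (1/\<beta>) * p))"
  proof cases
    case 1
    then have l: "l = 1" using assms(8) by simp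
    have "G \<le> 0" using cases 1 assms(3) by auto
    moreover have "\<alpha> * u > 0" using 1 assms(1) by simp
    ultimately have "p \<le> - \<beta>" using l by (simp add: G_def)
    then have "- (1/\<beta>) * p \<ge> 1" using assms(2) by (simp add: field_simps)
    then show ?thesis using l by simp
  next
    case 2
    then have l: "l = -1" using assms(8) by (simp add: abs_if) (metis less_irrefl mult_minus_left mult_right_cancel mult_1)
    have "G \<ge> 0" using cases 2 assms(4) by auto
    moreover have "\<alpha> * u < 0" using 2 assms(1) by (simp add: mult_pos_neg)
    ultimately have "p \<ge> \<beta>" using l by (simp add: G_def)
    then have "- (1/\<beta>) * p \<le> -1" using assms(2) by (simp add: field_simps)
    then show ?thesis using l by simp
  next
    case 3
    then have "G = 0" using cases assms(3,4) by auto
    then have "- (1/\<beta>) * p = l" using 3 assms(2) by (simp add: G_def field_simps)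
    then show ?thesis using assms(7) by (auto simp: abs_le_iff)
  qed
qed

lemma clip_nonexpansive: "\<bar>min t (max s x) - min t (max s y)\<bar> \<le> \<bar>x - (y::real)\<bar>"
  by (auto simp: min_def max_def)

text \<open>\<open>u\<close> and \<open>l\<close> are the same clips of \<open>p\<close> that
  \<open>u_tilde\<close> and \<open>lambda_tilde\<close> are of \<open>q\<close>, and clipping is
  nonexpansive. The 2 in \<open>2/\<alpha>\<close> counts \<open>p - q\<close> once directly and
  once through the multiplier, whose difference times \<open>\<beta>\<close> is again at most
  \<open>\<bar>p x - q x\<bar>\<close>.\<close>

lemma optimal_pointwise_bounds:
  fixes u l p :: "'a::euclidean_space \<Rightarrow> real"
  assumes \<Omega>: "\<Omega> \<in> lmeasurable" and c: "\<alpha> > 0" "\<beta> > 0" "a < 0" "0 < b"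
    and opt: "optimal \<Omega> \<alpha> \<beta> a b f y\<^sub>\<Omega> y p u l"
  shows "AE x in lebesgue_on \<Omega>. \<bar>lambda_tilde \<beta> q x - l x\<bar> \<le> 1/\<beta> * \<bar>p x - q x\<bar> \<and>
     \<bar>u_tilde \<alpha> \<beta> a b q x - u x\<bar> \<le> 2/\<alpha> * \<bar>p x - q x\<bar>"
proof -
  have U: "u \<in> U_ad \<Omega> a b" and u2: "u \<in> L2 \<Omega>" and ub: "AE x in lebesgue_on \<Omega>. a \<le> u x \<and> u x \<le> b"
    and l: "l \<in> subdifferential \<Omega> (L2 \<Omega>) (L1_norm \<Omega>) u" and l2: "l \<in> L2 \<Omega>" and p2: "p \<in> L2 \<Omega>"
    using opt by (auto simp: optimal_def U_ad_def subdifferential_def H10_def H1_def)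
  have "(\<lambda>x. p x + \<alpha> *\<^sub>R u x + \<beta> *\<^sub>R l x) \<in> L2 \<Omega>" by (intro L2_add L2_scaleR p2 u2 l2)
  then have F: "(\<lambda>x. p x + \<alpha> * u x + \<beta> * l x) \<in> L2 \<Omega>" by simp
  have "AE x in lebesgue_on \<Omega>. u x = min b (max a (u x - (p x + \<alpha> * u x + \<beta> * l x)))"
    by (rule variational_inequality_pointwise[OF \<Omega> _ U F]) (use c opt in \<open>auto simp: optimal_def\<close>)
  with ub subgradient_L1_pointwise[OF \<Omega> u2 l] show ?thesis
  proof eventually_elim
    case (elim x)
    note proj = projection_formulas[OF c, of "u x" "l x" "p x"]
    have l: "l x = min 1 (max (-1) (- (1/\<beta>) * p x))" and u: "u x = min b (max a (- (1/\<alpha>) * (p x + \<beta> * l x)))"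
      using proj elim by blast+
    have "\<bar>lambda_tilde \<beta> q x - l x\<bar> \<le> \<bar>(- (1/\<beta>) * q x) - (- (1/\<beta>) * p x)\<bar>"
      unfolding lambda_tilde_def clip_def by (subst l) (rule clip_nonexpansive)
    also have "\<dots> = \<bar>(1/\<beta>) * (p x - q x)\<bar>" by (simp add: algebra_simps)
    also have "\<dots> = 1/\<beta> * \<bar>p x - q x\<bar>" using c(2) by (simp add: abs_mult)
    finally have 1: "\<bar>lambda_tilde \<beta> q x - l x\<bar> \<le> 1/\<beta> * \<bar>p x - q x\<bar>" .
    then have 2: "\<beta> * \<bar>lambda_tilde \<beta> q x - l x\<bar> \<le> \<bar>p x - q x\<bar>" using c(2) by (simp add: field_simps)
    have "\<bar>u_tilde \<alpha> \<beta> a b q x - u x\<bar> \<le> \<bar>(- (1/\<alpha>) * (q x + \<beta> * lambda_tilde \<beta> q x)) - (- (1/\<alpha>) * (p x + \<beta> * l x))\<bar>"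
      unfolding u_tilde_def clip_def by (subst u) (rule clip_nonexpansive)
    also have "\<dots> = \<bar>(1/\<alpha>) * ((p x - q x) - \<beta> * (lambda_tilde \<beta> q x - l x))\<bar>" by (simp add: algebra_simps)
    also have "\<dots> = 1/\<alpha> * \<bar>(p x - q x) - \<beta> * (lambda_tilde \<beta> q x - l x)\<bar>" using c(1) by (simp add: abs_mult)
    also have "\<dots> \<le> 1/\<alpha> * (\<bar>p x - q x\<bar> + \<beta> * \<bar>lambda_tilde \<beta> q x - l x\<bar>)"
    proof (rule mult_left_mono)
      have "\<bar>\<beta> * (lambda_tilde \<beta> q x - l x)\<bar> = \<beta> * \<bar>lambda_tilde \<beta> q x - l x\<bar>" using c(2) by (simp add: abs_mult)
      then show "\<bar>(p x - q x) - \<beta> * (lambda_tilde \<beta> q x - l x)\<bar> \<le> \<bar>p x - q x\<bar> + \<beta> * \<bar>lambda_tilde \<beta> q x - l x\<bar>" by linarith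
    qed (use c(1) in simp)
    also have "\<dots> \<le> 1/\<alpha> * (2 * \<bar>p x - q x\<bar>)" using 2 c(1) by (intro mult_left_mono) auto
    finally show ?case using 1 by simp
  qed
qed

section \<open>Efficiency of the estimator\<close>

lemma pw_const_L2: "u \<in> pw_const \<Omega> \<T> \<Longrightarrow> u \<in> L2 \<Omega>"
  by (simp add: pw_const_def)

lemma L2_norm_minus_commute:
  fixes f g :: "'a::euclidean_space \<Rightarrow> 'b::euclidean_space"
  shows "L2_norm S (\<lambda>x. f x - g x) = L2_norm S (\<lambda>x. g x - f x)"
  by (simp add: L2_norm_def norm_minus_commute)

lemma L2_inner_commute: "L2_inner S f g = L2_inner S g f"
  by (simp add: L2_inner_def inner_commute)

section \<open>Residual equations and data oscillation\<close>

context fe_mesh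
begin

lemma L2_inner_weak_grad_test:
  assumes "v \<in> H1 \<Omega>" "\<phi> \<in> test_functions \<Omega>"
  shows "L2_inner \<Omega> (weak_grad \<Omega> v) (weak_grad \<Omega> \<phi>) = L2_inner \<Omega> (weak_grad \<Omega> v) (classical_grad \<phi>)"
proof -
  note t = test_function_weak_grad[OF open_\<Omega> bounded_\<Omega> assms(2)]
  note m = L2_D(1)[OF H1_D(2)[OF assms(1)]] L2_D(1)[OF H1_D(2)[OF t(1)]] L2_D(1)[OF test_function_L2(2)[OF assms(2) \<Omega>_lmeasurable]]
  show ?thesis
    unfolding L2_inner_def
  proof (rule integral_cong_AE)
    show "AE x in lebesgue_on \<Omega>. weak_grad \<Omega> v x \<bullet> weak_grad \<Omega> \<phi> x = weak_grad \<Omega> v x \<bullet> classical_grad \<phi> x"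
      using t(2) by eventually_elim simp
  qed (intro borel_measurable_inner m)+
qed

lemma residualI:
  assumes v: "v \<in> H1 \<Omega>" and z: "z \<in> fe_space \<Omega> \<T>" and s: "s \<in> L2 \<Omega>" and r: "r \<in> L2 \<Omega>"
    and eq: "\<And>\<phi>. \<phi> \<in> H10 \<Omega> \<Longrightarrow> L2_inner \<Omega> (weak_grad \<Omega> v) (weak_grad \<Omega> \<phi>) = L2_inner \<Omega> (\<lambda>x. s x + r x) \<phi>"
  shows "fe_residual \<Omega> \<T> \<sigma> z s r (\<lambda>x. weak_grad \<Omega> v x - pw_grad z x)"
proof unfold_locales
  show "(\<lambda>x. weak_grad \<Omega> v x - pw_grad z x) \<in> L2 \<Omega>" by (intro L2_diff H1_D(2)[OF v] fe_weak_grad(2)[OF z])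
  fix \<phi> assume \<phi>: "\<phi> \<in> test_functions \<Omega>"
  have "L2_inner \<Omega> (\<lambda>x. weak_grad \<Omega> v x - pw_grad z x) (classical_grad \<phi>)
      = L2_inner \<Omega> (weak_grad \<Omega> v) (classical_grad \<phi>) - L2_inner \<Omega> (pw_grad z) (classical_grad \<phi>)"
    by (intro L2_inner_diff_left H1_D(2)[OF v] fe_weak_grad(2)[OF z] test_function_L2(2)[OF \<phi> \<Omega>_lmeasurable])
  also have "L2_inner \<Omega> (weak_grad \<Omega> v) (classical_grad \<phi>) = L2_inner \<Omega> (\<lambda>x. s x + r x) \<phi>"
    using eq[OF test_function_H10[OF open_\<Omega> bounded_\<Omega> \<phi>]] L2_inner_weak_grad_test[OF v \<phi>] by simp
  finally show "L2_inner \<Omega> (\<lambda>x. weak_grad \<Omega> v x - pw_grad z x) (classical_grad \<phi>)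
      = L2_inner \<Omega> (\<lambda>x. s x + r x) \<phi> - L2_inner \<Omega> (pw_grad z) (classical_grad \<phi>)" .
qed (use z s r in auto)

lemma proj_affine:
  assumes K: "K \<in> \<T>" and g: "g \<in> L2 \<Omega>" and l: "l = 0 \<or> l = 1"
  obtains A k where "\<And>x. L2_proj K l g x = A + k \<bullet> x" "(\<lambda>x. g x - L2_proj K l g x) \<in> L2 \<Omega>"
proof -
  obtain c r where c: "r > 0" "cball c r \<subseteq> K" using shape[OF K] by blast
  obtain A k where Ak: "\<And>x. L2_proj K l g x = A + k \<bullet> x"
    using L2_proj_affine[OF element_props(6)[OF K] element_props(7)[OF K] c(2,1) element_L2(2)[OF g K] l] by blast
  have "(\<lambda>x. g x - (A + k \<bullet> x)) \<in> L2 \<Omega>" by (intro L2_diff g affine_L2[OF bounded_\<Omega> \<Omega>_lmeasurable])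
  then show thesis using that[of A k] Ak by simp
qed

lemma osc_sq: "(osc l 0 g \<T>)\<^sup>2 = (\<Sum>K\<in>\<T>. (diameter K)\<^sup>2 * (L2_norm K (\<lambda>x. g x - L2_proj K l g x))\<^sup>2)"
  unfolding osc_def by (subst real_sqrt_pow2) (auto intro!: sum_nonneg)

lemma osc_nonneg: "osc l 0 g \<T> \<ge> 0"
  unfolding osc_def by (intro real_sqrt_ge_zero sum_nonneg) auto

text \<open>A piecewise constant control is absorbed exactly by the constant term of the affine
  comparison function, so only the oscillation of \<open>g\<close> remains.\<close>

lemma state_data_oscillation:
  assumes K: "K \<in> \<T>" and u: "u \<in> pw_const \<Omega> \<T>" and g: "g \<in> L2 \<Omega>" and l: "l = 0 \<or> l = 1"
  shows "\<exists>A k. L2_norm (interior K) (\<lambda>x. (u x + g x) - (A + k \<bullet> x)) \<le> L2_norm K (\<lambda>x. g x - L2_proj K l g x)"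
proof -
  obtain A k where Ak: "\<And>x. L2_proj K l g x = A + k \<bullet> x" "(\<lambda>x. g x - L2_proj K l g x) \<in> L2 \<Omega>" using proj_affine[OF K g l] by blast
  obtain c where c: "AE x in lebesgue_on K. u x = c" using u K by (auto simp: pw_const_def Poly01_def)
  have AE: "AE x in lebesgue_on (interior K). u x = c"
    using c element_props(8)[OF K] interior_subset[of K] by (simp add: AE_restrict_space_iff) (auto elim!: eventually_mono)
  have u2: "u \<in> L2 \<Omega>" using u by (rule pw_const_L2)
  have iO: "interior K \<in> lmeasurable"
    using element_props(6)[OF K] by (intro open_bounded_lmeasurable bounded_interior) auto
  have m1: "(\<lambda>x. (u x + g x) - ((c + A) + k \<bullet> x)) \<in> borel_measurable (lebesgue_on (interior K))"
    by (rule L2_D(1)[OF element_L2(1)[OF _ K]]) (intro L2_diff L2_add u2 g affine_L2[OF bounded_\<Omega> \<Omega>_lmeasurable])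
  have "L2_norm (interior K) (\<lambda>x. (u x + g x) - ((c + A) + k \<bullet> x)) = L2_norm (interior K) (\<lambda>x. g x - L2_proj K l g x)"
  proof (rule L2_norm_cong_AE[OF _ m1 L2_D(1)[OF element_L2(1)[OF Ak(2) K]]])
    show "AE x in lebesgue_on (interior K). (u x + g x) - ((c + A) + k \<bullet> x) = g x - L2_proj K l g x"
      using AE by eventually_elim (simp add: Ak(1))
  qed
  also have "\<dots> = L2_norm K (\<lambda>x. g x - L2_proj K l g x)" using element_L2(3)[OF Ak(2) K] by simp
  finally show ?thesis by (intro exI[of _ "c + A"] exI[of _ k]) simp
qed

text \<open>The comparison function may be affine for either degree \<open>l\<close>, so the affine
  \<open>z\<close> is subtracted exactly and only the oscillation of \<open>g\<close> remains even
  when \<open>l = 0\<close>.\<close>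

lemma adjoint_data_oscillation:
  assumes K: "K \<in> \<T>" and z: "z \<in> fe_space \<Omega> \<T>" and g: "g \<in> L2 \<Omega>" and l: "l = 0 \<or> l = 1"
  shows "\<exists>A k. L2_norm (interior K) (\<lambda>x. (z x - g x) - (A + k \<bullet> x)) \<le> L2_norm K (\<lambda>x. g x - L2_proj K l g x)"
proof -
  obtain A k where Ak: "\<And>x. L2_proj K l g x = A + k \<bullet> x" "(\<lambda>x. g x - L2_proj K l g x) \<in> L2 \<Omega>" using proj_affine[OF K g l] by blast
  obtain c where c: "\<And>x. x \<in> K \<Longrightarrow> z x = c + elem_grad K z \<bullet> x" using fe_affine[OF z K] by blast
  have "L2_norm (interior K) (\<lambda>x. (z x - g x) - ((c - A) + (elem_grad K z - k) \<bullet> x))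
      = L2_norm (interior K) (\<lambda>x. L2_proj K l g x - g x)"
  proof (rule L2_cong(2))
    fix x assume "x \<in> interior K"
    then have "z x = c + elem_grad K z \<bullet> x" using interior_subset by (intro c) blast
    then show "(z x - g x) - ((c - A) + (elem_grad K z - k) \<bullet> x) = L2_proj K l g x - g x"
      by (simp add: Ak(1) inner_diff_left)
  qed
  also have "\<dots> = L2_norm (interior K) (\<lambda>x. g x - L2_proj K l g x)" by (rule L2_norm_minus_commute)
  also have "\<dots> = L2_norm K (\<lambda>x. g x - L2_proj K l g x)" using element_L2(3)[OF Ak(2) K] by simp
  finally show ?thesis by (intro exI[of _ "c - A"] exI[of _ "elem_grad K z - k"]) simp
qed

text \<open>Triangle inequality through the continuous quantity \<open>w\<close>: in the
  applications \<open>e\<close> is the adjoint error, and \<open>w - q\<close> is part of the total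
  error.\<close>

lemma projection_indicator_bound:
  assumes q: "q \<in> L2 \<Omega>" "w \<in> L2 \<Omega>" "e \<in> L2 \<Omega>" "v \<in> borel_measurable (lebesgue_on \<Omega>)" and C: "C \<ge> 0"
    and bd: "AE x in lebesgue_on \<Omega>. \<bar>v x - w x\<bar> \<le> C * \<bar>e x\<bar>"
  shows "(\<Sum>K\<in>\<T>. (L2_norm K (\<lambda>x. v x - q x))\<^sup>2) \<le> 2 * (C * L2_norm \<Omega> e)\<^sup>2 + 2 * (L2_norm \<Omega> (\<lambda>x. w x - q x))\<^sup>2"
proof -
  have Ce: "(\<lambda>x. C *\<^sub>R e x) \<in> L2 \<Omega>" by (rule L2_scaleR[OF q(3)])
  have bd': "AE x in lebesgue_on \<Omega>. norm (v x - w x) \<le> norm (C *\<^sub>R e x)"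
    using bd by eventually_elim (use C in \<open>simp add: abs_mult\<close>)
  have m: "(\<lambda>x. v x - w x) \<in> borel_measurable (lebesgue_on \<Omega>)"
    by (intro borel_measurable_diff q(4) L2_D(1)[OF q(2)])
  note vw = L2_bound[OF Ce m bd']
  have vw2: "L2_norm \<Omega> (\<lambda>x. v x - w x) \<le> C * L2_norm \<Omega> e"
    using vw(2) C by (simp add: L2_norm_scaleR[of \<Omega> C e, simplified])
  have wq: "(\<lambda>x. w x - q x) \<in> L2 \<Omega>" by (rule L2_diff[OF q(2,1)])
  have "(\<lambda>x. (v x - w x) + (w x - q x)) \<in> L2 \<Omega>" by (rule L2_add[OF vw(1) wq])
  then have vq: "(\<lambda>x. v x - q x) \<in> L2 \<Omega>" by simp
  have "(\<Sum>K\<in>\<T>. (L2_norm K (\<lambda>x. v x - q x))\<^sup>2) = (\<Sum>K\<in>\<T>. (L2_norm (interior K) (\<lambda>x. v x - q x))\<^sup>2)"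
    using element_L2(3)[OF vq] by simp
  also have "\<dots> \<le> (L2_norm \<Omega> (\<lambda>x. v x - q x))\<^sup>2" by (rule sum_elements_le[OF vq])
  also have "\<dots> \<le> (C * L2_norm \<Omega> e + L2_norm \<Omega> (\<lambda>x. w x - q x))\<^sup>2"
  proof (intro power_mono L2_norm_nonneg)
    have "L2_norm \<Omega> (\<lambda>x. v x - q x) = L2_norm \<Omega> (\<lambda>x. (v x - w x) + (w x - q x))" by simp
    also have "\<dots> \<le> L2_norm \<Omega> (\<lambda>x. v x - w x) + L2_norm \<Omega> (\<lambda>x. w x - q x)"
      by (rule L2_triangle[OF vw(1) wq])
    finally show "L2_norm \<Omega> (\<lambda>x. v x - q x) \<le> C * L2_norm \<Omega> e + L2_norm \<Omega> (\<lambda>x. w x - q x)" using vw2 by simp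
  qed
  also have "\<dots> \<le> 2 * (C * L2_norm \<Omega> e)\<^sup>2 + 2 * (L2_norm \<Omega> (\<lambda>x. w x - q x))\<^sup>2"
    using sum_squares_bound[of "C * L2_norm \<Omega> e" "L2_norm \<Omega> (\<lambda>x. w x - q x)"] by (simp add: power2_sum)
  finally show ?thesis .
qed

end

section \<open>Assembly of the efficiency bound\<close>

definition residual_const :: "'a::euclidean_space itself \<Rightarrow> real \<Rightarrow> real \<Rightarrow> real" where
  "residual_const T \<sigma> D = interior_const T \<sigma> + side_const T \<sigma> D * (2 * real (Suc DIM('a)) * (interior_const T \<sigma> + 1))"

text \<open>The Poincare factor \<open>P\<close> enters where an error is needed in the norm of
  \<open>L2\<close>: for the state in the adjoint residual, and for the adjoint state in the two
  projection indicators.\<close>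

lemma estimator_bound:
  fixes \<Omega> :: "'a::euclidean_space set"
  assumes fe: "fe_mesh \<Omega> \<T> \<sigma>" and R: "\<Omega> \<subseteq> ball 0 R" "R > 0"
    and c: "\<alpha> > 0" "\<beta> > 0" "a < 0" "0 < b" and C: "C1 > 0" "C2 > 0" "C3 > 0" "C4 > 0" and l: "l = 0 \<or> l = 1"
    and f: "f \<in> L2 \<Omega>" "y\<^sub>\<Omega> \<in> L2 \<Omega>"
    and opt: "optimal \<Omega> \<alpha> \<beta> a b f y\<^sub>\<Omega> y p u lam" and dopt: "discrete_optimal \<Omega> \<T> \<alpha> \<beta> a b f y\<^sub>\<Omega> yT pT uT lamT"
  defines "D \<equiv> diameter (closure \<Omega>)" and "P \<equiv> 2 * (R + 1)"
  defines "E \<equiv> residual_const TYPE('a) \<sigma> D"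
  shows "estimator \<T> C1 C2 C3 C4 \<alpha> \<beta> a b f y\<^sub>\<Omega> yT pT uT lamT
    \<le> sqrt (C1 * E * (1 + D\<^sup>2) + C2 * E * (1 + D\<^sup>2 * P\<^sup>2) + C3 * (2 * (2/\<alpha> * P)\<^sup>2 + 2) + C4 * (2 * (1/\<beta> * P)\<^sup>2 + 2))
      * (total_error \<Omega> y p u lam yT pT uT lamT + osc l 0 f \<T> + osc l 0 y\<^sub>\<Omega> \<T>)"
proof -
  interpret fe_mesh \<Omega> \<T> \<sigma> by (rule fe)
  have o: "y \<in> H10 \<Omega>" "p \<in> H10 \<Omega>" "u \<in> U_ad \<Omega> a b" "lam \<in> L2 \<Omega>"
    "\<And>v. v \<in> H10 \<Omega> \<Longrightarrow> L2_inner \<Omega> (weak_grad \<Omega> y) (weak_grad \<Omega> v) = L2_inner \<Omega> (\<lambda>x. u x + f x) v"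
    "\<And>w. w \<in> H10 \<Omega> \<Longrightarrow> L2_inner \<Omega> (weak_grad \<Omega> w) (weak_grad \<Omega> p) = L2_inner \<Omega> (\<lambda>x. y x - y\<^sub>\<Omega> x) w"
    using opt by (auto simp: optimal_def subdifferential_def)
  have d: "yT \<in> fe_space \<Omega> \<T>" "pT \<in> fe_space \<Omega> \<T>" "uT \<in> pw_const \<Omega> \<T>" "lamT \<in> pw_const \<Omega> \<T>"
    using dopt by (auto simp: discrete_optimal_def subdifferential_def)
  have H: "y \<in> H1 \<Omega>" "p \<in> H1 \<Omega>" using o by (auto simp: H10_def)
  have L: "y \<in> L2 \<Omega>" "p \<in> L2 \<Omega>" "u \<in> L2 \<Omega>" "yT \<in> L2 \<Omega>" "pT \<in> L2 \<Omega>" "uT \<in> L2 \<Omega>" "lamT \<in> L2 \<Omega>"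
    using H o(3) d fe_weak_grad(1) by (auto simp: H1_def U_ad_def pw_const_def)
  define Ey where "Ey = H1_seminorm \<Omega> (\<lambda>x. y x - yT x)"
  define Ep where "Ep = H1_seminorm \<Omega> (\<lambda>x. p x - pT x)"
  define Eu where "Eu = L2_norm \<Omega> (\<lambda>x. u x - uT x)"
  define El where "El = L2_norm \<Omega> (\<lambda>x. lam x - lamT x)"
  define Of where "Of = osc l 0 f \<T>"
  define Oy where "Oy = osc l 0 y\<^sub>\<Omega> \<T>"
  define S where "S = Ey\<^sup>2 + Ep\<^sup>2 + Eu\<^sup>2 + El\<^sup>2 + Of\<^sup>2 + Oy\<^sup>2"
  have D0: "D \<ge> 0" unfolding D_def by (rule diameter_ge_0[OF bounded_closure[OF bounded_\<Omega>]])
  have P0: "P \<ge> 0" using R(2) by (simp add: P_def)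
  have E0: "E \<ge> 0"
    unfolding E_def residual_const_def using interior_const_pos[OF \<sigma>1, where 'a='a] side_const_nonneg[OF \<sigma>1 D0, where 'a='a]
    by (intro add_nonneg_nonneg mult_nonneg_nonneg) auto
  have py: "L2_norm \<Omega> (\<lambda>x. y x - yT x) \<le> P * Ey" unfolding P_def Ey_def by (rule Poincare_fe[OF o(1) d(1) R])
  have pp: "L2_norm \<Omega> (\<lambda>x. p x - pT x) \<le> P * Ep" unfolding P_def Ep_def by (rule Poincare_fe[OF o(2) d(2) R])
  \<comment> \<open>The source error here is the control error, itself a part of the total error, so
    this residual needs no Poincare factor.\<close>
  interpret st: fe_residual \<Omega> \<T> \<sigma> yT "\<lambda>x. u x - uT x" "\<lambda>x. uT x + f x" "\<lambda>x. weak_grad \<Omega> y x - pw_grad yT x"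
    by (rule residualI[OF H(1) d(1)]) (use o(5) in \<open>auto intro!: L2_diff L2_add L f\<close>)
  interpret ad: fe_residual \<Omega> \<T> \<sigma> pT "\<lambda>x. y x - yT x" "\<lambda>x. yT x - y\<^sub>\<Omega> x" "\<lambda>x. weak_grad \<Omega> p x - pw_grad pT x"
    by (rule residualI[OF H(2) d(2)]) (use o(6) L2_inner_commute[of \<Omega> "weak_grad \<Omega> p"] in \<open>auto intro!: L2_diff L f\<close>)
  have st: "(\<Sum>K\<in>\<T>. residual_indicator_sq \<T> (\<lambda>x. uT x + f x) yT K) \<le> E * (Of\<^sup>2 + D\<^sup>2 * Eu\<^sup>2 + Ey\<^sup>2)"
    unfolding E_def residual_const_def D_def Of_def osc_sq Eu_def Ey_def H1_seminorm_fe[OF H(1) d(1)]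
    by (rule st.residual_estimate) (rule state_data_oscillation[OF _ d(3) f(1) l])
  have ad: "(\<Sum>K\<in>\<T>. residual_indicator_sq \<T> (\<lambda>x. yT x - y\<^sub>\<Omega> x) pT K)
      \<le> E * (Oy\<^sup>2 + D\<^sup>2 * (L2_norm \<Omega> (\<lambda>x. y x - yT x))\<^sup>2 + Ep\<^sup>2)"
    unfolding E_def residual_const_def D_def Oy_def osc_sq Ep_def H1_seminorm_fe[OF H(2) d(2)]
    by (rule ad.residual_estimate) (rule adjoint_data_oscillation[OF _ d(1) f(2) l])
  note pw = optimal_pointwise_bounds[OF \<Omega>_lmeasurable c opt, of pT]
  have pm: "pT \<in> borel_measurable (lebesgue_on \<Omega>)" by (rule L2_D(1)[OF L(5)])
  have lm: "lambda_tilde \<beta> pT \<in> borel_measurable (lebesgue_on \<Omega>)"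
    unfolding lambda_tilde_def clip_def[abs_def] using pm by measurable
  have um: "u_tilde \<alpha> \<beta> a b pT \<in> borel_measurable (lebesgue_on \<Omega>)"
    unfolding u_tilde_def clip_def[abs_def] using pm lm by measurable
  have pL: "(\<lambda>x. p x - pT x) \<in> L2 \<Omega>" by (intro L2_diff L)
  have ct: "(\<Sum>K\<in>\<T>. (L2_norm K (\<lambda>x. u_tilde \<alpha> \<beta> a b pT x - uT x))\<^sup>2)
      \<le> 2 * (2/\<alpha> * L2_norm \<Omega> (\<lambda>x. p x - pT x))\<^sup>2 + 2 * Eu\<^sup>2"
    unfolding Eu_def
    by (rule projection_indicator_bound[OF L(6,3) pL um]) (use c pw in \<open>auto elim: eventually_mono\<close>)
  have sg: "(\<Sum>K\<in>\<T>. (L2_norm K (\<lambda>x. lambda_tilde \<beta> pT x - lamT x))\<^sup>2)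
      \<le> 2 * (1/\<beta> * L2_norm \<Omega> (\<lambda>x. p x - pT x))\<^sup>2 + 2 * El\<^sup>2"
    unfolding El_def
    by (rule projection_indicator_bound[OF L(7) o(4) pL lm]) (use c pw in \<open>auto elim: eventually_mono\<close>)
  have Sle: "Ey\<^sup>2 \<le> S" "Ep\<^sup>2 \<le> S" "Of\<^sup>2 + Ey\<^sup>2 \<le> S" "Oy\<^sup>2 + Ep\<^sup>2 \<le> S" "Eu\<^sup>2 \<le> S" "El\<^sup>2 \<le> S" by (auto simp: S_def)
  have S0: "S \<ge> 0" by (simp add: S_def)
  have b1: "Of\<^sup>2 + D\<^sup>2 * Eu\<^sup>2 + Ey\<^sup>2 \<le> (1 + D\<^sup>2) * S"
    using mult_left_mono[OF Sle(5), of "D\<^sup>2"] Sle(3) by (simp add: distrib_right)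
  have y2: "(L2_norm \<Omega> (\<lambda>x. y x - yT x))\<^sup>2 \<le> P\<^sup>2 * S"
  proof -
    have "(L2_norm \<Omega> (\<lambda>x. y x - yT x))\<^sup>2 \<le> (P * Ey)\<^sup>2" by (intro power_mono py L2_norm_nonneg)
    also have "\<dots> \<le> P\<^sup>2 * S" unfolding power_mult_distrib by (intro mult_left_mono Sle) auto
    finally show ?thesis .
  qed
  have b2: "Oy\<^sup>2 + D\<^sup>2 * (L2_norm \<Omega> (\<lambda>x. y x - yT x))\<^sup>2 + Ep\<^sup>2 \<le> (1 + D\<^sup>2 * P\<^sup>2) * S"
    using mult_left_mono[OF y2, of "D\<^sup>2"] Sle(4) by (simp add: distrib_right mult.assoc)
  have p2: "2 * (k * L2_norm \<Omega> (\<lambda>x. p x - pT x))\<^sup>2 + 2 * e \<le> (2 * (k * P)\<^sup>2 + 2) * S" if "e \<le> S" for k e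
  proof -
    have "(L2_norm \<Omega> (\<lambda>x. p x - pT x))\<^sup>2 \<le> (P * Ep)\<^sup>2" by (intro power_mono pp L2_norm_nonneg)
    also have "\<dots> \<le> P\<^sup>2 * S" unfolding power_mult_distrib by (intro mult_left_mono Sle) auto
    finally have "k\<^sup>2 * (L2_norm \<Omega> (\<lambda>x. p x - pT x))\<^sup>2 \<le> k\<^sup>2 * (P\<^sup>2 * S)" by (intro mult_left_mono) auto
    then show ?thesis using that by (simp add: power_mult_distrib distrib_right mult.assoc)
  qed
  define CC where "CC = C1 * E * (1 + D\<^sup>2) + C2 * E * (1 + D\<^sup>2 * P\<^sup>2) + C3 * (2 * (2/\<alpha> * P)\<^sup>2 + 2) + C4 * (2 * (1/\<beta> * P)\<^sup>2 + 2)"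
  define X where "X = (\<Sum>K\<in>\<T>.
       C1 * residual_indicator_sq \<T> (\<lambda>x. uT x + f x) yT K +
       C2 * residual_indicator_sq \<T> (\<lambda>x. yT x - y\<^sub>\<Omega> x) pT K +
       C3 * (L2_norm K (\<lambda>x. u_tilde \<alpha> \<beta> a b pT x - uT x))\<^sup>2 +
       C4 * (L2_norm K (\<lambda>x. lambda_tilde \<beta> pT x - lamT x))\<^sup>2)"
  have "X = C1 * (\<Sum>K\<in>\<T>. residual_indicator_sq \<T> (\<lambda>x. uT x + f x) yT K)
      + C2 * (\<Sum>K\<in>\<T>. residual_indicator_sq \<T> (\<lambda>x. yT x - y\<^sub>\<Omega> x) pT K)
      + C3 * (\<Sum>K\<in>\<T>. (L2_norm K (\<lambda>x. u_tilde \<alpha> \<beta> a b pT x - uT x))\<^sup>2)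
      + C4 * (\<Sum>K\<in>\<T>. (L2_norm K (\<lambda>x. lambda_tilde \<beta> pT x - lamT x))\<^sup>2)"
    by (simp add: X_def sum.distrib sum_distrib_left)
  also have "\<dots> \<le> C1 * (E * ((1 + D\<^sup>2) * S)) + C2 * (E * ((1 + D\<^sup>2 * P\<^sup>2) * S))
      + C3 * ((2 * (2/\<alpha> * P)\<^sup>2 + 2) * S) + C4 * ((2 * (1/\<beta> * P)\<^sup>2 + 2) * S)"
    using C E0 by (intro add_mono mult_left_mono order_trans[OF st] order_trans[OF ad] order_trans[OF ct p2] order_trans[OF sg p2] b1 b2 Sle) auto
  also have "\<dots> = CC * S" by (simp add: CC_def algebra_simps)
  finally have XS: "X \<le> CC * S" .
  have CC0: "CC \<ge> 0" unfolding CC_def using C E0 by (intro add_nonneg_nonneg mult_nonneg_nonneg) auto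
  define tot where "tot = total_error \<Omega> y p u lam yT pT uT lamT"
  have tot: "tot\<^sup>2 = Ey\<^sup>2 + Ep\<^sup>2 + Eu\<^sup>2 + El\<^sup>2" "tot \<ge> 0"
    by (auto simp: tot_def total_error_def Ey_def Ep_def Eu_def El_def)
  have nn: "Of \<ge> 0" "Oy \<ge> 0" by (auto simp: Of_def Oy_def osc_nonneg)
  have "S = tot\<^sup>2 + Of\<^sup>2 + Oy\<^sup>2" by (simp add: S_def tot(1))
  also have "\<dots> \<le> (tot + Of + Oy)\<^sup>2" using tot(2) nn by (simp add: power2_eq_square algebra_simps)
  finally have "sqrt S \<le> tot + Of + Oy" using tot(2) nn by (intro real_le_lsqrt) auto
  then have "sqrt CC * sqrt S \<le> sqrt CC * (tot + Of + Oy)" by (intro mult_left_mono) (auto simp: CC0)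
  moreover have "sqrt X \<le> sqrt CC * sqrt S" using XS by (simp flip: real_sqrt_mult)
  moreover have "estimator \<T> C1 C2 C3 C4 \<alpha> \<beta> a b f y\<^sub>\<Omega> yT pT uT lamT = sqrt X"
    by (simp add: estimator_def X_def)
  ultimately show ?thesis by (simp only: CC_def tot_def Of_def Oy_def)
qed

theorem theorem5p7:
  fixes \<Omega> :: "'a::euclidean_space set"
    and \<T>\<^sub>0 :: "'a set set" and \<TT> :: "'a set set set"
    and \<alpha> \<beta> a b C\<^sub>s\<^sub>t C\<^sub>a\<^sub>d C\<^sub>c\<^sub>t C\<^sub>s\<^sub>g :: real and l :: nat
  assumes "DIM('a) = 2 \<or> DIM('a) = 3"
    and "polytopal_lipschitz_domain \<Omega>"
    and "mesh_family \<Omega> \<T>\<^sub>0 \<TT>"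
    and "\<alpha> > 0" and "\<beta> > 0" and "a < 0" and "0 < b"
    and "C\<^sub>s\<^sub>t > 0" and "C\<^sub>a\<^sub>d > 0" and "C\<^sub>c\<^sub>t > 0" and "C\<^sub>s\<^sub>g > 0"
    and "l = 0 \<or> l = 1"
  shows "\<exists>C>0. \<forall>f y\<^sub>\<Omega>. f \<in> L2 \<Omega> \<and> y\<^sub>\<Omega> \<in> L2 \<Omega> \<and>
      reliable \<Omega> \<TT> C\<^sub>s\<^sub>t C\<^sub>a\<^sub>d C\<^sub>c\<^sub>t C\<^sub>s\<^sub>g \<alpha> \<beta> a b f y\<^sub>\<Omega> \<longrightarrow>
      (\<forall>\<T>\<in>\<TT>. \<forall>y p u lam y\<^sub>T p\<^sub>T u\<^sub>T lam\<^sub>T.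
         optimal \<Omega> \<alpha> \<beta> a b f y\<^sub>\<Omega> y p u lam \<and>
         discrete_optimal \<Omega> \<T> \<alpha> \<beta> a b f y\<^sub>\<Omega> y\<^sub>T p\<^sub>T u\<^sub>T lam\<^sub>T \<longrightarrow>
         estimator \<T> C\<^sub>s\<^sub>t C\<^sub>a\<^sub>d C\<^sub>c\<^sub>t C\<^sub>s\<^sub>g \<alpha> \<beta> a b f y\<^sub>\<Omega> y\<^sub>T p\<^sub>T u\<^sub>T lam\<^sub>T
           \<le> C * (total_error \<Omega> y p u lam y\<^sub>T p\<^sub>T u\<^sub>T lam\<^sub>T + osc l 0 f \<T> + osc l 0 y\<^sub>\<Omega> \<T>))"
proof -
  obtain \<sigma>' where \<sigma>': "\<forall>\<T>\<in>\<TT>. \<forall>K\<in>\<T>. \<exists>c. \<exists>r>0. cball c r \<subseteq> K \<and> diameter K \<le> \<sigma>' * r"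
    using assms(3) by (auto simp: mesh_family_def shape_regular_def)
  \<comment> \<open>Shape regularity provides only some real constant; enlarging it to at least 1
    preserves the property.\<close>
  define \<sigma> where "\<sigma> = max \<sigma>' 1"
  have fe: "fe_mesh \<Omega> \<T> \<sigma>" if \<T>: "\<T> \<in> \<TT>" for \<T>
  proof
    show "conforming_mesh \<Omega> \<T>" using assms(3) \<T> by (simp add: mesh_family_def)
    show "\<exists>c. \<exists>r>0. cball c r \<subseteq> K \<and> diameter K \<le> \<sigma> * r" if K: "K \<in> \<T>" for K
    proof -
      obtain c r where cr: "r > 0" "cball c r \<subseteq> K" "diameter K \<le> \<sigma>' * r" using \<sigma>' \<T> K by blast
      have "\<sigma>' * r \<le> \<sigma> * r" using cr(1) by (intro mult_right_mono) (auto simp: \<sigma>_def)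
      with cr(3) have "diameter K \<le> \<sigma> * r" by linarith
      then show ?thesis using cr by blast
    qed
  qed (use assms(1,2) in \<open>auto simp: \<sigma>_def\<close>)
  have "bounded \<Omega>" using assms(2) by (simp add: polytopal_lipschitz_domain_def)
  \<comment> \<open>\<open>R\<close> depends on the domain alone, so the Poincare constant is shared
    by all meshes and all data.\<close>
  then obtain R where R: "R > 0" "\<Omega> \<subseteq> ball 0 R" using bounded_subset_ballD by blast
  define D where "D = diameter (closure \<Omega>)"
  define P where "P = 2 * (R + 1)"
  define E where "E = residual_const TYPE('a) \<sigma> D"
  have D0: "D \<ge> 0" unfolding D_def by (rule diameter_ge_0[OF bounded_closure[OF \<open>bounded \<Omega>\<close>]])
  have \<sigma>1: "\<sigma> \<ge> 1" by (simp add: \<sigma>_def)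
  have E0: "E \<ge> 0"
    unfolding E_def residual_const_def using interior_const_pos[OF \<sigma>1, where 'a='a] side_const_nonneg[OF \<sigma>1 D0, where 'a='a]
    by (intro add_nonneg_nonneg mult_nonneg_nonneg) auto
  define C where "C = sqrt (C\<^sub>s\<^sub>t * E * (1 + D\<^sup>2) + C\<^sub>a\<^sub>d * E * (1 + D\<^sup>2 * P\<^sup>2) + C\<^sub>c\<^sub>t * (2 * (2/\<alpha> * P)\<^sup>2 + 2) + C\<^sub>s\<^sub>g * (2 * (1/\<beta> * P)\<^sup>2 + 2))"
  \<comment> \<open>Strict positivity comes from the summand 2 multiplied by
    \<open>C\<^sub>s\<^sub>g\<close>; the other terms need only be nonnegative.\<close>
  have "C > 0"
    unfolding C_def using assms(8-11) E0
    by (intro real_sqrt_gt_zero add_nonneg_pos add_nonneg_nonneg mult_nonneg_nonneg mult_pos_pos) auto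
  moreover have "estimator \<T> C\<^sub>s\<^sub>t C\<^sub>a\<^sub>d C\<^sub>c\<^sub>t C\<^sub>s\<^sub>g \<alpha> \<beta> a b f y\<^sub>\<Omega> yT pT uT lamT
           \<le> C * (total_error \<Omega> y p u lam yT pT uT lamT + osc l 0 f \<T> + osc l 0 y\<^sub>\<Omega> \<T>)"
    if "f \<in> L2 \<Omega>" "y\<^sub>\<Omega> \<in> L2 \<Omega>" "\<T> \<in> \<TT>" "optimal \<Omega> \<alpha> \<beta> a b f y\<^sub>\<Omega> y p u lam"
      "discrete_optimal \<Omega> \<T> \<alpha> \<beta> a b f y\<^sub>\<Omega> yT pT uT lamT" for f y\<^sub>\<Omega> \<T> y p u lam yT pT uT lamT
    unfolding C_def E_def D_def P_def
    by (rule estimator_bound[OF fe[OF that(3)] R(2,1) assms(4-12) that(1,2,4,5)])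
  ultimately show ?thesis by blast
qed

end
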